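(* Let $n,K\ge 1$ be integers and let $\boldsymbol{A}_1,\ldots,\boldsymbol{A}_K$ be i.i.d. random matrices from $\mathrm{GUE}(n)$. Then the joint probability density function of the eigenvalues $\boldsymbol{s}=(s_1,\ldots,s_n)$ of the sum $\boldsymbol{S}=\sum_{k=1}^K\boldsymbol{A}_k$ is $$ p_{\boldsymbol{S},K}(\boldsymbol{s})=\frac{\left(\frac2K\right)^{\binom n2}}{(K\pi)^{\frac n2}\prod_{j=1}^nj!}\,\Delta(\boldsymbol{s})^2\exp\left(-\frac1K\langle\boldsymbol{s},\boldsymbol{s}\rangle\right),\qquad \boldsymbol{s}\in\mathbb{R}^n. $$
   Context: $\mathrm{GUE}(n)$ is the ensemble of random Hermitian matrices $\boldsymbol{A}=\frac12(\boldsymbol{Z}+\boldsymbol{Z}^\dagger)$, where $\boldsymbol{Z}=(z_{ij})_{n\times n}$ has i.i.d. standard complex Gaussian entries, i.e. the real and imaginary parts of $z_{ij}$ are independent $N(0,\frac12)$ real normal variables (mean $0$, variance $\frac12$). Equivalently, $\boldsymbol{A}$ has density $\frac{2^{\binom n2}}{\pi^{n^2/2}}\exp(-\operatorname{Tr}(\boldsymbol{A}^2))$ with respect to Lebesgue measure on the diagonal entries and the real and imaginary parts of the strictly upper triangular entries. $\Delta(\boldsymbol{s})=\prod_{1\le i<j\le n}(s_i-s_j)$, and $\langle\cdot,\cdot\rangle$ is the Euclidean inner product on $\mathbb{R}^n$. The joint eigenvalue density is that of the unordered eigenvalues: a density on all of $\mathbb{R}^n$, symmetric under permutations of $s_1,\ldots,s_n$.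 *)

theory Defs
  imports
    "HOL-Probability.Probability"
    "HOL-Combinatorics.Permutations"
    "Jordan_Normal_Form.Schur_Decomposition"
begin

definition hermitian_mats :: "nat \<Rightarrow> complex mat set" where
  "hermitian_mats n = {A \<in> carrier_mat n n. mat_adjoint A = A}"

(* The Borel sigma-algebra on Hermitian n x n matrices: the one generated by the entries.
   As a measure, vimage_algebra is null; only the sigma-algebra is used. *)
definition hermitian_borel :: "nat \<Rightarrow> complex mat measure" where
  "hermitian_borel n =
     vimage_algebra (hermitian_mats n)
       (\<lambda>A. \<lambda>ij\<in>{..<n} \<times> {..<n}. A $$ ij)
       (\<Pi>\<^sub>M ij\<in>{..<n} \<times> {..<n}. (borel :: complex measure))"

(* normal_density takes the standard deviation, so variance 1/2 is sqrt (1/2). *)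
definition std_complex_gaussian :: "complex measure" where
  "std_complex_gaussian =
     distr (density lborel (normal_density 0 (sqrt (1/2)))
              \<Otimes>\<^sub>M density lborel (normal_density 0 (sqrt (1/2))))
       borel (\<lambda>(x, y). Complex x y)"

definition hermitian_part :: "complex mat \<Rightarrow> complex mat" where
  "hermitian_part Z = (1/2) \<cdot>\<^sub>m (Z + mat_adjoint Z)"

definition GUE :: "nat \<Rightarrow> complex mat measure" where
  "GUE n =
     distr (\<Pi>\<^sub>M ij\<in>{..<n} \<times> {..<n}. std_complex_gaussian)
       (hermitian_borel n) (\<lambda>z. hermitian_part (Matrix.mat n n z))"

definition iid_GUE :: "'w measure \<Rightarrow> nat \<Rightarrow> nat set \<Rightarrow> (nat \<Rightarrow> 'w \<Rightarrow> complex mat) \<Rightarrow> bool" where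
  "iid_GUE M n I A \<longleftrightarrow>
     prob_space.indep_vars M (\<lambda>_. hermitian_borel n) A I \<and>
     (\<forall>k\<in>I. distr M (hermitian_borel n) (A k) = GUE n)"

definition sum_mats :: "nat \<Rightarrow> ('i \<Rightarrow> complex mat) \<Rightarrow> 'i set \<Rightarrow> complex mat" where
  "sum_mats n B I = Matrix.mat n n (\<lambda>ij. \<Sum>k\<in>I. B k $$ ij)"

(* Eigenvalues with algebraic multiplicity, in increasing order.  Re only changes the type:
   the eigenvalues of a Hermitian matrix are real. *)
definition eigvals :: "complex mat \<Rightarrow> real list" where
  "eigvals A = sorted_list_of_multiset (image_mset Re (proots (char_poly A)))"

(* The unordered eigenvalues of S form the vector obtained from the ordered ones by an independent
   uniformly random permutation of the labels.  R^n is the set of extensional functions on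
   {..<n}, so the components s_1, ..., s_n are s 0, ..., s (n - 1). *)
definition joint_eigenvalue_density ::
    "'w measure \<Rightarrow> nat \<Rightarrow> ('w \<Rightarrow> complex mat) \<Rightarrow> ((nat \<Rightarrow> real) \<Rightarrow> real) \<Rightarrow> bool" where
  "joint_eigenvalue_density M n S p \<longleftrightarrow>
     (\<forall>s \<in> {..<n} \<rightarrow>\<^sub>E UNIV. 0 \<le> p s) \<and>
     (\<forall>s \<in> {..<n} \<rightarrow>\<^sub>E UNIV. \<forall>\<pi>. \<pi> permutes {..<n} \<longrightarrow> p (s \<circ> \<pi>) = p s) \<and>
     distributed (M \<Otimes>\<^sub>M uniform_count_measure {\<pi>. \<pi> permutes {..<n}})
       (\<Pi>\<^sub>M i\<in>{..<n}. lborel)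
       (\<lambda>(\<omega>, \<pi>). \<lambda>i\<in>{..<n}. eigvals (S \<omega>) ! \<pi> i)
       (\<lambda>s. ennreal (p s))"

definition vandermonde :: "nat \<Rightarrow> (nat \<Rightarrow> real) \<Rightarrow> real" where
  "vandermonde n s = (\<Prod>j<n. \<Prod>i<j. s i - s j)"

end

theory Submission
  imports Defs
begin

text \<open>A sum of \<open>K\<close> independent GUE matrices is a Gaussian Hermitian matrix whose entries have \<open>K\<close> times the variance.
  The eigenvalue density of such a matrix \<open>H\<close> of size \<open>n + 1\<close> is found by induction on \<open>n\<close>.  Let \<open>m\<close> be the
  spectrum of its upper left corner of size \<open>n\<close>, and let \<open>v\<close> and \<open>a\<close> be the rest of the last column.  As the law of \<open>v\<close>
  is invariant under unitary maps, the corner may be replaced by the diagonal matrix of \<open>m\<close>.  The spectrum \<open>l\<close> of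
  the resulting arrow matrix interlaces \<open>m\<close> and depends only on \<open>a\<close> and on the independent exponential
  variables \<open>r\<^sub>i = |v\<^sub>i|\<^sup>2\<close>, which are the coefficients in the partial fraction expansion of
  \<open>(\<Prod>i. x - l\<^sub>i) / (\<Prod>i. x - m\<^sub>i)\<close>.  For fixed \<open>m\<close> the map \<open>l \<mapsto> (r, a)\<close> has Jacobian \<open>\<Delta>(l) / \<Delta>(m)\<close>, and
  \<open>\<Sum>i. l\<^sub>i\<^sup>2 = (\<Sum>i. m\<^sub>i\<^sup>2) + a\<^sup>2 + 2 (\<Sum>i. r\<^sub>i)\<close>.  So the pair \<open>(m, l)\<close> has a density proportional to
  \<open>\<Delta>(m) \<Delta>(l) exp (- (\<Sum>i. l\<^sub>i\<^sup>2) / K)\<close> on interlacing pairs, and integrating \<open>\<Delta>(m)\<close> over all \<open>m\<close> that interlace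
  \<open>l\<close> gives \<open>\<Delta>(l) / n!\<close>.\<close>

section \<open>Gaussian product measures\<close>

text \<open>The classical route diagonalises the whole matrix and needs the Jacobian of a map on n^2
  real coordinates. Growing the matrix by one row and column at a time leaves only one-dimensional
  substitutions. The obstacle is that the parameters m of the substitution are random themselves:
  the change of variables is therefore proved for fixed m, by an induction of its own, and m is
  integrated out afterwards.

  All laws are compared by integrating arbitrary nonnegative measurable functions. Iterated
  integrals can then be rearranged without integrability conditions, and almost sure simplicity of
  the spectrum comes out of the formula, whose right-hand side lives on strictly increasing
  sequences.

  With c = K, the step from n to n + 1 contributes (2/c)^n from n exponential densities, 1/sqrt(c
  pi) from the normal density of a, and 1/n! from the integral over m. Labelling the n eigenvalues
  at random divides once more by n!, which completes the product of factorials.\<close>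

definition rgauss :: "real \<Rightarrow> real measure" where
  "rgauss s = density lborel (\<lambda>x. ennreal (normal_density 0 s x))"

text \<open>\<open>s\<close> is the standard deviation of the real part and of the imaginary part,
  so the mean of \<open>(cmod z)\<^sup>2\<close> is \<open>2 * s\<^sup>2\<close>; the standard
  complex Gaussian has \<open>s = sqrt (1/2)\<close>.\<close>

definition cgauss :: "real \<Rightarrow> complex measure" where
  "cgauss s = distr (rgauss s \<Otimes>\<^sub>M rgauss s) borel (\<lambda>(x, y). Complex x y)"

lemma sets_rgauss[measurable_cong, simp]: "sets (rgauss s) = sets borel"
  and space_rgauss[simp]: "space (rgauss s) = UNIV"
  by (simp_all add: rgauss_def)

lemma sets_cgauss[measurable_cong, simp]: "sets (cgauss s) = sets borel"
  and space_cgauss[simp]: "space (cgauss s) = UNIV"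
  by (simp_all add: cgauss_def)

lemma measurable_cgauss1[simp]: "measurable N (cgauss s) = borel_measurable N"
  by (rule measurable_cong_sets) auto

lemma measurable_cgauss2[simp]: "measurable (cgauss s) N = measurable borel N"
  by (rule measurable_cong_sets) auto

lemma std_complex_gaussian_eq: "std_complex_gaussian = cgauss (sqrt (1/2))"
  by (simp add: std_complex_gaussian_def cgauss_def rgauss_def)

lemma measurable_Complex[measurable (raw)]:
  assumes "f \<in> borel_measurable M" "g \<in> borel_measurable M"
  shows "(\<lambda>x. Complex (f x) (g x)) \<in> borel_measurable M"
  unfolding Complex_eq using assms by measurable

lemma prob_space_rgauss: "0 < s \<Longrightarrow> prob_space (rgauss s)"
  unfolding rgauss_def by (rule prob_space_normal_density)

lemma prob_space_cgauss: assumes "0 < s" shows "prob_space (cgauss s)"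
proof -
  interpret R: prob_space "rgauss s" using assms by (rule prob_space_rgauss)
  interpret RR: pair_prob_space "rgauss s" "rgauss s" ..
  show ?thesis unfolding cgauss_def by (rule RR.prob_space_distr) measurable
qed

lemma nn_integral_cgauss:
  assumes "0 < s" and [measurable]: "f \<in> borel_measurable borel"
  shows "(\<integral>\<^sup>+z. f z \<partial>cgauss s) = (\<integral>\<^sup>+x. \<integral>\<^sup>+y. f (Complex x y) \<partial>rgauss s \<partial>rgauss s)"
proof -
  interpret R: prob_space "rgauss s" using assms(1) by (rule prob_space_rgauss)
  interpret RR: pair_prob_space "rgauss s" "rgauss s" ..
  have "(\<integral>\<^sup>+z. f z \<partial>cgauss s) = (\<integral>\<^sup>+p. f (case p of (x, y) \<Rightarrow> Complex x y) \<partial>(rgauss s \<Otimes>\<^sub>M rgauss s))"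
    unfolding cgauss_def by (subst nn_integral_distr) auto
  also have "\<dots> = (\<integral>\<^sup>+x. \<integral>\<^sup>+y. f (Complex x y) \<partial>rgauss s \<partial>rgauss s)"
    by (subst R.nn_integral_fst[symmetric]) auto
  finally show ?thesis .
qed

section \<open>Linear combinations of independent Gaussian variables\<close>

lemma distr_rgauss_mult:
  assumes "0 < s" "c \<noteq> 0"
  shows "distr (rgauss s) borel (\<lambda>x. c * x) = rgauss (\<bar>c\<bar> * s)"
proof -
  interpret R: prob_space "rgauss s" using assms(1) by (rule prob_space_rgauss)
  have "distributed (rgauss s) lborel (\<lambda>x. x) (normal_density 0 s)"
    unfolding distributed_def
    by (auto simp: rgauss_def distr_id2 intro!: distr_id2)
  from R.normal_density_affine[OF this assms, of 0]
  have "distr (rgauss s) lborel (\<lambda>x. c * x) = density lborel (normal_density 0 (\<bar>c\<bar> * s))"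
    by (simp add: distributed_def)
  then show ?thesis unfolding rgauss_def[of "\<bar>c\<bar> * s"]
    by (metis (no_types, lifting) distr_cong sets_lborel)
qed

text \<open>Rescaling both variables reduces the claim to the convolution of two centred normal
  densities. The law is expressed through a test function and an iterated integral because an
  induction over the coordinates of a product measure consumes it in this form.\<close>

lemma nn_integral_rgauss_linear:
  fixes f :: "real \<Rightarrow> ennreal"
  assumes "0 < s" "0 < t" "a \<noteq> 0" "b \<noteq> 0" and [measurable]: "f \<in> borel_measurable borel"
  shows "(\<integral>\<^sup>+x. \<integral>\<^sup>+y. f (a * x + b * y) \<partial>rgauss t \<partial>rgauss s) =
    (\<integral>\<^sup>+x. f x \<partial>rgauss (sqrt ((a * s)\<^sup>2 + (b * t)\<^sup>2)))"
proof -
  have p: "0 < \<bar>a\<bar> * s" "0 < \<bar>b\<bar> * t" using assms by auto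
  interpret A: prob_space "rgauss (\<bar>a\<bar> * s)" using p by (intro prob_space_rgauss)
  interpret B: prob_space "rgauss (\<bar>b\<bar> * t)" using p by (intro prob_space_rgauss)
  have "(\<integral>\<^sup>+x. \<integral>\<^sup>+y. f (a * x + b * y) \<partial>rgauss t \<partial>rgauss s) =
      (\<integral>\<^sup>+x. \<integral>\<^sup>+y. f (a * x + y) \<partial>rgauss (\<bar>b\<bar> * t) \<partial>rgauss s)"
    unfolding distr_rgauss_mult[OF \<open>0 < t\<close> \<open>b \<noteq> 0\<close>, symmetric]
    by (intro nn_integral_cong, subst nn_integral_distr) auto
  also have "\<dots> = (\<integral>\<^sup>+x. \<integral>\<^sup>+y. f (x + y) \<partial>rgauss (\<bar>b\<bar> * t) \<partial>rgauss (\<bar>a\<bar> * s))"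
    unfolding distr_rgauss_mult[OF \<open>0 < s\<close> \<open>a \<noteq> 0\<close>, symmetric]
    by (subst nn_integral_distr) auto
  also have "\<dots> = (\<integral>\<^sup>+x. f x \<partial>(rgauss (\<bar>a\<bar> * s) \<star> rgauss (\<bar>b\<bar> * t)))"
    using A.finite_measure_axioms B.finite_measure_axioms by (intro nn_integral_convolution[symmetric]) auto
  also have "rgauss (\<bar>a\<bar> * s) \<star> rgauss (\<bar>b\<bar> * t) = rgauss (sqrt ((\<bar>a\<bar> * s)\<^sup>2 + (\<bar>b\<bar> * t)\<^sup>2))"
    using A.finite_measure_axioms B.finite_measure_axioms conv_normal_density_zero_mean[OF p]
    unfolding rgauss_def by (subst convolution_density) (auto simp: ennreal_mult)
  finally show ?thesis by (simp add: power_mult_distrib)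
qed

text \<open>Real and imaginary parts are two instances of the real case once Fubini has brought the
  partners together. The separate coefficient \<open>b'\<close> covers conjugation:
  \<open>b' = b\<close> serves the sum of two Gaussians, \<open>b' = - b\<close> the symmetrisation
  \<open>(z + cnj w) / 2\<close>.\<close>

lemma nn_integral_cgauss_linear:
  fixes f :: "complex \<Rightarrow> ennreal"
  assumes "0 < s" "0 < t" "a \<noteq> 0" "b \<noteq> 0" "\<bar>b'\<bar> = \<bar>b\<bar>" and [measurable]: "f \<in> borel_measurable borel"
  shows "(\<integral>\<^sup>+z. \<integral>\<^sup>+w. f (Complex (a * Re z + b * Re w) (a * Im z + b' * Im w)) \<partial>cgauss t \<partial>cgauss s) =
    (\<integral>\<^sup>+z. f z \<partial>cgauss (sqrt ((a * s)\<^sup>2 + (b * t)\<^sup>2)))"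
proof -
  define u where "u = sqrt ((a * s)\<^sup>2 + (b * t)\<^sup>2)"
  have b'2: "(b' * t)\<^sup>2 = (b * t)\<^sup>2" using assms(5) by (metis power2_abs abs_mult)
  have b': "b' \<noteq> 0" using assms by auto
  have u: "0 < u" using assms by (simp add: u_def add_pos_nonneg)
  interpret A: prob_space "rgauss s" using assms by (intro prob_space_rgauss)
  interpret B: prob_space "rgauss t" using assms by (intro prob_space_rgauss)
  interpret U: prob_space "rgauss u" using u by (intro prob_space_rgauss)
  interpret AB: pair_prob_space "rgauss s" "rgauss t" ..
  interpret C: prob_space "cgauss t" using assms by (intro prob_space_cgauss)
  have "(\<integral>\<^sup>+z. \<integral>\<^sup>+w. f (Complex (a * Re z + b * Re w) (a * Im z + b' * Im w)) \<partial>cgauss t \<partial>cgauss s) =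
      (\<integral>\<^sup>+x. \<integral>\<^sup>+y. \<integral>\<^sup>+w. f (Complex (a * x + b * Re w) (a * y + b' * Im w)) \<partial>cgauss t \<partial>rgauss s \<partial>rgauss s)"
    using assms(1) by (subst nn_integral_cgauss) auto
  also have "\<dots> = (\<integral>\<^sup>+x. \<integral>\<^sup>+y. \<integral>\<^sup>+x'. \<integral>\<^sup>+y'. f (Complex (a * x + b * x') (a * y + b' * y'))
      \<partial>rgauss t \<partial>rgauss t \<partial>rgauss s \<partial>rgauss s)"
    using assms(2) by (intro nn_integral_cong, subst nn_integral_cgauss) auto
  also have "\<dots> = (\<integral>\<^sup>+x. \<integral>\<^sup>+x'. \<integral>\<^sup>+y. \<integral>\<^sup>+y'. f (Complex (a * x + b * x') (a * y + b' * y'))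
      \<partial>rgauss t \<partial>rgauss s \<partial>rgauss t \<partial>rgauss s)"
    by (intro nn_integral_cong AB.Fubini'[symmetric]) measurable
  also have "\<dots> = (\<integral>\<^sup>+x. \<integral>\<^sup>+x'. \<integral>\<^sup>+y. f (Complex (a * x + b * x') y) \<partial>rgauss u \<partial>rgauss t \<partial>rgauss s)"
    using b' b'2 assms by (intro nn_integral_cong, subst nn_integral_rgauss_linear) (auto simp: u_def)
  also have "\<dots> = (\<integral>\<^sup>+x. \<integral>\<^sup>+y. f (Complex x y) \<partial>rgauss u \<partial>rgauss u)"
  proof -
    have "(\<lambda>x. \<integral>\<^sup>+y. f (Complex x y) \<partial>rgauss u) \<in> borel_measurable borel" by measurable
    from nn_integral_rgauss_linear[OF assms(1-4) this] show ?thesis by (simp add: u_def[symmetric])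
  qed
  also have "\<dots> = (\<integral>\<^sup>+z. f z \<partial>cgauss u)"
    using u by (subst nn_integral_cgauss) auto
  finally show ?thesis by (simp add: u_def)
qed

lemma nn_integral_cgauss_add:
  assumes "0 < s" "0 < t" "f \<in> borel_measurable borel"
  shows "(\<integral>\<^sup>+z. \<integral>\<^sup>+w. f (z + w) \<partial>cgauss t \<partial>cgauss s) = (\<integral>\<^sup>+z. f z \<partial>cgauss (sqrt (s\<^sup>2 + t\<^sup>2)))"
  using nn_integral_cgauss_linear[of s t 1 1 1 f] assms by (simp add: complex_eq_iff plus_complex.code)

lemma nn_integral_cgauss_hermitian:
  assumes "0 < s" "f \<in> borel_measurable borel"
  shows "(\<integral>\<^sup>+z. \<integral>\<^sup>+w. f ((z + cnj w) / 2) \<partial>cgauss s \<partial>cgauss s) = (\<integral>\<^sup>+z. f z \<partial>cgauss (s / sqrt 2))"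
proof -
  have "sqrt ((1 / 2 * s)\<^sup>2 + (1 / 2 * s)\<^sup>2) = s / sqrt 2"
    using assms(1) by (intro real_sqrt_unique) (auto simp: power2_eq_square)
  moreover have "Complex (1 / 2 * Re z + 1 / 2 * Re w) (1 / 2 * Im z + - (1 / 2) * Im w) = (z + cnj w) / 2" for z w
    by (simp add: complex_eq_iff)
  ultimately show ?thesis
    using nn_integral_cgauss_linear[of s s "1/2" "1/2" "-(1/2)" f] assms by (simp only:) simp
qed

text \<open>Meant for the diagonal of the Hermitian part, where an entry is averaged with its own
  conjugate: there the width stays \<open>s\<close>, while two independent entries give
  \<open>s / sqrt 2\<close>.\<close>

lemma nn_integral_cgauss_Re:
  fixes f :: "real \<Rightarrow> ennreal"
  assumes "0 < s" "f \<in> borel_measurable borel"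
  shows "(\<integral>\<^sup>+z. f (Re z) \<partial>cgauss s) = (\<integral>\<^sup>+x. f x \<partial>rgauss s)"
proof -
  interpret R: prob_space "rgauss s" using assms(1) by (rule prob_space_rgauss)
  show ?thesis
    using assms R.emeasure_space_1 by (subst nn_integral_cgauss) auto
qed

section \<open>The squared modulus of a complex Gaussian variable\<close>

lemma lborel_complex: "(lborel :: complex measure) = distr (lborel \<Otimes>\<^sub>M lborel) borel (\<lambda>(x, y). Complex x y)"
proof (rule lborel_eqI)
  fix l u :: complex assume le: "\<And>b. b \<in> Basis \<Longrightarrow> l \<bullet> b \<le> u \<bullet> b"
  have le: "Re l \<le> Re u" "Im l \<le> Im u" using le[of 1] le[of \<i>] by (auto simp: Basis_complex_def)
  have "(\<lambda>(x, y). Complex x y) -` box l u = {Re l<..<Re u} \<times> {Im l<..<Im u}"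
    by (auto simp: box_def Basis_complex_def)
  then show "emeasure (distr (lborel \<Otimes>\<^sub>M lborel) borel (\<lambda>(x, y). Complex x y)) (box l u) =
      ennreal (\<Prod>b\<in>Basis. (u - l) \<bullet> b)"
    using le by (subst emeasure_distr)
      (auto simp: space_pair_measure lborel.emeasure_pair_measure_Times Basis_complex_def ennreal_mult')
qed simp

text \<open>With respect to planar Lebesgue measure the density depends on \<open>cmod z\<close>
  alone. Invariance under unitary maps and the exponential law of the squared modulus both rest on
  this.\<close>

lemma cgauss_eq_density:
  assumes "0 < s"
  shows "cgauss s = density lborel (\<lambda>z. ennreal (exp (- (cmod z)\<^sup>2 / (2 * s\<^sup>2)) / (2 * pi * s\<^sup>2)))"
proof -
  interpret R: prob_space "rgauss s" using assms by (rule prob_space_rgauss)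
  have "rgauss s \<Otimes>\<^sub>M rgauss s = density (lborel \<Otimes>\<^sub>M lborel)
      (\<lambda>(x, y). ennreal (normal_density 0 s x) * ennreal (normal_density 0 s y))"
    using R.sigma_finite_measure_axioms unfolding rgauss_def
    by (intro pair_measure_density sigma_finite_lborel) auto
  also have "(\<lambda>(x, y). ennreal (normal_density 0 s x) * ennreal (normal_density 0 s y)) =
      (\<lambda>p. ennreal (exp (- (cmod (case p of (x, y) \<Rightarrow> Complex x y))\<^sup>2 / (2 * s\<^sup>2)) / (2 * pi * s\<^sup>2)))"
  proof (rule ext, clarify)
    fix x y :: real
    have "normal_density 0 s x * normal_density 0 s y =
        exp (- x\<^sup>2 / (2 * s\<^sup>2)) * exp (- y\<^sup>2 / (2 * s\<^sup>2)) / (sqrt (2 * pi * s\<^sup>2) * sqrt (2 * pi * s\<^sup>2))"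
      by (simp add: normal_density_def)
    also have "\<dots> = exp (- (cmod (Complex x y))\<^sup>2 / (2 * s\<^sup>2)) / (2 * pi * s\<^sup>2)"
      by (simp add: exp_add[symmetric] cmod_power2 add_divide_distrib diff_divide_distrib)
    finally show "ennreal (normal_density 0 s x) * ennreal (normal_density 0 s y) =
       ennreal (exp (- (cmod (Complex x y))\<^sup>2 / (2 * s\<^sup>2)) / (2 * pi * s\<^sup>2))"
      by (simp add: ennreal_mult[symmetric])
  qed
  finally show ?thesis
    unfolding cgauss_def lborel_complex by (subst density_distr) auto
qed

text \<open>The disc of squared radius t has area \<open>t * pi\<close>, which is linear in t, so
  the squared modulus carries the plane to pi times Lebesgue measure on the positive half line. It
  suffices to compare the two measures on the sets \<open>{..t}\<close>.\<close>

lemma nn_integral_lborel_cmod_square: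
  fixes f :: "real \<Rightarrow> ennreal"
  assumes [measurable]: "f \<in> borel_measurable borel"
  shows "(\<integral>\<^sup>+z. f ((cmod z)\<^sup>2) \<partial>lborel) = (\<integral>\<^sup>+r. (if 0 < r then ennreal pi * f r else 0) \<partial>lborel)"
proof -
  let ?M = "distr lborel borel (\<lambda>z. (cmod z)\<^sup>2)"
  let ?N = "density lborel (\<lambda>r::real. if 0 < r then ennreal pi else 0)"
  have "?M = ?N"
  proof (rule measure_eqI_generator_eq)
    show "Int_stable (range atMost :: real set set)"
      by (auto simp: Int_stable_def)
    show "range atMost \<subseteq> Pow (UNIV :: real set)" by auto
    show "emeasure ?M X = emeasure ?N X" if "X \<in> range atMost" for X
    proof -
      obtain t where X: "X = {..t}" using \<open>X \<in> range atMost\<close> by auto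
      have vol: "unit_ball_vol (real DIM(complex)) = pi"
        by (simp add: unit_ball_vol_2)
      have "emeasure ?M X = ennreal (max 0 t * pi)"
      proof (cases "0 \<le> t")
        case True
        have "(\<lambda>z. (cmod z)\<^sup>2) -` X = cball 0 (sqrt t)"
        proof -
          have "(cmod z)\<^sup>2 \<le> t \<longleftrightarrow> cmod z \<le> sqrt t" for z
            using real_sqrt_le_iff[of "(cmod z)\<^sup>2" t] by simp
          then show ?thesis by (auto simp: X)
        qed
        moreover have "emeasure lborel (cball 0 (sqrt t) :: complex set) = ennreal (t * pi)"
          using True by (subst emeasure_cball) (auto simp: vol unit_ball_vol_2 mult.commute)
        ultimately show ?thesis using True by (simp add: emeasure_distr X)
      next
        case False
        have "(\<lambda>z. (cmod z)\<^sup>2) -` X = {}"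
          using False by (auto simp: X) (meson order_trans zero_le_power2)
        then show ?thesis using False by (simp add: emeasure_distr X)
      qed
      moreover have "emeasure ?N X = ennreal (max 0 t * pi)"
      proof -
        have "emeasure ?N X = (\<integral>\<^sup>+r. ennreal pi * indicator {0<..t} r \<partial>lborel)"
          unfolding X by (subst emeasure_density) (auto intro!: nn_integral_cong split: split_indicator)
        also have "\<dots> = ennreal pi * emeasure lborel {0<..t}"
          by (subst nn_integral_cmult_indicator) auto
        also have "\<dots> = ennreal (max 0 t * pi)"
          by (cases "0 \<le> t") (auto simp: ennreal_mult' mult.commute)
        finally show ?thesis .
      qed
      ultimately show ?thesis by simp
    qed
    show "sets ?M = sigma_sets UNIV (range atMost)" "sets ?N = sigma_sets UNIV (range atMost)"
    proof -
      have "sets (borel :: real measure) = sigma_sets UNIV (range atMost)"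
        by (subst borel_eq_atMost, subst sets_measure_of) auto
      then show "sets ?M = sigma_sets UNIV (range atMost)" "sets ?N = sigma_sets UNIV (range atMost)"
        by simp_all
    qed
    show "range (\<lambda>n::nat. {..real n}) \<subseteq> range atMost" by auto
    show "(\<Union>i. {..real i}) = UNIV" by (auto intro: real_arch_simple)
    show "emeasure ?M {..real i} \<noteq> \<infinity>" for i
    proof -
      have "emeasure ?M {..real i} \<le> emeasure lborel (cball 0 (sqrt (real i)) :: complex set)"
        by (subst emeasure_distr) (auto intro!: emeasure_mono simp: real_le_rsqrt)
      also have "\<dots> < \<infinity>" by (subst emeasure_cball) auto
      finally show ?thesis by simp
    qed
  qed
  then have "(\<integral>\<^sup>+r. f r \<partial>?M) = (\<integral>\<^sup>+r. f r \<partial>?N)" by simp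
  then show ?thesis
    by (subst (asm) nn_integral_distr, simp, simp, subst (asm) nn_integral_density)
       (auto simp: if_distrib[of "\<lambda>x. x * _"] cong: if_cong)
qed

text \<open>The factor pi from the area cancels the one in the Gaussian density and leaves the
  exponential density of mean \<open>2 * s\<^sup>2\<close>.\<close>

lemma nn_integral_cgauss_cmod_square:
  fixes f :: "real \<Rightarrow> ennreal"
  assumes s: "0 < s" and [measurable]: "f \<in> borel_measurable borel"
  shows "(\<integral>\<^sup>+z. f ((cmod z)\<^sup>2) \<partial>cgauss s) =
    (\<integral>\<^sup>+r. (if 0 < r then ennreal (exp (- r / (2 * s\<^sup>2)) / (2 * s\<^sup>2)) * f r else 0) \<partial>lborel)"
proof -
  have "(\<integral>\<^sup>+z. f ((cmod z)\<^sup>2) \<partial>cgauss s) =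
      (\<integral>\<^sup>+z. ennreal (exp (- (cmod z)\<^sup>2 / (2 * s\<^sup>2)) / (2 * pi * s\<^sup>2)) * f ((cmod z)\<^sup>2) \<partial>lborel)"
    using s by (simp add: cgauss_eq_density nn_integral_density)
  also have "\<dots> = (\<integral>\<^sup>+r. (if 0 < r then ennreal pi * (ennreal (exp (- r / (2 * s\<^sup>2)) / (2 * pi * s\<^sup>2)) * f r) else 0) \<partial>lborel)"
    by (rule nn_integral_lborel_cmod_square[where f = "\<lambda>r. ennreal (exp (- r / (2 * s\<^sup>2)) / (2 * pi * s\<^sup>2)) * f r"]) measurable
  also have "\<dots> = (\<integral>\<^sup>+r. (if 0 < r then ennreal (exp (- r / (2 * s\<^sup>2)) / (2 * s\<^sup>2)) * f r else 0) \<partial>lborel)"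
    by (intro nn_integral_cong) (auto simp: mult.assoc[symmetric] ennreal_mult'[symmetric])
  finally show ?thesis .
qed

section \<open>Coordinatewise changes of variable in finite product measures\<close>

lemma nn_integral_PiM_unary:
  fixes A :: "'a measure" and C :: "'c measure" and F :: "('i \<Rightarrow> 'c) \<Rightarrow> ennreal"
  assumes "finite I" "sigma_finite_measure A" "sigma_finite_measure C"
    and g: "\<And>i. i \<in> I \<Longrightarrow> g i \<in> A \<rightarrow>\<^sub>M C"
    and eq: "\<And>i f. i \<in> I \<Longrightarrow> f \<in> borel_measurable C \<Longrightarrow> (\<integral>\<^sup>+x. f (g i x) \<partial>A) = (\<integral>\<^sup>+x. f x \<partial>C)"
    and "F \<in> borel_measurable (Pi\<^sub>M I (\<lambda>_. C))"
  shows "(\<integral>\<^sup>+x. F (\<lambda>i\<in>I. g i (x i)) \<partial>Pi\<^sub>M I (\<lambda>_. A)) = (\<integral>\<^sup>+x. F x \<partial>Pi\<^sub>M I (\<lambda>_. C))"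
  using assms(1,4-)
proof (induction I arbitrary: F rule: finite_induct)
  case empty
  then show ?case by (simp add: PiM_empty nn_integral_count_space_finite)
next
  case (insert i I)
  interpret A: sigma_finite_measure A by fact
  interpret C: sigma_finite_measure C by fact
  interpret PA: product_sigma_finite "\<lambda>_. A" ..
  interpret PC: product_sigma_finite "\<lambda>_. C" ..
  interpret FA: finite_product_sigma_finite "\<lambda>_. A" I by standard fact
  interpret FC: finite_product_sigma_finite "\<lambda>_. C" I by standard fact
  note [measurable] = insert.prems(3)
  have gi[measurable]: "g i \<in> A \<rightarrow>\<^sub>M C" using insert.prems(1) by auto
  have gI[measurable]: "(\<lambda>x. \<lambda>j\<in>I. g j (x j)) \<in> Pi\<^sub>M I (\<lambda>_. A) \<rightarrow>\<^sub>M Pi\<^sub>M I (\<lambda>_. C)"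
    using insert.prems(1) by (intro measurable_restrict measurable_compose[OF measurable_component_singleton]) auto
  have upd: "(\<lambda>j\<in>insert i I. g j ((x(i := y)) j)) = (\<lambda>j\<in>I. g j (x j))(i := g i y)" for x y
    using insert.hyps by (auto simp: fun_eq_iff)
  have gJ[measurable]: "(\<lambda>x. \<lambda>j\<in>insert i I. g j (x j)) \<in> Pi\<^sub>M (insert i I) (\<lambda>_. A) \<rightarrow>\<^sub>M Pi\<^sub>M (insert i I) (\<lambda>_. C)"
    using insert.prems(1) by (intro measurable_restrict measurable_compose[OF measurable_component_singleton]) auto
  have "(\<integral>\<^sup>+x. F (\<lambda>j\<in>insert i I. g j (x j)) \<partial>Pi\<^sub>M (insert i I) (\<lambda>_. A)) =
      (\<integral>\<^sup>+x. \<integral>\<^sup>+y. F ((\<lambda>j\<in>I. g j (x j))(i := g i y)) \<partial>A \<partial>Pi\<^sub>M I (\<lambda>_. A))"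
    using insert.hyps by (subst PA.product_nn_integral_insert) (simp, simp, measurable, simp only: upd)
  also have "\<dots> = (\<integral>\<^sup>+x. \<integral>\<^sup>+c. F ((\<lambda>j\<in>I. g j (x j))(i := c)) \<partial>C \<partial>Pi\<^sub>M I (\<lambda>_. A))"
  proof (intro nn_integral_cong insert.prems(2))
    fix x assume "x \<in> space (Pi\<^sub>M I (\<lambda>_. A))"
    from measurable_space[OF gI this]
    have [measurable]: "(\<lambda>j\<in>I. g j (x j)) \<in> space (Pi\<^sub>M I (\<lambda>_. C))" .
    show "(\<lambda>c. F ((\<lambda>j\<in>I. g j (x j))(i := c))) \<in> borel_measurable C"
      by measurable
  qed auto
  also have "\<dots> = (\<integral>\<^sup>+x. \<integral>\<^sup>+c. F (x(i := c)) \<partial>C \<partial>Pi\<^sub>M I (\<lambda>_. C))"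
    using insert.prems(1,2) by (intro insert.IH[where F = "\<lambda>x. \<integral>\<^sup>+c. F (x(i := c)) \<partial>C"]) (auto, measurable)
  also have "\<dots> = (\<integral>\<^sup>+x. F x \<partial>Pi\<^sub>M (insert i I) (\<lambda>_. C))"
    using insert.hyps by (subst PC.product_nn_integral_insert) auto
  finally show ?case .
qed

text \<open>Two independent families are combined coordinate by coordinate. Independent random
  matrices supply the order of integration with all x outside all y, so the induction has to
  interleave the two.\<close>

lemma nn_integral_PiM_binary:
  fixes A :: "'a measure" and B :: "'b measure" and C :: "'c measure" and F :: "('i \<Rightarrow> 'c) \<Rightarrow> ennreal"
  assumes "finite I" "sigma_finite_measure A" "sigma_finite_measure B" "sigma_finite_measure C"
    and g: "(\<lambda>(x, y). g x y) \<in> A \<Otimes>\<^sub>M B \<rightarrow>\<^sub>M C"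
    and eq: "\<And>f. f \<in> borel_measurable C \<Longrightarrow> (\<integral>\<^sup>+x. \<integral>\<^sup>+y. f (g x y) \<partial>B \<partial>A) = (\<integral>\<^sup>+x. f x \<partial>C)"
    and "F \<in> borel_measurable (Pi\<^sub>M I (\<lambda>_. C))"
  shows "(\<integral>\<^sup>+x. \<integral>\<^sup>+y. F (\<lambda>i\<in>I. g (x i) (y i)) \<partial>Pi\<^sub>M I (\<lambda>_. B) \<partial>Pi\<^sub>M I (\<lambda>_. A)) =
    (\<integral>\<^sup>+x. F x \<partial>Pi\<^sub>M I (\<lambda>_. C))"
  using assms(1,7)
proof (induction I arbitrary: F rule: finite_induct)
  case empty
  then show ?case by (simp add: PiM_empty nn_integral_count_space_finite)
next
  case (insert i I)
  interpret A: sigma_finite_measure A by fact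
  interpret B: sigma_finite_measure B by fact
  interpret C: sigma_finite_measure C by fact
  interpret PA: product_sigma_finite "\<lambda>_. A" ..
  interpret PB: product_sigma_finite "\<lambda>_. B" ..
  interpret PC: product_sigma_finite "\<lambda>_. C" ..
  interpret FA: finite_product_sigma_finite "\<lambda>_. A" I by standard fact
  interpret FB: finite_product_sigma_finite "\<lambda>_. B" I by standard fact
  interpret FB': finite_product_sigma_finite "\<lambda>_. B" "insert i I" by standard (use insert in auto)
  interpret FC: finite_product_sigma_finite "\<lambda>_. C" I by standard fact
  interpret AB: pair_sigma_finite "Pi\<^sub>M I (\<lambda>_. B)" A ..
  note [measurable] = insert.prems g
  have g2[measurable (raw)]: "(\<lambda>p. g (a p) (b p)) \<in> N \<rightarrow>\<^sub>M C"
    if "a \<in> N \<rightarrow>\<^sub>M A" "b \<in> N \<rightarrow>\<^sub>M B" for a b and N :: "'n measure"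
    using measurable_compose[OF measurable_Pair[OF that] g] by simp
  have G[measurable (raw)]: "(\<lambda>p. \<lambda>j\<in>J. g (a p j) (b p j)) \<in> N \<rightarrow>\<^sub>M Pi\<^sub>M J (\<lambda>_. C)"
    if "a \<in> N \<rightarrow>\<^sub>M Pi\<^sub>M J (\<lambda>_. A)" "b \<in> N \<rightarrow>\<^sub>M Pi\<^sub>M J (\<lambda>_. B)"
    for a b and J :: "'i set" and N :: "'n measure"
    by (intro measurable_restrict g2 measurable_compose[OF that(1) measurable_component_singleton]
        measurable_compose[OF that(2) measurable_component_singleton])
  have upd: "(\<lambda>j\<in>insert i I. g ((x(i := s)) j) ((y(i := t)) j)) = (\<lambda>j\<in>I. g (x j) (y j))(i := g s t)" for x s y t
    using insert.hyps by (auto simp: fun_eq_iff)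
  have "(\<integral>\<^sup>+x. \<integral>\<^sup>+y. F (\<lambda>i\<in>insert i I. g (x i) (y i)) \<partial>Pi\<^sub>M (insert i I) (\<lambda>_. B) \<partial>Pi\<^sub>M (insert i I) (\<lambda>_. A)) =
      (\<integral>\<^sup>+x. \<integral>\<^sup>+s. \<integral>\<^sup>+y. F (\<lambda>j\<in>insert i I. g ((x(i := s)) j) (y j))
        \<partial>Pi\<^sub>M (insert i I) (\<lambda>_. B) \<partial>A \<partial>Pi\<^sub>M I (\<lambda>_. A))"
    using insert.hyps by (intro PA.product_nn_integral_insert) (simp, simp, measurable)
  also have "\<dots> = (\<integral>\<^sup>+x. \<integral>\<^sup>+s. \<integral>\<^sup>+y. \<integral>\<^sup>+t. F ((\<lambda>j\<in>I. g (x j) (y j))(i := g s t))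
        \<partial>B \<partial>Pi\<^sub>M I (\<lambda>_. B) \<partial>A \<partial>Pi\<^sub>M I (\<lambda>_. A))"
    unfolding upd[symmetric]
  proof (intro nn_integral_cong PB.product_nn_integral_insert)
    fix x s assume "x \<in> space (Pi\<^sub>M I (\<lambda>_. A))" "s \<in> space A"
    then have [measurable]: "x(i := s) \<in> space (Pi\<^sub>M (insert i I) (\<lambda>_. A))"
      by (auto simp: space_PiM PiE_def extensional_def)
    show "(\<lambda>y. F (\<lambda>j\<in>insert i I. g ((x(i := s)) j) (y j))) \<in> borel_measurable (Pi\<^sub>M (insert i I) (\<lambda>_. B))"
      by measurable
  qed (use insert.hyps in auto)
  \<comment> \<open>The new coordinate \<open>s\<close> of the first family moves inside the old
    coordinates of the second, next to its partner \<open>t\<close>, so that \<open>eq\<close>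
    applies to the pair.\<close>
  also have "\<dots> = (\<integral>\<^sup>+x. \<integral>\<^sup>+y. \<integral>\<^sup>+s. \<integral>\<^sup>+t. F ((\<lambda>j\<in>I. g (x j) (y j))(i := g s t))
        \<partial>B \<partial>A \<partial>Pi\<^sub>M I (\<lambda>_. B) \<partial>Pi\<^sub>M I (\<lambda>_. A))"
    by (intro nn_integral_cong AB.Fubini') measurable
  also have "\<dots> = (\<integral>\<^sup>+x. \<integral>\<^sup>+y. \<integral>\<^sup>+c. F ((\<lambda>j\<in>I. g (x j) (y j))(i := c))
        \<partial>C \<partial>Pi\<^sub>M I (\<lambda>_. B) \<partial>Pi\<^sub>M I (\<lambda>_. A))"
  proof (intro nn_integral_cong eq)
    fix x y assume [measurable]: "x \<in> space (Pi\<^sub>M I (\<lambda>_. A))" "y \<in> space (Pi\<^sub>M I (\<lambda>_. B))"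
    show "(\<lambda>c. F ((\<lambda>j\<in>I. g (x j) (y j))(i := c))) \<in> borel_measurable C" by measurable
  qed
  also have "\<dots> = (\<integral>\<^sup>+x. \<integral>\<^sup>+c. F (x(i := c)) \<partial>C \<partial>Pi\<^sub>M I (\<lambda>_. C))"
    by (intro insert.IH[where F = "\<lambda>x. \<integral>\<^sup>+c. F (x(i := c)) \<partial>C"]) measurable
  also have "\<dots> = (\<integral>\<^sup>+x. F x \<partial>Pi\<^sub>M (insert i I) (\<lambda>_. C))"
    using insert.hyps by (subst PC.product_nn_integral_insert) auto
  finally show ?case .
qed

lemma nn_integral_PiM_density:
  fixes N :: "'a measure" and F :: "('i \<Rightarrow> 'a) \<Rightarrow> ennreal"
  assumes "finite I" "sigma_finite_measure N" "sigma_finite_measure (density N d)"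
    and d[measurable]: "d \<in> borel_measurable N"
    and "F \<in> borel_measurable (Pi\<^sub>M I (\<lambda>_. N))"
  shows "(\<integral>\<^sup>+x. F x \<partial>Pi\<^sub>M I (\<lambda>_. density N d)) = (\<integral>\<^sup>+x. (\<Prod>i\<in>I. d (x i)) * F x \<partial>Pi\<^sub>M I (\<lambda>_. N))"
  using assms(1,5)
proof (induction I arbitrary: F rule: finite_induct)
  case empty
  then show ?case by (simp add: PiM_empty nn_integral_count_space_finite)
next
  case (insert i I)
  interpret A: sigma_finite_measure N by fact
  interpret C: sigma_finite_measure "density N d" by fact
  interpret PA: product_sigma_finite "\<lambda>_. N" ..
  interpret PC: product_sigma_finite "\<lambda>_. density N d" ..
  interpret FA: finite_product_sigma_finite "\<lambda>_. N" I by standard fact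
  note [measurable] = insert.prems
  have [measurable]: "(\<lambda>x. \<Prod>j\<in>J. d (x j)) \<in> borel_measurable (Pi\<^sub>M J (\<lambda>_. N))" for J :: "'i set"
    by measurable
  have s: "sets (Pi\<^sub>M J (\<lambda>_. density N d)) = sets (Pi\<^sub>M J (\<lambda>_. N))" for J :: "'i set"
    by (intro sets_PiM_cong) auto
  have "(\<integral>\<^sup>+x. F x \<partial>Pi\<^sub>M (insert i I) (\<lambda>_. density N d)) =
      (\<integral>\<^sup>+x. \<integral>\<^sup>+y. F (x(i := y)) \<partial>density N d \<partial>Pi\<^sub>M I (\<lambda>_. density N d))"
    using insert by (intro PC.product_nn_integral_insert) (auto simp: measurable_cong_sets[OF s refl])
  also have "\<dots> = (\<integral>\<^sup>+x. \<integral>\<^sup>+y. d y * F (x(i := y)) \<partial>N \<partial>Pi\<^sub>M I (\<lambda>_. density N d))"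
  proof (intro nn_integral_cong nn_integral_density d)
    fix x assume "x \<in> space (Pi\<^sub>M I (\<lambda>_. density N d))"
    then have [measurable]: "x \<in> space (Pi\<^sub>M I (\<lambda>_. N))" by (simp add: space_PiM)
    show "(\<lambda>y. F (x(i := y))) \<in> borel_measurable N" by measurable
  qed
  also have "\<dots> = (\<integral>\<^sup>+x. (\<Prod>i\<in>I. d (x i)) * (\<integral>\<^sup>+y. d y * F (x(i := y)) \<partial>N) \<partial>Pi\<^sub>M I (\<lambda>_. N))"
    by (intro insert.IH) measurable
  also have "\<dots> = (\<integral>\<^sup>+x. \<integral>\<^sup>+y. (\<Prod>i\<in>I. d (x i)) * (d y * F (x(i := y))) \<partial>N \<partial>Pi\<^sub>M I (\<lambda>_. N))"
  proof (intro nn_integral_cong nn_integral_cmult[symmetric])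
    fix x assume [measurable]: "x \<in> space (Pi\<^sub>M I (\<lambda>_. N))"
    show "(\<lambda>y. d y * F (x(i := y))) \<in> borel_measurable N" by measurable
  qed
  also have "\<dots> = (\<integral>\<^sup>+x. \<integral>\<^sup>+y. (\<Prod>j\<in>insert i I. d ((x(i := y)) j)) * F (x(i := y)) \<partial>N \<partial>Pi\<^sub>M I (\<lambda>_. N))"
  proof (intro nn_integral_cong)
    fix x y
    have "(\<Prod>j\<in>I. d ((x(i := y)) j)) = (\<Prod>j\<in>I. d (x j))"
      using insert.hyps by (intro prod.cong) auto
    then show "(\<Prod>i\<in>I. d (x i)) * (d y * F (x(i := y))) = (\<Prod>j\<in>insert i I. d ((x(i := y)) j)) * F (x(i := y))"
      using insert.hyps by (simp add: mult_ac)
  qed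
  also have "\<dots> = (\<integral>\<^sup>+x. (\<Prod>j\<in>insert i I. d (x j)) * F x \<partial>Pi\<^sub>M (insert i I) (\<lambda>_. N))"
    using insert.hyps by (intro PA.product_nn_integral_insert[symmetric]) (auto, measurable)
  finally show ?case .
qed

interpretation lborel_PiM: product_sigma_finite "\<lambda>_::'i. lborel :: 'a::euclidean_space measure" ..

section \<open>Translations and linear isometries of product measures\<close>

lemma nn_integral_PiM_translate:
  fixes F :: "('i \<Rightarrow> 'a::euclidean_space) \<Rightarrow> ennreal"
  assumes "finite I" "F \<in> borel_measurable (Pi\<^sub>M I (\<lambda>_. lborel))"
  shows "(\<integral>\<^sup>+x. F (\<lambda>i\<in>I. x i + c i) \<partial>Pi\<^sub>M I (\<lambda>_. lborel)) = (\<integral>\<^sup>+x. F x \<partial>Pi\<^sub>M I (\<lambda>_. lborel))"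
proof (rule nn_integral_PiM_unary[where g = "\<lambda>i x. x + c i"])
  fix i and f :: "'a \<Rightarrow> ennreal" assume "f \<in> borel_measurable lborel"
  then have [measurable]: "f \<in> borel_measurable borel" by simp
  have "(\<integral>\<^sup>+x. f x \<partial>lborel) = (\<integral>\<^sup>+x. f x \<partial>distr lborel borel ((+) (c i)))"
    by (simp add: lborel_distr_plus)
  then show "(\<integral>\<^sup>+x. f (x + c i) \<partial>lborel) = (\<integral>\<^sup>+x. f x \<partial>lborel)"
    by (subst (asm) nn_integral_distr) (auto simp: add.commute)
qed (use assms in \<open>auto intro: sigma_finite_lborel\<close>)

text \<open>With \<open>m\<close> Lebesgue measure and \<open>g\<close> a rotation invariant probability density, translation invariance and
  Fubini turn \<open>\<integral>\<integral> F (T x) g (y) dm dm = \<integral>\<integral> F (T x) g (y - T x) dm dm\<close> into \<open>\<integral>\<integral> F (y + T x) g (x) dm dm\<close>;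
  so no determinant is needed.\<close>

lemma nn_integral_PiM_isometry:
  fixes F :: "('i \<Rightarrow> complex) \<Rightarrow> ennreal"
  assumes I: "finite I"
    and T[measurable]: "T \<in> Pi\<^sub>M I (\<lambda>_. lborel) \<rightarrow>\<^sub>M Pi\<^sub>M I (\<lambda>_. lborel)"
    and T'[measurable]: "T' \<in> Pi\<^sub>M I (\<lambda>_. lborel) \<rightarrow>\<^sub>M Pi\<^sub>M I (\<lambda>_. lborel)"
    and add: "\<And>x y. T (\<lambda>i\<in>I. x i + y i) = (\<lambda>i\<in>I. T x i + T y i)"
    and inv: "\<And>y. y \<in> I \<rightarrow>\<^sub>E UNIV \<Longrightarrow> T (T' y) = y"
    and norm: "\<And>x. (\<Sum>i\<in>I. (cmod (T x i))\<^sup>2) = (\<Sum>i\<in>I. (cmod (x i))\<^sup>2)"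
    and F[measurable]: "F \<in> borel_measurable (Pi\<^sub>M I (\<lambda>_. lborel))"
  shows "(\<integral>\<^sup>+x. F (T x) \<partial>Pi\<^sub>M I (\<lambda>_. lborel)) = (\<integral>\<^sup>+x. F x \<partial>Pi\<^sub>M I (\<lambda>_. lborel))"
proof -
  let ?P = "Pi\<^sub>M I (\<lambda>_. lborel :: complex measure)"
  interpret F: finite_product_sigma_finite "\<lambda>_. lborel :: complex measure" I by standard fact
  interpret FF: pair_sigma_finite ?P ?P ..
  define d where "d z = ennreal (exp (- (cmod z)\<^sup>2 / 2) / (2 * pi))" for z
  define g where "g x = (\<Prod>i\<in>I. d (x i))" for x :: "'i \<Rightarrow> complex"
  have d[measurable]: "d \<in> borel_measurable lborel" unfolding d_def by measurable
  have g[measurable]: "g \<in> borel_measurable ?P"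
    unfolding g_def by measurable
  have cd: "cgauss 1 = density lborel d"
    by (simp add: cgauss_eq_density d_def[abs_def])
  interpret C: prob_space "density lborel d"
    using prob_space_cgauss[of 1] cd by simp
  have "prob_space (Pi\<^sub>M I (\<lambda>_. density lborel d))"
    by (intro prob_space_PiM C.prob_space_axioms)
  then have g1: "(\<integral>\<^sup>+x. g x \<partial>?P) = 1"
    using nn_integral_PiM_density[OF I sigma_finite_lborel C.sigma_finite_measure_axioms d, of "\<lambda>_. 1"]
    by (simp add: g_def prob_space.emeasure_space_1)
  \<comment> \<open>The minus sign is harmless as \<open>g\<close> depends on moduli only; it arises
    below from \<open>y - (y + T x)\<close>.\<close>
  have gT: "g (\<lambda>i\<in>I. - T x i) = g x" for x
  proof -
    have "g x = ennreal (exp (- (\<Sum>i\<in>I. (cmod (x i))\<^sup>2) / 2) / (2 * pi) ^ card I)" for x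
      unfolding g_def d_def using I
      by (subst prod_ennreal) (auto simp: exp_sum prod_dividef sum_negf[symmetric] sum_divide_distrib)
    note this[of "\<lambda>i\<in>I. - T x i", simplified] this[of x]
    then show ?thesis using norm[of x] by simp
  qed
  have [measurable]: "(\<lambda>x. \<lambda>i\<in>I. f x i + h x i) \<in> N \<rightarrow>\<^sub>M ?P" "(\<lambda>x. \<lambda>i\<in>I. f x i - h x i) \<in> N \<rightarrow>\<^sub>M ?P"
    "(\<lambda>x. \<lambda>i\<in>I. - h x i) \<in> N \<rightarrow>\<^sub>M ?P"
    if "f \<in> N \<rightarrow>\<^sub>M ?P" "h \<in> N \<rightarrow>\<^sub>M ?P" for f h and N :: "'n measure"
  proof -
    have [measurable]: "(\<lambda>x. f x i) \<in> borel_measurable N" "(\<lambda>x. h x i) \<in> borel_measurable N" if "i \<in> I" for i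
      using measurable_compose[OF \<open>f \<in> N \<rightarrow>\<^sub>M ?P\<close> measurable_component_singleton[OF that]]
        measurable_compose[OF \<open>h \<in> N \<rightarrow>\<^sub>M ?P\<close> measurable_component_singleton[OF that]] by simp_all
    show "(\<lambda>x. \<lambda>i\<in>I. f x i + h x i) \<in> N \<rightarrow>\<^sub>M ?P" "(\<lambda>x. \<lambda>i\<in>I. f x i - h x i) \<in> N \<rightarrow>\<^sub>M ?P"
      "(\<lambda>x. \<lambda>i\<in>I. - h x i) \<in> N \<rightarrow>\<^sub>M ?P"
      by (intro measurable_restrict; simp)+
  qed
  have "(\<integral>\<^sup>+x. F (T x) \<partial>?P) = (\<integral>\<^sup>+x. \<integral>\<^sup>+y. F (T x) * g y \<partial>?P \<partial>?P)"
    by (subst nn_integral_cmult) (auto simp: g1)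
  also have "\<dots> = (\<integral>\<^sup>+x. \<integral>\<^sup>+y. F (T x) * g (\<lambda>i\<in>I. y i - T x i) \<partial>?P \<partial>?P)"
  proof (rule nn_integral_cong)
    fix x
    have "(\<lambda>y. F (T x) * g y) \<in> borel_measurable ?P" by measurable
    from nn_integral_PiM_translate[OF I this, of "\<lambda>i. - T x i"]
    show "(\<integral>\<^sup>+y. F (T x) * g y \<partial>?P) = (\<integral>\<^sup>+y. F (T x) * g (\<lambda>i\<in>I. y i - T x i) \<partial>?P)"
      by simp
  qed
  also have "\<dots> = (\<integral>\<^sup>+y. \<integral>\<^sup>+x. F (T x) * g (\<lambda>i\<in>I. y i - T x i) \<partial>?P \<partial>?P)"
    by (intro FF.Fubini') measurable
  also have "\<dots> = (\<integral>\<^sup>+y. \<integral>\<^sup>+x. F (\<lambda>i\<in>I. y i + T x i) * g x \<partial>?P \<partial>?P)"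
  proof (rule nn_integral_cong)
    fix y assume y: "y \<in> space ?P"
    then have inv: "T (T' y) = y" by (intro inv) (simp add: space_PiM)
    note [measurable] = y
    have e: "T (\<lambda>i\<in>I. x i + T' y i) = (\<lambda>i\<in>I. y i + T x i)" for x
      unfolding add inv by (auto simp: add.commute)
    have e': "(\<lambda>i\<in>I. y i - (\<lambda>i\<in>I. y i + T x i) i) = (\<lambda>i\<in>I. - T x i)" for x
      by (auto simp: fun_eq_iff)
    \<comment> \<open>The shift \<open>T' y\<close> is a preimage of y, so additivity turns the
      image of the shifted point into \<open>y + T x\<close>.\<close>
    have "(\<integral>\<^sup>+x. F (T x) * g (\<lambda>i\<in>I. y i - T x i) \<partial>?P) =
      (\<integral>\<^sup>+x. F (T (\<lambda>i\<in>I. x i + T' y i)) * g (\<lambda>i\<in>I. y i - T (\<lambda>i\<in>I. x i + T' y i) i) \<partial>?P)"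
      by (rule nn_integral_PiM_translate[OF I, symmetric, where c = "T' y"]) measurable
    then show "(\<integral>\<^sup>+x. F (T x) * g (\<lambda>i\<in>I. y i - T x i) \<partial>?P) = (\<integral>\<^sup>+x. F (\<lambda>i\<in>I. y i + T x i) * g x \<partial>?P)"
      by (simp only: e e' gT)
  qed
  also have "\<dots> = (\<integral>\<^sup>+x. \<integral>\<^sup>+y. F (\<lambda>i\<in>I. y i + T x i) * g x \<partial>?P \<partial>?P)"
    by (intro FF.Fubini') measurable
  also have "\<dots> = (\<integral>\<^sup>+x. (\<integral>\<^sup>+y. F y \<partial>?P) * g x \<partial>?P)"
  proof (rule nn_integral_cong)
    fix x assume x[measurable]: "x \<in> space ?P"
    have "(\<integral>\<^sup>+y. F (\<lambda>i\<in>I. y i + T x i) * g x \<partial>?P) = (\<integral>\<^sup>+y. F (\<lambda>i\<in>I. y i + T x i) \<partial>?P) * g x"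
      by (intro nn_integral_multc) measurable
    also have "(\<integral>\<^sup>+y. F (\<lambda>i\<in>I. y i + T x i) \<partial>?P) = (\<integral>\<^sup>+y. F y \<partial>?P)"
      by (rule nn_integral_PiM_translate[OF I F])
    finally show "(\<integral>\<^sup>+y. F (\<lambda>i\<in>I. y i + T x i) * g x \<partial>?P) = (\<integral>\<^sup>+y. F y \<partial>?P) * g x" .
  qed
  also have "\<dots> = (\<integral>\<^sup>+y. F y \<partial>?P)"
    by (subst nn_integral_cmult) (auto simp: g1)
  finally show ?thesis .
qed

text \<open>The Gaussian weight is a function of the sum of the squared moduli, which
  \<open>T\<close> preserves; the claim thus reduces to the one for Lebesgue measure.\<close>

lemma nn_integral_PiM_cgauss_isometry:
  fixes F :: "('i \<Rightarrow> complex) \<Rightarrow> ennreal"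
  assumes s: "0 < s" and I: "finite I"
    and T: "T \<in> Pi\<^sub>M I (\<lambda>_. lborel) \<rightarrow>\<^sub>M Pi\<^sub>M I (\<lambda>_. lborel)"
      "T' \<in> Pi\<^sub>M I (\<lambda>_. lborel) \<rightarrow>\<^sub>M Pi\<^sub>M I (\<lambda>_. lborel)"
      "\<And>x y. T (\<lambda>i\<in>I. x i + y i) = (\<lambda>i\<in>I. T x i + T y i)"
      "\<And>y. y \<in> I \<rightarrow>\<^sub>E UNIV \<Longrightarrow> T (T' y) = y"
      "\<And>x. (\<Sum>i\<in>I. (cmod (T x i))\<^sup>2) = (\<Sum>i\<in>I. (cmod (x i))\<^sup>2)"
    and F[measurable]: "F \<in> borel_measurable (Pi\<^sub>M I (\<lambda>_. lborel))"
  shows "(\<integral>\<^sup>+x. F (T x) \<partial>Pi\<^sub>M I (\<lambda>_. cgauss s)) = (\<integral>\<^sup>+x. F x \<partial>Pi\<^sub>M I (\<lambda>_. cgauss s))"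
proof -
  let ?P = "Pi\<^sub>M I (\<lambda>_. lborel :: complex measure)"
  define d where "d z = ennreal (exp (- (cmod z)\<^sup>2 / (2 * s\<^sup>2)) / (2 * pi * s\<^sup>2))" for z
  have d[measurable]: "d \<in> borel_measurable lborel" unfolding d_def by measurable
  have cd: "cgauss s = density lborel d"
    using s by (simp add: cgauss_eq_density d_def[abs_def])
  interpret C: prob_space "density lborel d"
    using prob_space_cgauss[OF s] cd by simp
  note [measurable] = T(1)
  have g[measurable]: "(\<lambda>x. \<Prod>i\<in>I. d (x i)) \<in> borel_measurable ?P"
    by measurable
  have gT: "(\<Prod>i\<in>I. d (T x i)) = (\<Prod>i\<in>I. d (x i))" for x
  proof -
    have "(\<Prod>i\<in>I. d (x i)) = ennreal (exp (- (\<Sum>i\<in>I. (cmod (x i))\<^sup>2) / (2 * s\<^sup>2)) / (2 * pi * s\<^sup>2) ^ card I)" for x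
      unfolding d_def using I
      by (subst prod_ennreal) (auto simp: exp_sum prod_dividef sum_negf[symmetric] sum_divide_distrib)
    from this[of "T x"] this[of x] show ?thesis using T(5)[of x] by simp
  qed
  have "(\<integral>\<^sup>+x. F (T x) \<partial>Pi\<^sub>M I (\<lambda>_. density lborel d)) = (\<integral>\<^sup>+x. (\<Prod>i\<in>I. d (T x i)) * F (T x) \<partial>?P)"
    unfolding gT
    by (intro nn_integral_PiM_density I sigma_finite_lborel C.sigma_finite_measure_axioms d) measurable
  also have "\<dots> = (\<integral>\<^sup>+x. (\<Prod>i\<in>I. d (x i)) * F x \<partial>?P)"
    by (rule nn_integral_PiM_isometry[OF I T]) measurable
  also have "\<dots> = (\<integral>\<^sup>+x. F x \<partial>Pi\<^sub>M I (\<lambda>_. density lborel d))"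
    by (intro nn_integral_PiM_density[symmetric] I sigma_finite_lborel C.sigma_finite_measure_axioms d F)
  finally show ?thesis unfolding cd .
qed

text \<open>Here the phases of the last column are integrated out and independent exponential
  variables survive. Their density lives on strictly positive \<open>r\<close>, the range that
  strict interlacing produces.\<close>

lemma nn_integral_PiM_cgauss_cmod_square:
  fixes F :: "('i \<Rightarrow> real) \<Rightarrow> ennreal"
  assumes s: "0 < s" and I: "finite I" and F[measurable]: "F \<in> borel_measurable (Pi\<^sub>M I (\<lambda>_. lborel))"
  shows "(\<integral>\<^sup>+z. F (\<lambda>i\<in>I. (cmod (z i))\<^sup>2) \<partial>Pi\<^sub>M I (\<lambda>_. cgauss s)) =
    (\<integral>\<^sup>+r. (if \<forall>i\<in>I. 0 < r i then ennreal (exp (- (\<Sum>i\<in>I. r i) / (2 * s\<^sup>2)) / (2 * s\<^sup>2) ^ card I) * F r else 0)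
      \<partial>Pi\<^sub>M I (\<lambda>_. lborel))"
proof -
  define d where "d r = (if 0 < r then ennreal (exp (- r / (2 * s\<^sup>2)) / (2 * s\<^sup>2)) else 0)" for r :: real
  have d[measurable]: "d \<in> borel_measurable lborel" unfolding d_def by measurable
  have eq: "(\<integral>\<^sup>+z. f ((cmod z)\<^sup>2) \<partial>cgauss s) = (\<integral>\<^sup>+r. f r \<partial>density lborel d)"
    if "f \<in> borel_measurable (density lborel d)" for f
    using that s by (subst nn_integral_cgauss_cmod_square)
      (auto simp: nn_integral_density d_def intro!: nn_integral_cong)
  interpret G: prob_space "cgauss s" using s by (rule prob_space_cgauss)
  \<comment> \<open>The test function 1 shows that the candidate density has total mass 1.\<close>
  interpret D: finite_measure "density lborel d"
    using eq[of "\<lambda>_. 1"] G.emeasure_space_1 by (intro finite_measureI) simp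
  have s': "sets (Pi\<^sub>M I (\<lambda>_. density lborel d)) = sets (Pi\<^sub>M I (\<lambda>_. lborel))"
    by (intro sets_PiM_cong) auto
  have "(\<integral>\<^sup>+z. F (\<lambda>i\<in>I. (cmod (z i))\<^sup>2) \<partial>Pi\<^sub>M I (\<lambda>_. cgauss s)) = (\<integral>\<^sup>+r. F r \<partial>Pi\<^sub>M I (\<lambda>_. density lborel d))"
    using F by (intro nn_integral_PiM_unary[where g = "\<lambda>_ z. (cmod z)\<^sup>2"] I G.sigma_finite_measure_axioms
      D.sigma_finite_measure_axioms eq) (auto simp: measurable_cong_sets[OF s' refl])
  also have "\<dots> = (\<integral>\<^sup>+r. (\<Prod>i\<in>I. d (r i)) * F r \<partial>Pi\<^sub>M I (\<lambda>_. lborel))"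
    by (intro nn_integral_PiM_density I sigma_finite_lborel D.sigma_finite_measure_axioms d F)
  also have "\<dots> = (\<integral>\<^sup>+r. (if \<forall>i\<in>I. 0 < r i then ennreal (exp (- (\<Sum>i\<in>I. r i) / (2 * s\<^sup>2)) / (2 * s\<^sup>2) ^ card I) * F r else 0)
      \<partial>Pi\<^sub>M I (\<lambda>_. lborel))"
  proof (rule nn_integral_cong)
    fix r :: "'i \<Rightarrow> real"
    have "(\<Prod>i\<in>I. d (r i)) = ennreal (exp (- (\<Sum>i\<in>I. r i) / (2 * s\<^sup>2)) / (2 * s\<^sup>2) ^ card I)" if "\<forall>i\<in>I. 0 < r i"
      using I that by (simp add: d_def prod_ennreal exp_sum prod_dividef sum_negf[symmetric] sum_divide_distrib)
    note 1 = this
    have 2: "(\<Prod>i\<in>I. d (r i)) = 0" if "\<not> (\<forall>i\<in>I. 0 < r i)"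
      using I that by (auto simp: d_def)
    show "(\<Prod>i\<in>I. d (r i)) * F r = (if \<forall>i\<in>I. 0 < r i then ennreal (exp (- (\<Sum>i\<in>I. r i) / (2 * s\<^sup>2)) / (2 * s\<^sup>2) ^ card I) * F r else 0)"
    proof (cases "\<forall>i\<in>I. 0 < r i")
      case True
      show ?thesis unfolding if_P[OF True] 1[OF True] ..
    next
      case False
      show ?thesis unfolding if_not_P[OF False] 2[OF False] by simp
    qed
  qed
  finally show ?thesis .
qed

section \<open>Interlacing sequences and the secular equation\<close>

text \<open>The factors are opposite in sign to those of \<open>vandermonde\<close>, so that the
  product is nonnegative on increasing sequences and survives the passage to \<open>ennreal\<close>;
  the squares agree.\<close>

definition vdm :: "nat \<Rightarrow> (nat \<Rightarrow> real) \<Rightarrow> real" where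
  "vdm n s = (\<Prod>j<n. \<Prod>i<j. s j - s i)"

lemma vdm_Suc: "vdm (Suc n) s = vdm n s * (\<Prod>i<n. s n - s i)"
  by (simp add: vdm_def)

lemma vdm_cong: "(\<And>i. i < n \<Longrightarrow> s i = t i) \<Longrightarrow> vdm n s = vdm n t"
  unfolding vdm_def by (intro prod.cong refl) auto

lemma vandermonde_square: "(vandermonde n s)\<^sup>2 = (vdm n s)\<^sup>2"
  unfolding vandermonde_def vdm_def prod_power_distrib
  by (simp add: power2_commute)

lemma vdm_nonneg:
  assumes "\<And>i j. i < j \<Longrightarrow> j < n \<Longrightarrow> s i \<le> s j"
  shows "0 \<le> vdm n s"
  unfolding vdm_def using assms by (intro prod_nonneg) auto

text \<open>The coefficients \<open>a\<close> and \<open>r\<^sub>i\<close> of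
  \<open>(\<Prod>i\<le>n. x - l\<^sub>i) / (\<Prod>i<n. x - m\<^sub>i) = x - a - (\<Sum>i<n. r\<^sub>i / (x - m\<^sub>i))\<close>, see
  \<open>secular_partial_fractions\<close>.  The recursion adds the factor \<open>(x - l\<^sub>n\<^sub>+\<^sub>1) / (x - m\<^sub>n)\<close>.\<close>

definition secular_a :: "(nat \<Rightarrow> real) \<Rightarrow> (nat \<Rightarrow> real) \<Rightarrow> nat \<Rightarrow> real" where
  "secular_a m l n = (\<Sum>i\<le>n. l i) - (\<Sum>i<n. m i)"

primrec secular_r :: "(nat \<Rightarrow> real) \<Rightarrow> (nat \<Rightarrow> real) \<Rightarrow> nat \<Rightarrow> nat \<Rightarrow> real" where
  "secular_r m l 0 = (\<lambda>i. undefined)"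
| "secular_r m l (Suc n) =
    (\<lambda>i\<in>{..<n}. secular_r m l n i * (l (Suc n) - m i) / (m n - m i))
    (n := (l (Suc n) - m n) * (m n - secular_a m l n - (\<Sum>k<n. secular_r m l n k / (m n - m k))))"

lemma secular_a_Suc: "secular_a m l (Suc n) = secular_a m l n + l (Suc n) - m n"
  by (simp add: secular_a_def)

lemma secular_a_cong: "(\<And>i. i \<le> n \<Longrightarrow> l i = l' i) \<Longrightarrow> secular_a m l n = secular_a m l' n"
  by (simp add: secular_a_def)

lemma secular_r_cong: "(\<And>i. i \<le> n \<Longrightarrow> l i = l' i) \<Longrightarrow> secular_r m l n = secular_r m l' n"
proof (induction n)
  case (Suc n)
  have "secular_r m l n = secular_r m l' n" "secular_a m l n = secular_a m l' n"
    using Suc by (auto intro: secular_a_cong)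
  with Suc.prems show ?case by simp
qed simp

text \<open>All inequalities are strict, which forces both sequences to increase strictly. For a
  fixed \<open>l\<close> the condition describes a box, the product of the open intervals between
  neighbours.\<close>

definition interlaces :: "nat \<Rightarrow> (nat \<Rightarrow> real) \<Rightarrow> (nat \<Rightarrow> real) \<Rightarrow> bool" where
  "interlaces n m l \<longleftrightarrow> (\<forall>i<n. l i < m i \<and> m i < l (Suc i))"

text \<open>Used in three ways: at a generic x to recognise the spectrum, at \<open>x = m n\<close>
  to decide interlacing, and at the next \<open>l\<close> to evaluate the factors that it adds to
  the Vandermonde product.\<close>

lemma secular_partial_fractions:
  assumes "inj_on m {..<n}" "\<And>i. i < n \<Longrightarrow> x \<noteq> m i"
  shows "(\<Prod>i\<le>n. x - l i) =
    (\<Prod>i<n. x - m i) * (x - secular_a m l n - (\<Sum>i<n. secular_r m l n i / (x - m i)))"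
  using assms
proof (induction n)
  case 0
  then show ?case by (simp add: secular_a_def)
next
  case (Suc n)
  define y where "y = l (Suc n)"
  define S where "S = (\<Sum>i<n. secular_r m l n i / (x - m i))"
  define S2 where "S2 = (\<Sum>i<n. secular_r m l n i / (m n - m i))"
  define S1 where "S1 = (\<Sum>i<n. secular_r m l n i * (y - m i) / (m n - m i) / (x - m i))"
  have ne: "m n \<noteq> m i" "x \<noteq> m i" if "i < n" for i
    using Suc.prems(2)[of i] inj_onD[OF Suc.prems(1), of n i] that by auto
  have xn: "x \<noteq> m n" using Suc.prems(2) by auto
  \<comment> \<open>Termwise this is \<open>(x - m n) * (y - m i) = (x - y) * (m n - m i) + (y - m
    n) * (x - m i)\<close>, the identity that separates the new pole from an old one.\<close>
  have "(x - m n) * S1 = (x - y) * S + (y - m n) * S2"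
    unfolding S_def S1_def S2_def sum_distrib_left sum.distrib[symmetric]
  proof (intro sum.cong refl)
    fix i assume "i \<in> {..<n}"
    then have "m n - m i \<noteq> 0" "x - m i \<noteq> 0" using ne[of i] by auto
    then show "(x - m n) * (secular_r m l n i * (y - m i) / (m n - m i) / (x - m i)) =
       (x - y) * (secular_r m l n i / (x - m i)) + (y - m n) * (secular_r m l n i / (m n - m i))"
      by (simp add: divide_simps) (simp add: algebra_simps)
  qed
  moreover have "(\<Sum>i<Suc n. secular_r m l (Suc n) i / (x - m i)) =
      S1 + (y - m n) * (m n - secular_a m l n - S2) / (x - m n)"
    by (simp add: S1_def S2_def y_def)
  moreover have "(\<Prod>i\<le>n. x - l i) = (\<Prod>i<n. x - m i) * (x - secular_a m l n - S)"
    unfolding S_def using Suc.prems by (intro Suc.IH) (auto simp: inj_on_def)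
  moreover have "(x - m n) * ((y - m n) * (m n - secular_a m l n - S2) / (x - m n))
      = (y - m n) * (m n - secular_a m l n - S2)" using xn by simp
  ultimately have "(x - m n) * (x - secular_a m l (Suc n) - (\<Sum>i<Suc n. secular_r m l (Suc n) i / (x - m i)))
     = (x - secular_a m l n - S) * (x - y)"
    unfolding secular_a_Suc y_def[symmetric] by (simp only: right_diff_distrib distrib_left) (simp add: algebra_simps)
  with \<open>(\<Prod>i\<le>n. x - l i) = _\<close> show ?case
    by (simp only: prod.atMost_Suc prod.lessThan_Suc y_def[symmetric] mult.assoc)
qed

text \<open>For interlacing sequences this is the trace of the squared arrow matrix, computed from
  its spectrum and from its entries. It makes the Gaussian weights of m, r and a combine into one
  that depends on l alone.\<close>

lemma secular_sum_squares:
  assumes "inj_on m {..<n}"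
  shows "(\<Sum>i\<le>n. (l i)\<^sup>2) = (\<Sum>i<n. (m i)\<^sup>2) + (secular_a m l n)\<^sup>2 + 2 * (\<Sum>i<n. secular_r m l n i)"
  using assms
proof (induction n)
  case 0
  then show ?case by (simp add: secular_a_def)
next
  case (Suc n)
  define y where "y = l (Suc n)"
  define S where "S = (\<Sum>i<n. secular_r m l n i)"
  define S2 where "S2 = (\<Sum>i<n. secular_r m l n i / (m n - m i))"
  have ne: "m n \<noteq> m i" if "i < n" for i
    using inj_onD[OF Suc.prems(1), of n i] that by auto
  have "(\<Sum>i<n. secular_r m l n i * (y - m i) / (m n - m i)) = S + (y - m n) * S2"
    unfolding S_def S2_def sum_distrib_left sum.distrib[symmetric]
    using ne by (intro sum.cong refl) (simp add: field_simps)
  then have "(\<Sum>i<Suc n. secular_r m l (Suc n) i) = S + (y - m n) * (m n - secular_a m l n)"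
    by (simp add: S2_def[symmetric] y_def[symmetric] algebra_simps)
  moreover have "(\<Sum>i\<le>n. (l i)\<^sup>2) = (\<Sum>i<n. (m i)\<^sup>2) + (secular_a m l n)\<^sup>2 + 2 * S"
    unfolding S_def using Suc.prems by (intro Suc.IH) (auto simp: inj_on_def)
  ultimately show ?case
    by (simp only: sum.atMost_Suc sum.lessThan_Suc[of "\<lambda>i. (m i)\<^sup>2"] secular_a_Suc y_def[symmetric])
       (simp add: power2_eq_square algebra_simps)
qed

text \<open>The partial fractions of level n, evaluated at \<open>x = m n\<close>, tie the last
  condition to the product of the \<open>m n - l i\<close>. All of these factors except
  \<open>m n - l n\<close> are positive already, so the sign decides the missing inequality
  \<open>l n < m n\<close>. The same expression times \<open>l (Suc n) - m n\<close> is the new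
  residue.\<close>

lemma interlaces_Suc:
  assumes "strict_mono_on {..<Suc n} m"
  shows "interlaces (Suc n) m l \<longleftrightarrow> m n < l (Suc n) \<and> interlaces n m l \<and>
    0 < m n - secular_a m l n - (\<Sum>i<n. secular_r m l n i / (m n - m i))"
proof -
  define q where "q = m n - secular_a m l n - (\<Sum>i<n. secular_r m l n i / (m n - m i))"
  have lt: "m i < m n" if "i < n" for i
    using strict_mono_onD[OF assms, of i n] that by auto
  have inj: "inj_on m {..<n}" using assms strict_mono_on_imp_inj_on
    by (metis inj_on_subset lessThan_subset_iff le_SucI order_refl)
  have eq: "(\<Prod>i<n. m n - l i) * (m n - l n) = (\<Prod>i<n. m n - m i) * q"
    using secular_partial_fractions[OF inj, of "m n" l] lt
    by (force simp: q_def lessThan_Suc_atMost[symmetric])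
  have "0 < m n - l n \<longleftrightarrow> 0 < q" if "interlaces n m l"
  proof -
    have "0 < m n - l i" if "i < n" for i
      using \<open>interlaces n m l\<close> that lt[OF that] by (force simp: interlaces_def)
    then have "0 < (\<Prod>i<n. m n - l i)" by (intro prod_pos) auto
    moreover have "0 < (\<Prod>i<n. m n - m i)" using lt by (intro prod_pos) auto
    ultimately show ?thesis using eq by (metis zero_less_mult_pos zero_less_mult_iff)
  qed
  then show ?thesis unfolding q_def[symmetric]
    by (auto simp: interlaces_def less_Suc_eq)
qed

text \<open>Positive residues have real square roots, which become the border of the arrow matrix
  with spectrum \<open>l\<close>.\<close>

lemma secular_r_pos:
  assumes "strict_mono_on {..<n} m" "interlaces n m l" "i < n"
  shows "0 < secular_r m l n i"
  using assms
proof (induction n arbitrary: i)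
  case (Suc n)
  have lt: "m i < m n" if "i < n" for i
    using strict_mono_onD[OF Suc.prems(1), of i n] that by auto
  have sm: "strict_mono_on {..<n} m"
    using Suc.prems(1) by (auto simp: strict_mono_on_def)
  note il = Suc.prems(2)[unfolded interlaces_Suc[OF Suc.prems(1)]]
  show ?case
  proof (cases "i = n")
    case True then show ?thesis using il by simp
  next
    case False
    then have "i < n" using Suc.prems by auto
    then show ?thesis using il lt[of i] Suc.IH[OF sm, of i] by simp
  qed
qed simp

text \<open>Monotonicity and surjectivity make the preimage of a bounded interval an interval with
  endpoints above \<open>b\<close>, to which the fundamental theorem of calculus applies. So
  \<open>g\<close> pushes the density \<open>g'\<close> on the half line forward to Lebesgue measure
  on the whole line.\<close>

lemma nn_integral_subst_half_line:
  fixes g g' :: "real \<Rightarrow> real" and f :: "real \<Rightarrow> ennreal"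
  assumes [measurable]: "f \<in> borel_measurable borel" "g \<in> borel_measurable borel" "g' \<in> borel_measurable borel"
    and deriv: "\<And>y. b < y \<Longrightarrow> (g has_real_derivative g' y) (at y)"
    and pos: "\<And>y. b < y \<Longrightarrow> 0 < g' y"
    and surj: "\<And>u. \<exists>y>b. g y = u"
  shows "(\<integral>\<^sup>+y. (if b < y then ennreal (g' y) * f (g y) else 0) \<partial>lborel) = (\<integral>\<^sup>+u. f u \<partial>lborel)"
proof -
  have mono: "g x < g y" if "b < x" "x < y" for x y
  proof (rule DERIV_pos_imp_increasing[OF \<open>x < y\<close>])
    fix z assume "x \<le> z" "z \<le> y"
    then have "b < z" using that by auto
    then show "\<exists>d. (g has_real_derivative d) (at z) \<and> 0 < d" using deriv pos by blast
  qed
  let ?D = "density lborel (\<lambda>y. if b < y then ennreal (g' y) else 0)"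
  have "lborel = distr ?D borel g"
  proof (rule lborel_eqI)
    fix l u :: real assume "\<And>b. b \<in> Basis \<Longrightarrow> l \<bullet> b \<le> u \<bullet> b"
    then have "l \<le> u" by simp
    obtain x y where x: "b < x" "g x = l" and y: "b < y" "g y = u" using surj by metis
    have "x \<le> y" using mono[of y x] x y \<open>l \<le> u\<close> by fastforce
    have iff: "l < g z \<and> g z < u \<longleftrightarrow> x < z \<and> z < y" if "b < z" for z
      using mono x y that by (metis less_asym linorder_less_linear)
    have "emeasure (distr ?D borel g) (box l u) =
        (\<integral>\<^sup>+z. (if b < z then ennreal (g' z) else 0) * indicator (g -` {l<..<u}) z \<partial>lborel)"
      using measurable_sets_borel[of g borel "{l<..<u}"]
      by (subst emeasure_distr) (auto simp: emeasure_density box_real)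
    \<comment> \<open>Two null points are added to pass from the open preimage to the closed
      interval of the fundamental theorem.\<close>
    also have "\<dots> = (\<integral>\<^sup>+z. ennreal (if b < z then g' z else 0) * indicator {x..y} z \<partial>lborel)"
    proof (intro nn_integral_cong_AE)
      show "AE z in lborel. (if b < z then ennreal (g' z) else 0) * indicator (g -` {l<..<u}) z =
          ennreal (if b < z then g' z else 0) * indicator {x..y} z"
        using AE_lborel_singleton[of x] AE_lborel_singleton[of y]
      proof eventually_elim
        case (elim z)
        then show ?case using iff[of z] by (auto split: split_indicator)
      qed
    qed
    also have "\<dots> = g y - g x"
      using x \<open>x \<le> y\<close> deriv pos
      by (intro nn_integral_FTC_Icc) (auto intro: less_imp_le)
    finally show "emeasure (distr ?D borel g) (box l u) = (\<Prod>b\<in>Basis. (u - l) \<bullet> b)"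
      using x y by simp
  qed simp
  then have "(\<integral>\<^sup>+u. f u \<partial>lborel) = (\<integral>\<^sup>+u. f u \<partial>distr ?D borel g)" by simp
  also have "\<dots> = (\<integral>\<^sup>+y. (if b < y then ennreal (g' y) else 0) * f (g y) \<partial>lborel)"
    by (subst nn_integral_distr) (auto simp: nn_integral_density)
  finally show ?thesis by (auto intro!: nn_integral_cong)
qed


lemma nn_integral_PiM_scale:
  fixes s :: "'i \<Rightarrow> real" and f :: "('i \<Rightarrow> real) \<Rightarrow> ennreal"
  assumes "finite I" "\<And>i. i \<in> I \<Longrightarrow> 0 < s i" "f \<in> borel_measurable (Pi\<^sub>M I (\<lambda>_. lborel))"
  shows "(\<integral>\<^sup>+x. f x \<partial>Pi\<^sub>M I (\<lambda>_. lborel)) =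
    ennreal (\<Prod>i\<in>I. s i) * (\<integral>\<^sup>+x. f (\<lambda>i\<in>I. s i * x i) \<partial>Pi\<^sub>M I (\<lambda>_. lborel))"
  using assms
proof (induction I arbitrary: f rule: finite_induct)
  case empty
  then show ?case by (simp add: PiM_empty nn_integral_count_space_finite)
next
  case (insert i I)
  interpret finite_product_sigma_finite "\<lambda>_. lborel :: real measure" I
    by standard fact
  note [measurable] = insert.prems(2)
  have "(\<integral>\<^sup>+x. f x \<partial>Pi\<^sub>M (insert i I) (\<lambda>_. lborel)) =
      (\<integral>\<^sup>+y. (\<integral>\<^sup>+x. f (x(i := y)) \<partial>Pi\<^sub>M I (\<lambda>_. lborel)) \<partial>lborel)"
    using insert by (intro lborel_PiM.product_nn_integral_insert_rev) auto
  also have "\<dots> = (\<integral>\<^sup>+y. ennreal (\<Prod>i\<in>I. s i) * (\<integral>\<^sup>+x. f ((\<lambda>i\<in>I. s i * x i)(i := y)) \<partial>Pi\<^sub>M I (\<lambda>_. lborel)) \<partial>lborel)"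
    using insert.prems(1) by (intro nn_integral_cong insert.IH) (blast, measurable)
  also have "\<dots> = ennreal (\<Prod>i\<in>I. s i) * (\<integral>\<^sup>+y. (\<integral>\<^sup>+x. f ((\<lambda>i\<in>I. s i * x i)(i := y)) \<partial>Pi\<^sub>M I (\<lambda>_. lborel)) \<partial>lborel)"
    by (intro nn_integral_cmult) measurable
  also have "(\<integral>\<^sup>+y. (\<integral>\<^sup>+x. f ((\<lambda>i\<in>I. s i * x i)(i := y)) \<partial>Pi\<^sub>M I (\<lambda>_. lborel)) \<partial>lborel)
     = ennreal \<bar>s i\<bar> * (\<integral>\<^sup>+y. (\<integral>\<^sup>+x. f ((\<lambda>i\<in>I. s i * x i)(i := 0 + s i * y)) \<partial>Pi\<^sub>M I (\<lambda>_. lborel)) \<partial>lborel)"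
    using insert.prems(1)[of i]
  proof (intro nn_integral_real_affine)
    have "(\<lambda>y. \<integral>\<^sup>+x. f ((\<lambda>i\<in>I. s i * x i)(i := y)) \<partial>Pi\<^sub>M I (\<lambda>_. lborel)) \<in> borel_measurable lborel"
      by measurable
    then show "(\<lambda>y. \<integral>\<^sup>+x. f ((\<lambda>i\<in>I. s i * x i)(i := y)) \<partial>Pi\<^sub>M I (\<lambda>_. lborel)) \<in> borel_measurable borel"
      by simp
  qed auto
  also have "(\<integral>\<^sup>+y. (\<integral>\<^sup>+x. f ((\<lambda>i\<in>I. s i * x i)(i := 0 + s i * y)) \<partial>Pi\<^sub>M I (\<lambda>_. lborel)) \<partial>lborel)
     = (\<integral>\<^sup>+x. f (\<lambda>j\<in>insert i I. s j * x j) \<partial>Pi\<^sub>M (insert i I) (\<lambda>_. lborel))"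
    using insert by (subst lborel_PiM.product_nn_integral_insert_rev)
      (auto intro!: nn_integral_cong arg_cong[where f=f])
  finally show ?case using insert.prems(1) insert.hyps
    by (simp add: ennreal_mult prod_nonneg less_imp_le mult_ac restrict_def)
qed

section \<open>Measurability and range of the secular data\<close>

lemma pred_interlaces:
  assumes "\<And>i. i < n \<Longrightarrow> (\<lambda>x. m x i) \<in> borel_measurable N"
    "\<And>i. i \<le> n \<Longrightarrow> (\<lambda>x. l x i) \<in> borel_measurable N"
  shows "Measurable.pred N (\<lambda>x. interlaces n (m x) (l x))"
  unfolding interlaces_def Ball_def[of "{..<n}", unfolded lessThan_iff, symmetric]
  using assms by (intro pred_intros_finite pred_intros_logic borel_measurable_pred_less) auto

lemma measurable_secular_a:
  assumes "\<And>i. i < n \<Longrightarrow> (\<lambda>x. m x i) \<in> borel_measurable N"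
    "\<And>i. i \<le> n \<Longrightarrow> (\<lambda>x. l x i) \<in> borel_measurable N"
  shows "(\<lambda>x. secular_a (m x) (l x) n) \<in> borel_measurable N"
  unfolding secular_a_def using assms by (intro borel_measurable_diff borel_measurable_sum) auto

lemma measurable_secular_r:
  assumes "\<And>i. i < n \<Longrightarrow> (\<lambda>x. m x i) \<in> borel_measurable N"
    "\<And>i. i \<le> n \<Longrightarrow> (\<lambda>x. l x i) \<in> borel_measurable N"
  shows "(\<lambda>x. secular_r (m x) (l x) n) \<in> measurable N (Pi\<^sub>M {..<n} (\<lambda>_. lborel))"
  using assms
proof (induction n)
  case 0
  \<comment> \<open>\<open>secular_r m l 0\<close> is constantly \<open>undefined\<close>, which is
    the only point of the empty product.\<close>
  then show ?case by (simp add: PiM_empty)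
next
  case (Suc n)
  have m: "(\<lambda>x. m x i) \<in> borel_measurable N" if "i \<le> n" for i
    using Suc that by auto
  have l: "(\<lambda>x. l x (Suc n)) \<in> borel_measurable N"
    using Suc by auto
  have IH: "(\<lambda>x. secular_r (m x) (l x) n) \<in> measurable N (Pi\<^sub>M {..<n} (\<lambda>_. lborel))"
    using Suc by auto
  have a: "(\<lambda>x. secular_a (m x) (l x) n) \<in> borel_measurable N"
    using Suc by (intro measurable_secular_a) auto
  have r: "(\<lambda>x. secular_r (m x) (l x) n i) \<in> borel_measurable N" if "i < n" for i
    using measurable_compose[OF IH measurable_component_singleton[of i "{..<n}"]] that by simp
  show ?case
    unfolding secular_r.simps using m l a r
    by (intro measurable_fun_upd[where J = "{..<n}"] measurable_restrict measurable_lborel1[THEN equalityD2, THEN subsetD]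
        borel_measurable_times borel_measurable_diff borel_measurable_divide borel_measurable_sum) 
      (auto simp: lessThan_Suc)
qed

text \<open>Beyond its largest pole the secular function rises from minus infinity to plus infinity,
  so the intermediate value theorem gives a solution.\<close>

lemma secular_function_surj:
  fixes m r :: "nat \<Rightarrow> real"
  assumes "strict_mono_on {..<Suc n} m" "\<And>i. i < n \<Longrightarrow> 0 \<le> r i" "0 < \<rho>"
  shows "\<exists>y>m n. y - (\<Sum>i<n. r i / (y - m i)) - \<rho> / (y - m n) = u"
proof -
  let ?g = "\<lambda>y. y - (\<Sum>i<n. r i / (y - m i)) - \<rho> / (y - m n)"
  have lt: "m i < m n" if "i < n" for i
    using strict_mono_onD[OF assms(1), of i n] that by auto
  define R where "R = (\<Sum>i<n. r i) + \<rho>"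
  have "0 \<le> (\<Sum>i<n. r i)" using assms(2) by (intro sum_nonneg) auto
  then have R: "0 < R" using assms(3) by (simp add: R_def)
  \<comment> \<open>At \<open>b\<close> every denominator is at least 1, so the poles cost at most
    \<open>R\<close> there. At distance \<open>d\<close> from the last pole the term
    \<open>\<rho> / d\<close> is at least \<open>\<bar>m n\<bar> + 2 + \<bar>u\<bar>\<close>, which
    pulls the value below \<open>u\<close>.\<close>
  define b where "b = m n + 1 + \<bar>u\<bar> + \<bar>m n\<bar> + R"
  define d where "d = min 1 (\<rho> / (\<bar>m n\<bar> + 2 + \<bar>u\<bar>))"
  define a where "a = m n + d"
  have d: "0 < d" "d \<le> 1" "d * (\<bar>m n\<bar> + 2 + \<bar>u\<bar>) \<le> \<rho>"
  proof -
    have p: "0 < \<bar>m n\<bar> + 2 + \<bar>u\<bar>" by linarith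
    show "0 < d" "d \<le> 1" using assms(3) p by (auto simp: d_def)
    have "d \<le> \<rho> / (\<bar>m n\<bar> + 2 + \<bar>u\<bar>)" by (simp add: d_def)
    then show "d * (\<bar>m n\<bar> + 2 + \<bar>u\<bar>) \<le> \<rho>" using p by (simp add: pos_le_divide_eq)
  qed
  have "?g a \<le> a - \<rho> / d"
    using lt assms(2) d by (auto simp: a_def intro!: sum_nonneg divide_nonneg_nonneg) (smt (verit) lt)
  also have "\<rho> / d \<ge> \<bar>m n\<bar> + 2 + \<bar>u\<bar>" using d by (simp add: pos_le_divide_eq mult.commute)
  then have "a - \<rho> / d \<le> u" using d by (simp add: a_def) 
  finally have 1: "?g a \<le> u" .
  have "(\<Sum>i<n. r i / (b - m i)) \<le> (\<Sum>i<n. r i)"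
  proof (intro sum_mono)
    fix i assume i: "i \<in> {..<n}"
    then have "1 \<le> b - m i" using lt[of i] R by (simp add: b_def)
    then show "r i / (b - m i) \<le> r i" using assms(2)[of i] i
      by (simp add: pos_divide_le_eq mult_left_le) (metis mult.right_neutral mult_left_mono)
  qed
  moreover have "\<rho> / (b - m n) \<le> \<rho>"
    using R assms(3) by (simp add: b_def pos_divide_le_eq)
  ultimately have "b - R \<le> ?g b" by (simp add: R_def)
  moreover have "u \<le> b - R" by (simp add: b_def)
  ultimately have 2: "u \<le> ?g b" by linarith
  have "a \<le> b" using d R by (simp add: a_def b_def)
  have "continuous_on {a..b} ?g"
    using lt d by (intro continuous_intros) (force simp: a_def)+
  from IVT'[of ?g a u b, OF 1 2 \<open>a \<le> b\<close> this] obtain y where "a \<le> y" "?g y = u" by auto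
  then show ?thesis using d by (intro exI[of _ y]) (auto simp: a_def)
qed

lemma interlaces_strict_mono:
  assumes "interlaces n m l"
  shows "strict_mono_on {..n} l"
proof -
  have step: "l i < l (Suc i)" if "i < n" for i
    using assms that by (force simp: interlaces_def)
  have "i < j \<Longrightarrow> j \<le> n \<Longrightarrow> l i < l j" for i j
  proof (induction j)
    case (Suc j)
    then show ?case using step[of j] by (cases "i = j") auto
  qed simp
  then show ?thesis by (auto simp: strict_mono_on_def)
qed

lemma interlaces_lower_strict_mono:
  assumes "interlaces n m l"
  shows "strict_mono_on {..<n} m"
proof -
  have step: "m i < m (Suc i)" if "Suc i < n" for i
    using assms that unfolding interlaces_def by (meson Suc_lessD less_trans)
  have "i < j \<Longrightarrow> j < n \<Longrightarrow> m i < m j" for i j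
  proof (induction j)
    case (Suc j)
    then show ?case using step[of j] by (cases "i = j") auto
  qed simp
  then show ?thesis by (auto simp: strict_mono_on_def)
qed

lemma interlaces_vdm_nonneg: "interlaces n m l \<Longrightarrow> 0 \<le> vdm (Suc n) l"
  using strict_mono_onD[OF interlaces_strict_mono] by (intro vdm_nonneg) (simp add: less_imp_le)

text \<open>Passing from \<open>n\<close> to \<open>n + 1\<close> only needs a rescaling of the old residues, an affine substitution for the
  new residue, and one monotone substitution for the new largest \<open>l\<close>, which is a root of the secular equation.\<close>

lemma nn_integral_interlacing:
  fixes f :: "(nat \<Rightarrow> real) \<times> real \<Rightarrow> ennreal"
  assumes "strict_mono_on {..<n} m"
    and "f \<in> borel_measurable (Pi\<^sub>M {..<n} (\<lambda>_. lborel) \<Otimes>\<^sub>M lborel)"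
  shows "(\<integral>\<^sup>+l. (if interlaces n m l
            then ennreal (vdm (Suc n) l) * f (secular_r m l n, secular_a m l n) else 0)
          \<partial>Pi\<^sub>M {..<Suc n} (\<lambda>_. lborel)) =
    ennreal (vdm n m) *
      (\<integral>\<^sup>+r. \<integral>\<^sup>+a. (if \<forall>i\<in>{..<n}. 0 < r i then f (r, a) else 0) \<partial>lborel \<partial>Pi\<^sub>M {..<n} (\<lambda>_. lborel))"
  using assms
proof (induction n arbitrary: f)
  case 0
  have [measurable]: "(\<lambda>x. f (\<lambda>i. undefined, x)) \<in> borel_measurable lborel"
    by (rule measurable_compose[OF _ 0(2)]) (auto simp: PiM_empty)
  have "{..<Suc 0} = {0::nat}" by auto
  with lborel_PiM.product_nn_integral_singleton[of "\<lambda>x. f (\<lambda>i. undefined, x)" "0::nat"] show ?case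
    by (simp add: PiM_empty nn_integral_count_space_finite interlaces_def vdm_def secular_a_def
        max.absorb2)
next
  case (Suc n)
  let ?P = "\<lambda>k. Pi\<^sub>M {..<k} (\<lambda>_::nat. lborel :: real measure)"
  have ins: "{..<Suc k} = insert k {..<k}" for k :: nat by auto
  interpret F: finite_product_sigma_finite "\<lambda>_. lborel :: real measure" "{..<n}"
    by standard auto
  interpret F1: finite_product_sigma_finite "\<lambda>_. lborel :: real measure" "{..<Suc n}"
    by standard auto
  note f[measurable] = Suc.prems(2)
  have lt: "m i < m n" if "i < n" for i
    using strict_mono_onD[OF Suc.prems(1), of i n] that by auto
  have sm: "strict_mono_on {..<n} m"
    using Suc.prems(1) by (auto simp: strict_mono_on_def)
  have inj: "inj_on m {..<n}" using sm strict_mono_on_imp_inj_on by blast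
  have upd[measurable]: "(\<lambda>x. (g x)(n := h x)) \<in> N \<rightarrow>\<^sub>M ?P (Suc n)"
    if "g \<in> N \<rightarrow>\<^sub>M ?P n" "h \<in> N \<rightarrow>\<^sub>M lborel" for N g and h :: "'z \<Rightarrow> real"
    using that by (intro measurable_fun_upd[where J = "{..<n}"]) auto
  have if_const: "(\<integral>\<^sup>+a. (if Q then h a else 0) \<partial>lborel) = (if Q then \<integral>\<^sup>+a. h a \<partial>lborel else 0)"
    for Q and h :: "real \<Rightarrow> ennreal" by simp
  \<comment> \<open>Fix y, the new largest value. In terms of the data (r, a) of the values before
    it, \<open>T y r a\<close> is the product of the \<open>y - l i\<close> divided by the product
    of the \<open>y - m i\<close>. The residues of the next level are \<open>R y r a\<close>, and
    \<open>q\<close> is the last of them without its factor \<open>y - m n\<close>.\<close>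
  define q where "q r a = m n - a - (\<Sum>k<n. r k / (m n - m k))" for r a
  define T where "T y r a = y - a - (\<Sum>i<n. r i / (y - m i))" for y a and r :: "nat \<Rightarrow> real"
  define R where "R y r a = (\<lambda>i\<in>{..<n}. r i * (y - m i) / (m n - m i)) (n := (y - m n) * q r a)"
    for y a and r :: "nat \<Rightarrow> real"
  define f2 where "f2 y = (\<lambda>(r, a). if 0 < q r a
    then ennreal ((\<Prod>i<n. y - m i) * T y r a) * f (R y r a, a + y - m n) else 0)" for y
  \<comment> \<open>Now y is seen as a root of the secular equation with residues r and \<rho>:
    \<open>G r \<rho> y\<close> is the value of a that makes it a root, and \<open>G'\<close> is the
    derivative of \<open>G\<close> in y. \<open>H\<close> is the integrand in the final residues,
    with y still in the place of a.\<close>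
  define G where "G r \<rho> y = y - (\<Sum>i<n. r i / (y - m i)) - \<rho> / (y - m n)"
    for r :: "nat \<Rightarrow> real" and \<rho> y
  define G' where "G' r \<rho> y = 1 + (\<Sum>i<n. r i / (y - m i)\<^sup>2) + \<rho> / (y - m n)\<^sup>2"
    for r :: "nat \<Rightarrow> real" and \<rho> y
  define H where "H y r \<rho> = (if m n < y \<and> (\<forall>i\<in>{..<n}. 0 < r i) \<and> 0 < \<rho>
    then ennreal (G' r \<rho> y) * f (r(n := \<rho>), G r \<rho> y) else 0)" for y r \<rho>
  have H: "(\<lambda>(y, r, \<rho>). H y r \<rho>) \<in> borel_measurable (lborel \<Otimes>\<^sub>M ?P n \<Otimes>\<^sub>M lborel)"
    unfolding H_def G_def G'_def split_beta' by measurable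
  have [measurable (raw)]: "(\<lambda>x. H (a x) (b x) (c x)) \<in> borel_measurable N"
    if "a \<in> N \<rightarrow>\<^sub>M lborel" "b \<in> N \<rightarrow>\<^sub>M ?P n" "c \<in> N \<rightarrow>\<^sub>M lborel" for a b c and N :: "'y measure"
    using measurable_compose[OF measurable_Pair[OF that(1) measurable_Pair[OF that(2,3)]] H] by simp
  have [measurable]: "f2 y \<in> borel_measurable (?P n \<Otimes>\<^sub>M lborel)" for y
    unfolding f2_def q_def T_def R_def split_beta' by measurable
  have 1: "(\<lambda>l. (if interlaces (Suc n) m l
      then ennreal (vdm (Suc (Suc n)) l) * f (secular_r m l (Suc n), secular_a m l (Suc n)) else 0))
      \<in> borel_measurable (?P (Suc (Suc n)))"
  proof -
    have [measurable]: "(\<lambda>l. l i) \<in> borel_measurable (?P (Suc (Suc n)))" if "i \<le> Suc n" for i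
      using measurable_component_singleton[of i "{..<Suc (Suc n)}" "\<lambda>_. lborel :: real measure"] that by simp
    have [measurable]: "Measurable.pred (?P (Suc (Suc n))) (interlaces (Suc n) m)"
      by (intro pred_interlaces) auto
    have [measurable]: "(\<lambda>l. secular_r m l (Suc n)) \<in> ?P (Suc (Suc n)) \<rightarrow>\<^sub>M ?P (Suc n)"
      by (intro measurable_secular_r) auto
    have [measurable]: "(\<lambda>l. secular_a m l (Suc n)) \<in> borel_measurable (?P (Suc (Suc n)))"
      by (intro measurable_secular_a) auto
    have [measurable]: "vdm (Suc (Suc n)) \<in> borel_measurable (?P (Suc (Suc n)))"
      unfolding vdm_def by (intro borel_measurable_prod borel_measurable_diff) auto
    show ?thesis by measurable
  qed
  have 2: "(if interlaces (Suc n) m l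
      then ennreal (vdm (Suc (Suc n)) l) * f (secular_r m l (Suc n), secular_a m l (Suc n)) else 0) =
      (if m n < y then if interlaces n m x
        then ennreal (vdm (Suc n) x) * f2 y (secular_r m x n, secular_a m x n) else 0 else 0)"
    if l: "l = x(Suc n := y)" for l x y
  proof (cases "m n < y \<and> interlaces n m x \<and> 0 < q (secular_r m x n) (secular_a m x n)")
    case True
    have c: "secular_r m l n = secular_r m x n" "secular_a m l n = secular_a m x n"
      by (auto simp: l intro: secular_r_cong secular_a_cong)
    have "interlaces (Suc n) m l"
      using True unfolding interlaces_Suc[OF Suc.prems(1)] c q_def
      by (auto simp: l interlaces_def)
    moreover have "vdm (Suc (Suc n)) l = vdm (Suc n) x * (\<Prod>i\<le>n. y - x i)"
      using vdm_cong[of "Suc n" l x] by (simp add: vdm_Suc[of "Suc n"] l lessThan_Suc_atMost)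
    \<comment> \<open>The factors that y adds to the Vandermonde product form the left-hand side of
      the partial fraction identity at y.\<close>
    moreover have "(\<Prod>i\<le>n. y - x i) = (\<Prod>i<n. y - m i) * T y (secular_r m x n) (secular_a m x n)"
      unfolding T_def using True lt by (intro secular_partial_fractions[OF inj]) force
    moreover have "0 \<le> vdm (Suc n) x" using True interlaces_vdm_nonneg by auto
    moreover have "secular_r m l (Suc n) = R y (secular_r m x n) (secular_a m x n)"
      by (simp add: R_def c q_def) (simp add: l)
    moreover have "secular_a m l (Suc n) = secular_a m x n + y - m n"
      by (simp add: secular_a_Suc c) (simp add: l)
    ultimately show ?thesis using True
      by (simp add: f2_def ennreal_mult' mult.assoc)
  next
    case False
    have c: "secular_r m l n = secular_r m x n" "secular_a m l n = secular_a m x n"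
      by (auto simp: l intro: secular_r_cong secular_a_cong)
    have "interlaces n m l = interlaces n m x" by (auto simp: l interlaces_def)
    then show ?thesis using False unfolding interlaces_Suc[OF Suc.prems(1)] c q_def[symmetric]
      by (auto simp: l f2_def)
  qed
  have 3: "(\<integral>\<^sup>+x. (if interlaces n m x
        then ennreal (vdm (Suc n) x) * f2 y (secular_r m x n, secular_a m x n) else 0) \<partial>?P (Suc n)) =
      ennreal (vdm (Suc n) m) * (\<integral>\<^sup>+r. \<integral>\<^sup>+\<rho>. H y r \<rho> \<partial>lborel \<partial>?P n)" if y: "m n < y" for y
  proof -
    define d where "d = y - m n"
    have d: "0 < d" using y by (simp add: d_def)
    \<comment> \<open>\<open>s i\<close> undoes the factor with which the recursion multiplies the
      i-th residue. After rescaling by \<open>s\<close> the integration variables are the residues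
      of the next level.\<close>
    define s where "s i = (m n - m i) / (y - m i)" for i
    have yi: "0 < y - m i" if "i < n" for i using lt[OF that] y by simp
    have s: "0 < s i" if "i < n" for i using lt[OF that] yi[OF that] by (simp add: s_def)
    have inner: "(\<integral>\<^sup>+a. (if \<forall>i\<in>{..<n}. 0 < (\<lambda>i\<in>{..<n}. s i * r i) i then f2 y (\<lambda>i\<in>{..<n}. s i * r i, a) else 0) \<partial>lborel)
        = ennreal (\<Prod>i<n. y - m i) * (\<integral>\<^sup>+\<rho>. H y r \<rho> \<partial>lborel)" (is "?L = _")
      if r: "r \<in> space (?P n)" for r
    proof -
      define S where "S = (\<Sum>i<n. r i / (y - m i))"
      have pr: "(\<forall>i\<in>{..<n}. 0 < (\<lambda>i\<in>{..<n}. s i * r i) i) \<longleftrightarrow> (\<forall>i\<in>{..<n}. 0 < r i)"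
        using s by (auto simp: zero_less_mult_iff dest: less_asym)
      have qs: "q (\<lambda>i\<in>{..<n}. s i * r i) a = m n - a - S" for a
      proof -
        have "(\<Sum>k<n. (\<lambda>i\<in>{..<n}. s i * r i) k / (m n - m k)) = S"
          unfolding S_def using lt yi by (intro sum.cong) (auto simp: s_def, force)
        then show ?thesis by (simp add: q_def)
      qed
      have Rs: "R y (\<lambda>i\<in>{..<n}. s i * r i) a = r(n := d * (m n - a - S))" for a
      proof -
        have "(\<lambda>i\<in>{..<n}. (\<lambda>i\<in>{..<n}. s i * r i) i * (y - m i) / (m n - m i)) = r"
        proof
          fix i show "(\<lambda>i\<in>{..<n}. (\<lambda>i\<in>{..<n}. s i * r i) i * (y - m i) / (m n - m i)) i = r i"
            using r lt[of i] yi[of i] by (auto simp: s_def space_PiM PiE_def extensional_def)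
        qed
        then show ?thesis by (simp add: R_def qs d_def)
      qed
      \<comment> \<open>Here the Jacobian appears: the Vandermonde product contributes
        \<open>y - m n\<close> times the derivative of the secular function. The factor
        \<open>d\<close> cancels against the \<open>1 / d\<close> of the affine
        substitution.\<close>
      have Ts: "T y (\<lambda>i\<in>{..<n}. s i * r i) (m n - S - \<rho> / d) = d * G' r \<rho> y" for \<rho>
      proof -
        have "S - (\<Sum>i<n. (\<lambda>i\<in>{..<n}. s i * r i) i / (y - m i)) = d * (\<Sum>i<n. r i / (y - m i)\<^sup>2)"
          unfolding S_def sum_subtractf[symmetric] sum_distrib_left
        proof (intro sum.cong refl)
          fix i assume "i \<in> {..<n}"
          then show "r i / (y - m i) - (\<lambda>i\<in>{..<n}. s i * r i) i / (y - m i) = d * (r i / (y - m i)\<^sup>2)"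
            using yi[of i] by (simp add: s_def d_def power2_eq_square divide_simps) (simp add: algebra_simps)
        qed
        moreover have "d * (\<rho> / d\<^sup>2) = \<rho> / d" using d by (simp add: power2_eq_square)
        ultimately show ?thesis unfolding T_def G'_def d_def[symmetric] distrib_left
          by (simp add: d_def)
      qed
      have "?L = (if \<forall>i\<in>{..<n}. 0 < r i then \<integral>\<^sup>+a. f2 y (\<lambda>i\<in>{..<n}. s i * r i, a) \<partial>lborel else 0)"
        unfolding pr if_const ..
      \<comment> \<open>The new residue \<open>\<rho> = d * (m n - S - a)\<close> replaces a as
        integration variable.\<close>
      also have "(\<integral>\<^sup>+a. f2 y (\<lambda>i\<in>{..<n}. s i * r i, a) \<partial>lborel) =
          ennreal \<bar>- (1 / d)\<bar> * (\<integral>\<^sup>+\<rho>. f2 y (\<lambda>i\<in>{..<n}. s i * r i, (m n - S) + (- (1 / d)) * \<rho>) \<partial>lborel)"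
      proof (rule nn_integral_real_affine)
        have "(\<lambda>i\<in>{..<n}. s i * r i) \<in> space (?P n)" by (simp add: space_PiM)
        then have "(\<lambda>a. f2 y (\<lambda>i\<in>{..<n}. s i * r i, a)) \<in> borel_measurable lborel"
          by measurable
        then show "(\<lambda>a. f2 y (\<lambda>i\<in>{..<n}. s i * r i, a)) \<in> borel_measurable borel" by simp
      qed (use d in auto)
      also have "\<dots> = (\<integral>\<^sup>+\<rho>. ennreal (1 / d) * f2 y (\<lambda>i\<in>{..<n}. s i * r i, (m n - S) + (- (1 / d)) * \<rho>) \<partial>lborel)"
        using d
      proof (subst nn_integral_cmult)
        have "(\<lambda>i\<in>{..<n}. s i * r i) \<in> space (?P n)" by (simp add: space_PiM)
        then show "(\<lambda>\<rho>. f2 y (\<lambda>i\<in>{..<n}. s i * r i, (m n - S) + (- (1 / d)) * \<rho>)) \<in> borel_measurable lborel"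
          by measurable
      qed auto
      finally have "?L = (if \<forall>i\<in>{..<n}. 0 < r i then \<integral>\<^sup>+\<rho>. ennreal (1 / d) * f2 y (\<lambda>i\<in>{..<n}. s i * r i, (m n - S) + (- (1 / d)) * \<rho>) \<partial>lborel else 0)" .
      also have "\<dots> = (\<integral>\<^sup>+\<rho>. ennreal (\<Prod>i<n. y - m i) * H y r \<rho> \<partial>lborel)"
      proof (cases "\<forall>i\<in>{..<n}. 0 < r i")
        case True
        have "ennreal (1 / d) * f2 y (\<lambda>i\<in>{..<n}. s i * r i, (m n - S) + (- (1 / d)) * \<rho>) =
            ennreal (\<Prod>i<n. y - m i) * H y r \<rho>" for \<rho>
        proof -
          have e1: "m n - (m n - S - \<rho> / d) - S = \<rho> / d" by simp
          have e2: "m n - S - \<rho> / d + y - m n = G r \<rho> y"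
            by (simp add: G_def S_def d_def)
          have e3: "0 < \<rho> / d \<longleftrightarrow> 0 < \<rho>" using d by (simp add: zero_less_divide_iff)
          have e4: "d * (\<rho> / d) = \<rho>" using d by simp
          have e5: "m n - S + - (1 / d) * \<rho> = m n - S - \<rho> / d" by simp
          have Pr: "0 \<le> (\<Prod>i<n. y - m i)" using yi by (intro prod_nonneg) (auto intro: less_imp_le)
          have "ennreal (1 / d) * (ennreal ((\<Prod>i<n. y - m i) * (d * G' r \<rho> y)) * z) =
              ennreal (\<Prod>i<n. y - m i) * (ennreal (G' r \<rho> y) * z)" for z
          proof -
            have "ennreal (1 / d) * ennreal ((\<Prod>i<n. y - m i) * (d * G' r \<rho> y)) =
                ennreal (1 / d * ((\<Prod>i<n. y - m i) * (d * G' r \<rho> y)))"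
              using d by (intro ennreal_mult'[symmetric]) simp
            also have "1 / d * ((\<Prod>i<n. y - m i) * (d * G' r \<rho> y)) = (\<Prod>i<n. y - m i) * G' r \<rho> y"
              using d by simp
            also have "ennreal \<dots> = ennreal (\<Prod>i<n. y - m i) * ennreal (G' r \<rho> y)"
              by (rule ennreal_mult'[OF Pr])
            finally show ?thesis by (simp only: mult.assoc[symmetric])
          qed
          then show ?thesis unfolding e5 f2_def H_def prod.case qs Rs Ts e1 e2 e3 e4
            using True y by simp
        qed
        then show ?thesis unfolding if_P[OF True] by simp
      next
        case False
        then have "H y r \<rho> = 0" for \<rho> by (auto simp: H_def)
        then show ?thesis unfolding if_not_P[OF False] by simp
      qed
      also have "\<dots> = ennreal (\<Prod>i<n. y - m i) * (\<integral>\<^sup>+\<rho>. H y r \<rho> \<partial>lborel)"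
        using r by (intro nn_integral_cmult) measurable
      finally show ?thesis .
    qed
    have "(\<integral>\<^sup>+x. (if interlaces n m x
        then ennreal (vdm (Suc n) x) * f2 y (secular_r m x n, secular_a m x n) else 0) \<partial>?P (Suc n)) =
        ennreal (vdm n m) * (\<integral>\<^sup>+r. \<integral>\<^sup>+a. (if \<forall>i\<in>{..<n}. 0 < r i then f2 y (r, a) else 0) \<partial>lborel \<partial>?P n)"
      by (rule Suc.IH[OF sm]) measurable
    also have "(\<integral>\<^sup>+r. \<integral>\<^sup>+a. (if \<forall>i\<in>{..<n}. 0 < r i then f2 y (r, a) else 0) \<partial>lborel \<partial>?P n) =
        ennreal (\<Prod>i<n. s i) * (\<integral>\<^sup>+r. \<integral>\<^sup>+a. (if \<forall>i\<in>{..<n}. 0 < (\<lambda>i\<in>{..<n}. s i * r i) i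
          then f2 y (\<lambda>i\<in>{..<n}. s i * r i, a) else 0) \<partial>lborel \<partial>?P n)"
      using s by (intro nn_integral_PiM_scale) (auto, measurable)
    also have "(\<integral>\<^sup>+r. \<integral>\<^sup>+a. (if \<forall>i\<in>{..<n}. 0 < (\<lambda>i\<in>{..<n}. s i * r i) i
          then f2 y (\<lambda>i\<in>{..<n}. s i * r i, a) else 0) \<partial>lborel \<partial>?P n) =
        (\<integral>\<^sup>+r. ennreal (\<Prod>i<n. y - m i) * (\<integral>\<^sup>+\<rho>. H y r \<rho> \<partial>lborel) \<partial>?P n)"
      by (intro nn_integral_cong inner)
    also have "\<dots> = ennreal (\<Prod>i<n. y - m i) * (\<integral>\<^sup>+r. \<integral>\<^sup>+\<rho>. H y r \<rho> \<partial>lborel \<partial>?P n)"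
      by (intro nn_integral_cmult) measurable
    finally have eq: "(\<integral>\<^sup>+x. (if interlaces n m x
        then ennreal (vdm (Suc n) x) * f2 y (secular_r m x n, secular_a m x n) else 0) \<partial>?P (Suc n)) =
        ennreal (vdm n m) * (ennreal (\<Prod>i<n. s i) * (ennreal (\<Prod>i<n. y - m i) *
        (\<integral>\<^sup>+r. \<integral>\<^sup>+\<rho>. H y r \<rho> \<partial>lborel \<partial>?P n)))" .
    \<comment> \<open>The product from the rescaling and the one from the Vandermonde factors
      combine into the quotient of \<open>vdm (Suc n) m\<close> by \<open>vdm n m\<close>.\<close>
    have P: "(\<Prod>i<n. m n - m i) = (\<Prod>i<n. s i) * (\<Prod>i<n. y - m i)"
      unfolding prod.distrib[symmetric] s_def using yi by (intro prod.cong) force+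
    have s0: "0 \<le> (\<Prod>i<n. s i)" using s by (intro prod_nonneg) (auto intro: less_imp_le)
    have v0: "0 \<le> vdm n m"
      using sm by (intro vdm_nonneg) (auto simp: strict_mono_on_def less_imp_le)
    show ?thesis
      unfolding eq vdm_Suc[of n m] ennreal_mult'[OF v0] P ennreal_mult'[OF s0] by (simp only: mult.assoc)
  qed
  \<comment> \<open>With all residues fixed, \<open>G\<close> matches the values y above
    \<open>m n\<close> with the real numbers a one to one, so the weight \<open>G'\<close> is used
    up by the substitution.\<close>
  have 4: "(\<integral>\<^sup>+y. H y r \<rho> \<partial>lborel) =
      (if (\<forall>i\<in>{..<n}. 0 < r i) \<and> 0 < \<rho> then \<integral>\<^sup>+a. f (r(n := \<rho>), a) \<partial>lborel else 0)"
    if r: "r \<in> space (?P n)" for r \<rho>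
  proof (cases "(\<forall>i\<in>{..<n}. 0 < r i) \<and> 0 < \<rho>")
    case True
    have "(\<integral>\<^sup>+y. H y r \<rho> \<partial>lborel) =
       (\<integral>\<^sup>+y. (if m n < y then ennreal (G' r \<rho> y) * f (r(n := \<rho>), G r \<rho> y) else 0) \<partial>lborel)"
      using True by (auto simp: H_def intro!: nn_integral_cong)
    also have "\<dots> = (\<integral>\<^sup>+a. f (r(n := \<rho>), a) \<partial>lborel)"
    proof (rule nn_integral_subst_half_line)
      have "r(n := \<rho>) \<in> space (?P (Suc n))" using r by (auto simp: space_PiM PiE_def extensional_def)
      then have "(\<lambda>a. f (r(n := \<rho>), a)) \<in> borel_measurable lborel" by measurable
      then show "(\<lambda>a. f (r(n := \<rho>), a)) \<in> borel_measurable borel" by simp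
      show "G r \<rho> \<in> borel_measurable borel" "G' r \<rho> \<in> borel_measurable borel"
        unfolding G_def G'_def by measurable
      show "(G r \<rho> has_real_derivative G' r \<rho> y) (at y)" if "m n < y" for y
      proof -
        have d1: "((\<lambda>y. r i / (y - m i)) has_real_derivative - (r i / (y - m i)\<^sup>2)) (at y)" if "i < n" for i
          using lt[OF that] \<open>m n < y\<close> by (auto intro!: derivative_eq_intros simp: power2_eq_square)
        have "((\<lambda>y. \<rho> / (y - m n)) has_real_derivative - (\<rho> / (y - m n)\<^sup>2)) (at y)"
          using \<open>m n < y\<close> by (auto intro!: derivative_eq_intros simp: power2_eq_square)
        note d2 = this
        have "((\<lambda>y. \<Sum>i<n. r i / (y - m i)) has_real_derivative (\<Sum>i<n. - (r i / (y - m i)\<^sup>2))) (at y)"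
          by (intro DERIV_sum d1) simp
        from DERIV_diff[OF DERIV_diff[OF DERIV_ident this] d2] show ?thesis
          unfolding G_def[abs_def] G'_def by (simp add: sum_negf)
      qed
      show "0 < G' r \<rho> y" if "m n < y" for y
      proof -
        have "0 \<le> (\<Sum>i<n. r i / (y - m i)\<^sup>2)"
          using True by (intro sum_nonneg divide_nonneg_nonneg) (auto intro: less_imp_le)
        moreover have "0 < \<rho> / (y - m n)\<^sup>2" using True that by simp
        ultimately show ?thesis unfolding G'_def by linarith
      qed
      show "\<exists>y>m n. G r \<rho> y = u" for u
        unfolding G_def using True by (intro secular_function_surj[OF Suc.prems(1)]) (auto intro: less_imp_le)
    qed
    finally show ?thesis unfolding if_P[OF True] .
  next
    case False
    then have "H y r \<rho> = 0" for y by (auto simp: H_def)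
    then show ?thesis unfolding if_not_P[OF False] by simp
  qed
  interpret PP: pair_sigma_finite "lborel :: real measure" "?P n"
    by (intro pair_sigma_finite.intro F.sigma_finite_measure_axioms sigma_finite_lborel)
  have "(\<integral>\<^sup>+l. (if interlaces (Suc n) m l
            then ennreal (vdm (Suc (Suc n)) l) * f (secular_r m l (Suc n), secular_a m l (Suc n)) else 0)
          \<partial>?P (Suc (Suc n))) =
      (\<integral>\<^sup>+y. \<integral>\<^sup>+x. (if m n < y then if interlaces n m x
        then ennreal (vdm (Suc n) x) * f2 y (secular_r m x n, secular_a m x n) else 0 else 0)
        \<partial>?P (Suc n) \<partial>lborel)"
    unfolding ins[of "Suc n"] using 1[unfolded ins[of "Suc n"]]
    by (subst lborel_PiM.product_nn_integral_insert_rev) (auto simp: 2)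
  also have "\<dots> = (\<integral>\<^sup>+y. ennreal (vdm (Suc n) m) * (\<integral>\<^sup>+r. \<integral>\<^sup>+\<rho>. H y r \<rho> \<partial>lborel \<partial>?P n) \<partial>lborel)"
  proof (intro nn_integral_cong)
    fix y show "(\<integral>\<^sup>+x. (if m n < y then if interlaces n m x
        then ennreal (vdm (Suc n) x) * f2 y (secular_r m x n, secular_a m x n) else 0 else 0) \<partial>?P (Suc n)) =
        ennreal (vdm (Suc n) m) * (\<integral>\<^sup>+r. \<integral>\<^sup>+\<rho>. H y r \<rho> \<partial>lborel \<partial>?P n)"
    proof (cases "m n < y")
      case True then show ?thesis using 3[OF True] by simp
    next
      case False then show ?thesis by (simp add: H_def)
    qed
  qed
  also have "\<dots> = ennreal (vdm (Suc n) m) * (\<integral>\<^sup>+y. (\<integral>\<^sup>+r. \<integral>\<^sup>+\<rho>. H y r \<rho> \<partial>lborel \<partial>?P n) \<partial>lborel)"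
    by (intro nn_integral_cmult) measurable
  also have "(\<integral>\<^sup>+y. (\<integral>\<^sup>+r. \<integral>\<^sup>+\<rho>. H y r \<rho> \<partial>lborel \<partial>?P n) \<partial>lborel) =
      (\<integral>\<^sup>+r. \<integral>\<^sup>+y. \<integral>\<^sup>+\<rho>. H y r \<rho> \<partial>lborel \<partial>lborel \<partial>?P n)"
    by (intro PP.Fubini'[symmetric]) measurable
  also have "\<dots> = (\<integral>\<^sup>+r. \<integral>\<^sup>+\<rho>. \<integral>\<^sup>+y. H y r \<rho> \<partial>lborel \<partial>lborel \<partial>?P n)"
    by (intro nn_integral_cong lborel_pair.Fubini') measurable
  also have "\<dots> = (\<integral>\<^sup>+r. \<integral>\<^sup>+\<rho>. \<integral>\<^sup>+a. (if (\<forall>i\<in>{..<n}. 0 < r i) \<and> 0 < \<rho> then f (r(n := \<rho>), a) else 0) \<partial>lborel \<partial>lborel \<partial>?P n)"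
    by (rule nn_integral_cong, rule nn_integral_cong) (simp only: if_const 4)
  also have "\<dots> = (\<integral>\<^sup>+r. \<integral>\<^sup>+\<rho>. \<integral>\<^sup>+a. (if \<forall>i\<in>{..<Suc n}. 0 < (r(n := \<rho>)) i then f (r(n := \<rho>), a) else 0)
      \<partial>lborel \<partial>lborel \<partial>?P n)"
  proof -
    have "(\<forall>i\<in>{..<Suc n}. 0 < (r(n := \<rho>)) i) \<longleftrightarrow> (\<forall>i\<in>{..<n}. 0 < r i) \<and> 0 < \<rho>" for r :: "nat \<Rightarrow> real" and \<rho>
      by (auto simp: less_Suc_eq)
    then show ?thesis by (simp only:)
  qed
  also have "\<dots> = (\<integral>\<^sup>+r. \<integral>\<^sup>+a. (if \<forall>i\<in>{..<Suc n}. 0 < r i then f (r, a) else 0) \<partial>lborel \<partial>?P (Suc n))"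
    using lborel_PiM.product_nn_integral_insert[of "{..<n}" n
      "\<lambda>r. \<integral>\<^sup>+a. (if \<forall>i\<in>{..<Suc n}. 0 < r i then f (r, a) else 0) \<partial>lborel", folded ins]
    by (simp del: fun_upd_apply)
  finally show ?case .
qed

section \<open>Spectra of Hermitian matrices\<close>

lemma mat_adjoint_dim[simp]:
  "dim_row (mat_adjoint A) = dim_col A" "dim_col (mat_adjoint A) = dim_row A"
  by (auto simp: mat_adjoint_def)

lemma mat_adjoint_carrier[simp]: "A \<in> carrier_mat n m \<Longrightarrow> mat_adjoint A \<in> carrier_mat m n"
  unfolding carrier_mat_def by simp

lemma mat_adjoint_index[simp]:
  "i < dim_col A \<Longrightarrow> j < dim_row A \<Longrightarrow> mat_adjoint A $$ (i, j) = conjugate (A $$ (j, i))"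
  by (simp add: mat_adjoint_def mat_of_rows_index)

lemma mat_adjoint_adjoint[simp]: "mat_adjoint (mat_adjoint A) = (A :: complex mat)"
  by (intro eq_matI) auto

lemma mult_mat_index:
  "A \<in> carrier_mat n m \<Longrightarrow> B \<in> carrier_mat m k \<Longrightarrow> i < n \<Longrightarrow> j < k \<Longrightarrow>
    (A * B) $$ (i, j) = (\<Sum>l<m. A $$ (i, l) * B $$ (l, j))"
  by (auto simp: scalar_prod_def atLeast0LessThan)

lemma mat_adjoint_mult:
  assumes "A \<in> carrier_mat n m" "B \<in> carrier_mat m k"
  shows "mat_adjoint (A * B :: complex mat) = mat_adjoint B * mat_adjoint A"
proof (rule eq_matI)
  fix i j assume "i < dim_row (mat_adjoint B * mat_adjoint A)" "j < dim_col (mat_adjoint B * mat_adjoint A)"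
  then have ij: "i < k" "j < n" using assms by auto
  show "mat_adjoint (A * B) $$ (i, j) = (mat_adjoint B * mat_adjoint A) $$ (i, j)"
  proof -
    have "mat_adjoint (A * B) $$ (i, j) = conjugate ((A * B) $$ (j, i))"
      using assms ij by (intro mat_adjoint_index) auto
    then show ?thesis
      unfolding mult_mat_index[OF assms ij(2,1)]
        mult_mat_index[OF mat_adjoint_carrier[OF assms(2)] mat_adjoint_carrier[OF assms(1)] ij]
      using assms ij by (simp add: mult.commute)
  qed
qed (use assms in auto)

lemma hermitian_mats_iff:
  "A \<in> hermitian_mats n \<longleftrightarrow> A \<in> carrier_mat n n \<and> (\<forall>i<n. \<forall>j<n. A $$ (i, j) = cnj (A $$ (j, i)))"
proof -
  have "mat_adjoint A = A \<longleftrightarrow> (\<forall>i<n. \<forall>j<n. A $$ (i, j) = cnj (A $$ (j, i)))"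
    if A: "A \<in> carrier_mat n n"
  proof
    assume e: "mat_adjoint A = A"
    show "\<forall>i<n. \<forall>j<n. A $$ (i, j) = cnj (A $$ (j, i))"
    proof (intro allI impI)
      fix i j assume "i < n" "j < n"
      then show "A $$ (i, j) = cnj (A $$ (j, i))"
        using A mat_adjoint_index[of i A j] by (simp add: e)
    qed
  next
    assume e: "\<forall>i<n. \<forall>j<n. A $$ (i, j) = cnj (A $$ (j, i))"
    show "mat_adjoint A = A"
    proof (rule eq_matI)
      fix i j assume "i < dim_row A" "j < dim_col A"
      then have "i < n" "j < n" using A by auto
      then show "mat_adjoint A $$ (i, j) = A $$ (i, j)"
        using A by (subst e[rule_format, of i j]) auto
    qed (use A in auto)
  qed
  then show ?thesis unfolding hermitian_mats_def by blast
qed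

text \<open>Gram-Schmidt applied to a basis that starts with \<open>v\<close> keeps \<open>v\<close>
  in front, and normalising the columns makes them orthonormal. The factor \<open>c\<close> is the
  normalisation of \<open>v\<close>.\<close>

lemma unitary_mat_exists:
  fixes v :: "complex vec"
  assumes v: "v \<in> carrier_vec n" "v \<noteq> 0\<^sub>v n" and n: "0 < n"
  shows "\<exists>W c. W \<in> carrier_mat n n \<and> mat_adjoint W * W = 1\<^sub>m n \<and> W * mat_adjoint W = 1\<^sub>m n \<and>
    (\<forall>i<n. W $$ (i, 0) = c * v $ i)"
proof -
  interpret cof_vec_space n "TYPE(complex)" .
  define b where "b = basis_completion v"
  define ws where "ws = gram_schmidt n b"
  note bc = basis_completion[OF v, folded b_def]
  from bc(6,7) n obtain vs where bv: "b = v # vs" by (cases b) auto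
  from gram_schmidt_result[OF bc(2,4,5) refl, folded ws_def] bc(6)
  have ws: "set ws \<subseteq> carrier_vec n" "corthogonal ws" "length ws = n" by auto
  have "hd ws = v" using gram_schmidt_hd[OF v(1), of vs, folded bv] by (simp add: ws_def)
  then have ws0: "ws ! 0 = v" using ws n by (cases ws) auto
  have wsi: "ws ! i \<in> carrier_vec n" if "i < n" for i using ws that by auto
  define d where "d j = (\<Sum>k<n. (cmod (ws ! j $ k))\<^sup>2)" for j
  have prod: "ws ! j \<bullet>c ws ! i = (\<Sum>k<n. cnj (ws ! i $ k) * ws ! j $ k)" if "i < n" "j < n" for i j
    using wsi[OF that(1)] wsi[OF that(2)] by (auto simp: scalar_prod_def atLeast0LessThan mult.commute)
  have d: "0 < d j" if "j < n" for j
  proof -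
    have "of_real (d j) = ws ! j \<bullet>c ws ! j"
      unfolding prod[OF that that] d_def of_real_sum
      by (intro sum.cong refl) (metis complex_norm_square mult.commute)
    moreover have "ws ! j \<bullet>c ws ! j \<noteq> 0" using corthogonalD[OF ws(2), of j j] ws(3) that by simp
    ultimately have "d j \<noteq> 0" by auto
    moreover have "0 \<le> d j" unfolding d_def by (intro sum_nonneg) auto
    ultimately show ?thesis by simp
  qed
  define W where "W = Matrix.mat n n (\<lambda>(k, j). ws ! j $ k / of_real (sqrt (d j)))"
  have W: "W \<in> carrier_mat n n" by (simp add: W_def)
  have WW: "mat_adjoint W * W = 1\<^sub>m n"
  proof (rule eq_matI)
    fix i j assume "i < dim_row (1\<^sub>m n :: complex mat)" "j < dim_col (1\<^sub>m n :: complex mat)"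
    then have ij: "i < n" "j < n" by auto
    have "(mat_adjoint W * W) $$ (i, j) = (\<Sum>l<n. mat_adjoint W $$ (i, l) * W $$ (l, j))"
      using W ij by (intro mult_mat_index) auto
    also have "\<dots> = (\<Sum>k<n. cnj (ws ! i $ k) * ws ! j $ k) / (of_real (sqrt (d i)) * of_real (sqrt (d j)))"
      using W ij by (simp add: W_def sum_divide_distrib)
    also have "\<dots> = 1\<^sub>m n $$ (i, j)"
    proof (cases "i = j")
      case True
      have "(\<Sum>k<n. cnj (ws ! j $ k) * ws ! j $ k) = of_real (d j)"
        unfolding d_def of_real_sum by (intro sum.cong refl) (metis complex_norm_square mult.commute)
      then show ?thesis using True ij d[of j] by (simp add: of_real_mult[symmetric] del: of_real_mult)
    next
      case False
      then have "ws ! j \<bullet>c ws ! i = 0" using corthogonalD[OF ws(2), of j i] ws(3) ij by auto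
      then show ?thesis using False ij prod[OF ij] by simp
    qed
    finally show "(mat_adjoint W * W) $$ (i, j) = 1\<^sub>m n $$ (i, j)" .
  qed (use W in auto)
  moreover have "W * mat_adjoint W = 1\<^sub>m n"
    using mat_mult_left_right_inverse[OF _ W WW] W by auto
  moreover have "\<forall>i<n. W $$ (i, 0) = (1 / of_real (sqrt (d 0))) * v $ i"
    using n by (simp add: W_def ws0)
  ultimately show ?thesis using W by blast
qed

lemma mult_mat_regroup:
  assumes "A \<in> carrier_mat n n" "B \<in> carrier_mat n n" "C \<in> carrier_mat n n" "D \<in> carrier_mat n n" "E \<in> carrier_mat n n"
  shows "A * (B * (C * D)) * E = (A * B) * C * (D * E)"
  using assms by (simp add: assoc_mult_mat[of _ n n _ n _ n] mult_carrier_mat[of _ n n _ n])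

lemma mult_mat_regroup':
  assumes "A \<in> carrier_mat n n" "B \<in> carrier_mat n n" "C \<in> carrier_mat n n" "D \<in> carrier_mat n n" "E \<in> carrier_mat n n"
  shows "(A * B) * C * (D * E) = A * (B * C * D) * E"
  using assms by (simp add: assoc_mult_mat[of _ n n _ n _ n] mult_carrier_mat[of _ n n _ n])

lemma mult_mat_regroup'':
  assumes "A \<in> carrier_mat n n" "B \<in> carrier_mat n n" "C \<in> carrier_mat n n" "D \<in> carrier_mat n n"
  shows "(A * B) * (C * D) = A * (B * C) * D"
  using assms by (simp add: assoc_mult_mat[of _ n n _ n _ n] mult_carrier_mat[of _ n n _ n])

lemma char_poly_unitary:
  fixes A :: "complex mat"
  assumes "A \<in> carrier_mat n n" "U \<in> carrier_mat n n" "mat_adjoint U * U = 1\<^sub>m n" "U * mat_adjoint U = 1\<^sub>m n"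
  shows "char_poly (U * A * mat_adjoint U) = char_poly A"
  using assms
  by (intro char_poly_similar similar_matI[of _ _ U "mat_adjoint U" n]) auto

text \<open>Deflation: conjugation by a unitary matrix whose first column is an eigenvector clears
  the rest of the first column, hence by symmetry of the first row, and leaves a smaller Hermitian
  block. The list \<open>es\<close> prescribes the order on the diagonal, so that the increasing
  order can be requested later.\<close>

lemma hermitian_spectral:
  fixes H :: "complex mat"
  assumes "H \<in> hermitian_mats n" "char_poly H = (\<Prod>e\<leftarrow>es. [:- e, 1:])" "length es = n"
  shows "\<exists>U. U \<in> carrier_mat n n \<and> mat_adjoint U * U = 1\<^sub>m n \<and> U * mat_adjoint U = 1\<^sub>m n \<and>
    H = U * mat_diag n (\<lambda>i. es ! i) * mat_adjoint U"
  using assms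
proof (induction es arbitrary: n H)
  case Nil
  then have "H \<in> carrier_mat 0 0" by (auto simp: hermitian_mats_def)
  with Nil show ?case by (intro exI[of _ "1\<^sub>m 0"]) (auto intro!: eq_matI)
next
  case (Cons e es)
  then obtain k where n: "n = Suc k" and es: "length es = k" by auto
  have H: "H \<in> carrier_mat n n" and Hh: "mat_adjoint H = H"
    using Cons.prems(1) by (auto simp: hermitian_mats_def)
  have "eigenvalue H e"
    unfolding eigenvalue_root_char_poly[OF H] Cons.prems(2) by simp
  then obtain v where v: "v \<in> carrier_vec n" "v \<noteq> 0\<^sub>v n" "H *\<^sub>v v = e \<cdot>\<^sub>v v"
    using H unfolding eigenvalue_def eigenvector_def by auto
  from unitary_mat_exists[OF v(1,2)] n obtain W c where W: "W \<in> carrier_mat n n"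
    "mat_adjoint W * W = 1\<^sub>m n" "W * mat_adjoint W = 1\<^sub>m n" "\<And>i. i < n \<Longrightarrow> W $$ (i, 0) = c * v $ i" by auto
  note assoc = assoc_mult_mat[of _ n n _ n _ n]
  define A where "A = mat_adjoint W * (H * W)"
  have A: "A \<in> carrier_mat n n" 
    unfolding A_def by (rule mult_carrier_mat[OF mat_adjoint_carrier[OF W(1)] mult_carrier_mat[OF H W(1)]])
  have Ah: "mat_adjoint A = A"
    unfolding A_def using W H Hh by (simp add: mat_adjoint_mult[of _ n n _ n] assoc)
  have WAW: "W * A * mat_adjoint W = H"
  proof -
    have "W * A * mat_adjoint W = (W * mat_adjoint W) * H * (W * mat_adjoint W)"
      unfolding A_def using W(1) H by (intro mult_mat_regroup[of _ n]) auto
    then show ?thesis using W H by simp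
  qed
  have HW: "(H * W) $$ (l, 0) = e * W $$ (l, 0)" if "l < n" for l
  proof -
    have "(H *\<^sub>v v) $ l = (\<Sum>i<n. H $$ (l, i) * v $ i)"
      using H v(1) that by (auto simp: scalar_prod_def atLeast0LessThan)
    moreover have "(H *\<^sub>v v) $ l = e * v $ l" unfolding v(3) using v(1) that by simp
    ultimately have "e * v $ l = (\<Sum>i<n. H $$ (l, i) * v $ i)" by simp
    then have "c * (e * v $ l) = (\<Sum>i<n. H $$ (l, i) * (c * v $ i))"
      by (simp add: sum_distrib_left mult_ac)
    also have "\<dots> = (H * W) $$ (l, 0)"
      using H W that n by (subst mult_mat_index[of _ n n _ n]) auto
    finally show ?thesis using W(4)[OF that] by (simp add: mult_ac)
  qed
  have A0: "A $$ (i, 0) = (if i = 0 then e else 0)" if i: "i < n" for i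
  proof -
    have "A $$ (i, 0) = (\<Sum>l<n. mat_adjoint W $$ (i, l) * (H * W) $$ (l, 0))"
      unfolding A_def using W H i n by (intro mult_mat_index) auto
    also have "\<dots> = e * (\<Sum>l<n. mat_adjoint W $$ (i, l) * W $$ (l, 0))"
      by (simp add: HW sum_distrib_left mult_ac)
    also have "(\<Sum>l<n. mat_adjoint W $$ (i, l) * W $$ (l, 0)) = (mat_adjoint W * W) $$ (i, 0)"
      using W i n by (intro mult_mat_index[symmetric]) auto
    finally show ?thesis using W i n by simp
  qed
  have e: "cnj e = e"
    using A0[of 0] n arg_cong[OF Ah, of "\<lambda>M. M $$ (0, 0)"] A by simp
  have A0': "A $$ (0, i) = (if i = 0 then e else 0)" if i: "i < n" for i
  proof -
    have "A $$ (0, i) = cnj (A $$ (i, 0))" by (subst Ah[symmetric]) (use A i n in auto)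
    then show ?thesis using A0[OF i] e by auto
  qed
  define B where "B = Matrix.mat k k (\<lambda>(i, j). A $$ (Suc i, Suc j))"
  define E where "E = Matrix.mat 1 1 (\<lambda>_. e)"
  have B: "B \<in> carrier_mat k k" by (simp add: B_def)
  have E: "E \<in> carrier_mat 1 1" by (simp add: E_def)
  have AB: "A = four_block_mat E (0\<^sub>m 1 k) (0\<^sub>m k 1) B"
    using A n A0 A0' by (intro eq_matI) (auto simp: B_def E_def)
  have "A \<in> hermitian_mats n" using A Ah by (simp add: hermitian_mats_def)
  then have hA: "\<forall>i<n. \<forall>j<n. A $$ (i, j) = cnj (A $$ (j, i))" unfolding hermitian_mats_iff by blast
  have Bh: "B \<in> hermitian_mats k"
    unfolding hermitian_mats_iff
  proof (intro conjI allI impI B)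
    fix i j assume "i < k" "j < k"
    then show "B $$ (i, j) = cnj (B $$ (j, i))"
      using hA[rule_format, of "Suc i" "Suc j"] n by (simp only: B_def index_mat prod.case Suc_less_eq)
  qed
  have "char_poly H = char_poly A"
    using char_poly_unitary[OF A W(1-3)] WAW by simp
  also have "\<dots> = char_poly E * char_poly B"
    unfolding AB by (rule char_poly_four_block_zeros_col[OF E _ B]) simp
  also have "char_poly E = [:- e, 1:]"
    unfolding E_def char_poly_defs by (subst det_single) auto
  finally have "[:- e, 1:] * (\<Prod>e\<leftarrow>es. [:- e, 1:]) = [:- e, 1:] * char_poly B"
    using Cons.prems(2) by simp
  then have "char_poly B = (\<Prod>e\<leftarrow>es. [:- e, 1:])"
    by (subst (asm) mult_cancel_left) auto
  from Cons.IH[OF Bh this es] obtain V where V: "V \<in> carrier_mat k k" "mat_adjoint V * V = 1\<^sub>m k"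
    "V * mat_adjoint V = 1\<^sub>m k" "B = V * mat_diag k (\<lambda>i. es ! i) * mat_adjoint V" by auto
  define X where "X = four_block_mat (1\<^sub>m 1) (0\<^sub>m 1 k) (0\<^sub>m k 1) V"
  define D where "D = mat_diag k (\<lambda>i. es ! i)"
  have D: "D \<in> carrier_mat k k" by (simp add: D_def)
  have X: "X \<in> carrier_mat n n" 
    using four_block_carrier_mat[of "1\<^sub>m 1" 1 1 V k k] V n by (simp add: X_def)
  have Xa: "mat_adjoint X = four_block_mat (1\<^sub>m 1) (0\<^sub>m 1 k) (0\<^sub>m k 1) (mat_adjoint V)"
    using V n by (intro eq_matI) (auto simp: X_def)
  have DD: "mat_diag n (\<lambda>i. (e # es) ! i) = four_block_mat E (0\<^sub>m 1 k) (0\<^sub>m k 1) D"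
    using n by (intro eq_matI) (auto simp: mat_diag_def E_def D_def nth_Cons split: nat.splits)
  have m: "four_block_mat P (0\<^sub>m 1 k) (0\<^sub>m k 1) Q * four_block_mat P' (0\<^sub>m 1 k) (0\<^sub>m k 1) Q' =
      four_block_mat (P * P') (0\<^sub>m 1 k) (0\<^sub>m k 1) (Q * Q')"
    if "P \<in> carrier_mat 1 1" "P' \<in> carrier_mat 1 1" "Q \<in> carrier_mat k k" "Q' \<in> carrier_mat k k" for P P' Q Q' :: "complex mat"
    using that by (subst mult_four_block_mat[of _ 1 1 _ k _ k _ _ 1 _ k]) auto
  have Va: "mat_adjoint V \<in> carrier_mat k k" using V by simp
  have 1: "mat_adjoint X * X = 1\<^sub>m n" "X * mat_adjoint X = 1\<^sub>m n"
    unfolding Xa unfolding X_def using V n Va by (simp_all add: m del: One_nat_def add: plus_1_eq_Suc)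
  have 2: "X * mat_diag n (\<lambda>i. (e # es) ! i) * mat_adjoint X = A"
    unfolding Xa DD AB V(4) D_def[symmetric] unfolding X_def using V Va D E by (simp add: m del: One_nat_def)
  have Wa: "mat_adjoint W \<in> carrier_mat n n" and Xa': "mat_adjoint X \<in> carrier_mat n n"
    using W X by auto
  have a: "mat_adjoint (W * X) = mat_adjoint X * mat_adjoint W"
    by (rule mat_adjoint_mult[OF W(1) X])
  have "H = (W * X) * mat_diag n (\<lambda>i. (e # es) ! i) * mat_adjoint (W * X)"
    unfolding a mult_mat_regroup'[OF W(1) X mat_diag_dim Xa' Wa] 2 WAW ..
  moreover have "mat_adjoint (W * X) * (W * X) = 1\<^sub>m n"
    unfolding a mult_mat_regroup''[OF Xa' Wa W(1) X] W(2) right_mult_one_mat[OF Xa'] by (rule 1)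
  moreover have "(W * X) * mat_adjoint (W * X) = 1\<^sub>m n"
    unfolding a mult_mat_regroup''[OF W(1) X Xa' Wa] 1 right_mult_one_mat[OF W(1)] by (rule W)
  ultimately show ?case using W X mult_carrier_mat[OF W(1) X] by (intro exI[of _ "W * X"]) auto
qed

lemma proots_prod_list_linear:
  fixes es :: "'a::idom list"
  shows "proots (\<Prod>e\<leftarrow>es. [:- e, 1:]) = mset es"
proof (induction es)
  case (Cons e es)
  have "(\<Prod>e\<leftarrow>es. [:- e, 1:]) \<noteq> 0" by (auto simp: prod_list_zero_iff)
  then show ?case using Cons by (simp add: proots_mult del: mult_pCons_left)
qed simp

lemma prod_linear_factors_conv_list:
  "(\<Prod>i<n. [:- f i, 1:]) = (\<Prod>e\<leftarrow>map f [0..<n]. [:- e, 1:])"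
  by (induction n) (auto simp: mult.commute simp del: mult_pCons_left mult_pCons_right)

lemma hermitian_eigvals:
  assumes H: "H \<in> hermitian_mats n"
  shows "length (eigvals H) = n" "sorted (eigvals H)"
    "char_poly H = (\<Prod>i<n. [:- of_real (eigvals H ! i), 1:])"
    "\<exists>U. U \<in> carrier_mat n n \<and> mat_adjoint U * U = 1\<^sub>m n \<and> U * mat_adjoint U = 1\<^sub>m n \<and>
      H = U * mat_diag n (\<lambda>i. of_real (eigvals H ! i)) * mat_adjoint U"
proof -
  have Hc: "H \<in> carrier_mat n n" and Hh: "mat_adjoint H = H"
    using H by (auto simp: hermitian_mats_def)
  obtain es where es: "char_poly H = (\<Prod>e\<leftarrow>es. [:- e, 1:])" "length es = n"
    using char_poly_factorized[OF Hc] by auto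
  obtain U where U: "U \<in> carrier_mat n n" "mat_adjoint U * U = 1\<^sub>m n" "U * mat_adjoint U = 1\<^sub>m n"
    "H = U * mat_diag n (\<lambda>i. es ! i) * mat_adjoint U" using hermitian_spectral[OF H es] by auto
  \<comment> \<open>The diagonal form is unitarily conjugate to \<open>H\<close>, hence Hermitian,
    hence its entries are real. So taking \<open>Re\<close> in \<open>eigvals\<close> loses
    nothing.\<close>
  have real: "of_real (Re e) = e" if mem: "e \<in> set es" for e
  proof -
    obtain i where i: "i < n" "e = es ! i" using mem unfolding in_set_conv_nth es(2) by blast
    let ?D = "mat_diag n (\<lambda>i. es ! i)"
    have Ua: "mat_adjoint U \<in> carrier_mat n n" using U(1) by (rule mat_adjoint_carrier)
    have "mat_adjoint U * H * U = (mat_adjoint U * U) * ?D * (mat_adjoint U * U)"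
      unfolding mult_mat_regroup'[OF Ua U(1) mat_diag_dim Ua U(1)] U(4)[symmetric] ..
    then have D: "?D = mat_adjoint U * H * U"
      unfolding U(2) left_mult_one_mat[OF mat_diag_dim] right_mult_one_mat[OF mat_diag_dim] by (rule sym)
    have "mat_adjoint ?D = ?D"
      unfolding D mat_adjoint_mult[OF mult_carrier_mat[OF Ua Hc] U(1)] mat_adjoint_mult[OF Ua Hc] Hh
        mat_adjoint_adjoint by (rule assoc_mult_mat[OF Ua Hc U(1), symmetric])
    from arg_cong[OF this, of "\<lambda>M. M $$ (i, i)"] i have "cnj e = e" by (simp add: mat_diag_def)
    then show ?thesis by (metis Reals_cnj_iff of_real_Re)
  qed
  have "proots (char_poly H) = mset es"
    unfolding es(1) by (rule proots_prod_list_linear)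
  then have ev: "eigvals H = sort (map Re es)"
    unfolding eigvals_def by (simp only: mset_map[symmetric] sorted_list_of_multiset_mset)
  show len: "length (eigvals H) = n" and "sorted (eigvals H)" using ev es by auto
  have "mset (map of_real (eigvals H)) = (mset es :: complex multiset)"
  proof -
    have "map (\<lambda>e. complex_of_real (Re e)) es = es" using real by (intro map_idI) auto
    then have "mset (map (\<lambda>e. complex_of_real (Re e)) es) = mset es" by simp
    then show ?thesis unfolding ev by (simp add: image_mset.compositionality comp_def)
  qed
  moreover have "(\<Prod>e\<leftarrow>xs. [:- e, 1:]) = (\<Prod>e\<in>#mset xs. [:- e, 1:])" for xs :: "complex list"
    unfolding mset_map[symmetric] by (rule prod_mset_prod_list[symmetric])
  ultimately have "(\<Prod>e\<leftarrow>map of_real (eigvals H). [:- e, 1:]) = (\<Prod>e\<leftarrow>es. [:- e, 1:])"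
    by (simp only:)
  then have cp: "char_poly H = (\<Prod>e\<leftarrow>map of_real (eigvals H). [:- e, 1:])" using es by simp
  then show "char_poly H = (\<Prod>i<n. [:- of_real (eigvals H ! i), 1:])"
  proof -
    have "map (\<lambda>i. complex_of_real (eigvals H ! i)) [0..<n] = map of_real (eigvals H)"
      by (rule nth_equalityI) (auto simp: len)
    then show ?thesis unfolding prod_linear_factors_conv_list cp by simp
  qed
  have "mat_diag n (\<lambda>i. map of_real (eigvals H) ! i) = mat_diag n (\<lambda>i. of_real (eigvals H ! i) :: complex)"
    using len by (intro eq_matI) (auto simp: mat_diag_def)
  then show "\<exists>U. U \<in> carrier_mat n n \<and> mat_adjoint U * U = 1\<^sub>m n \<and> U * mat_adjoint U = 1\<^sub>m n \<and>
      H = U * mat_diag n (\<lambda>i. of_real (eigvals H ! i)) * mat_adjoint U"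
    using hermitian_spectral[OF H cp] len by simp
qed

lemma eigvals_eqI:
  assumes "char_poly A = (\<Prod>i<n. [:- of_real (l i), 1:])" "mono_on {..<n} l"
  shows "eigvals A = map l [0..<n]"
proof -
  have "proots (char_poly A) = mset (map (\<lambda>i. of_real (l i)) [0..<n])"
    unfolding assms(1) prod_linear_factors_conv_list by (rule proots_prod_list_linear)
  then have "image_mset Re (proots (char_poly A)) = mset (map l [0..<n])"
    by (simp only: mset_map[symmetric] map_map comp_def Re_complex_of_real)
  then have "eigvals A = sort (map l [0..<n])"
    unfolding eigvals_def by (simp only: sorted_list_of_multiset_mset)
  also have "sorted (map l [0..<n])"
    using assms(2) by (auto simp: sorted_iff_nth_mono mono_on_def)
  then have "sort (map l [0..<n]) = map l [0..<n]" by (rule sorted_sort_id)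
  finally show ?thesis .
qed

section \<open>Bordered matrices and arrow matrices\<close>

definition bordered :: "nat \<Rightarrow> complex mat \<Rightarrow> (nat \<Rightarrow> complex) \<Rightarrow> real \<Rightarrow> complex mat" where
  "bordered n H v a = four_block_mat H (Matrix.mat n 1 (\<lambda>(i, _). v i))
     (Matrix.mat 1 n (\<lambda>(_, j). cnj (v j))) (Matrix.mat 1 1 (\<lambda>_. of_real a))"

lemma bordered_carrier[simp]: "H \<in> carrier_mat n n \<Longrightarrow> bordered n H v a \<in> carrier_mat (Suc n) (Suc n)"
  by (simp add: bordered_def four_block_carrier_mat[of _ n n _ 1 1, simplified])

lemma bordered_index:
  assumes "H \<in> carrier_mat n n" "i \<le> n" "j \<le> n"
  shows "bordered n H v a $$ (i, j) =
    (if i < n then if j < n then H $$ (i, j) else v i else if j < n then cnj (v j) else of_real a)"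
  using assms by (auto simp: bordered_def)

lemma bordered_hermitian:
  assumes "H \<in> hermitian_mats n"
  shows "bordered n H v a \<in> hermitian_mats (Suc n)"
proof -
  have H: "H \<in> carrier_mat n n" and h: "\<forall>i<n. \<forall>j<n. H $$ (i, j) = cnj (H $$ (j, i))"
    using assms unfolding hermitian_mats_iff by blast+
  have "bordered n H v a $$ (i, j) = cnj (bordered n H v a $$ (j, i))" if "i \<le> n" "j \<le> n" for i j
    using h[rule_format, of i j] that by (simp add: bordered_index[OF H])
  then show ?thesis unfolding hermitian_mats_iff less_Suc_eq_le using H bordered_carrier by blast
qed

text \<open>The adjoint of \<open>U\<close> applied to the vector \<open>v\<close>, restricted to
  indices below n so that the result is again a point of the product space carrying the Gaussian
  law.\<close>

definition adjoint_action :: "nat \<Rightarrow> complex mat \<Rightarrow> (nat \<Rightarrow> complex) \<Rightarrow> nat \<Rightarrow> complex" where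
  "adjoint_action n U v = (\<lambda>i\<in>{..<n}. \<Sum>j<n. cnj (U $$ (j, i)) * v j)"

text \<open>The block diagonal matrix of \<open>U\<close> and 1 conjugates the second bordered
  matrix into the first: it multiplies the border by \<open>U\<close>, which undoes the adjoint, and
  fixes the last diagonal entry.\<close>

lemma char_poly_bordered_unitary:
  assumes U: "U \<in> carrier_mat n n" "mat_adjoint U * U = 1\<^sub>m n" "U * mat_adjoint U = 1\<^sub>m n"
    and D: "D \<in> carrier_mat n n"
  shows "char_poly (bordered n (U * D * mat_adjoint U) v a) = char_poly (bordered n D (adjoint_action n U v) a)"
proof -
  define X where "X = four_block_mat U (0\<^sub>m n 1) (0\<^sub>m 1 n) (1\<^sub>m 1)"
  define b where "b = Matrix.mat n 1 (\<lambda>(i, _). v i)"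
  define b' where "b' = Matrix.mat n 1 (\<lambda>(i, _). adjoint_action n U v i)"
  have Ua: "mat_adjoint U \<in> carrier_mat n n" using U by simp
  have c[simp]: "b \<in> carrier_mat n 1" "b' \<in> carrier_mat n 1" by (auto simp: b_def b'_def)
  then have ca[simp]: "mat_adjoint b \<in> carrier_mat 1 n" "mat_adjoint b' \<in> carrier_mat 1 n" by auto
  have X: "X \<in> carrier_mat (n + 1) (n + 1)"
    unfolding X_def using U by (intro four_block_carrier_mat) auto
  have Xa: "mat_adjoint X = four_block_mat (mat_adjoint U) (0\<^sub>m n 1) (0\<^sub>m 1 n) (1\<^sub>m 1)"
    using U by (intro eq_matI) (auto simp: X_def)
  have b': "b' = mat_adjoint U * b"
  proof (rule eq_matI)
    fix i j assume "i < dim_row (mat_adjoint U * b)" "j < dim_col (mat_adjoint U * b)"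
    then have ij: "i < n" "j < 1" using U by (auto simp: b_def)
    then show "b' $$ (i, j) = (mat_adjoint U * b) $$ (i, j)"
      unfolding mult_mat_index[OF Ua c(1) ij] using U
      by (simp add: b'_def b_def adjoint_action_def)
  qed (use U in \<open>auto simp: b'_def b_def\<close>)
  have Ub': "U * b' = b"
    unfolding b' assoc_mult_mat[OF U(1) Ua c(1), symmetric] U(3) using c(1) by simp
  have b'a: "mat_adjoint b' * mat_adjoint U = mat_adjoint b"
    using mat_adjoint_mult[OF U(1) c(2)] Ub' by simp
  have B: "bordered n H w a = four_block_mat H (Matrix.mat n 1 (\<lambda>(i, _). w i)) (mat_adjoint (Matrix.mat n 1 (\<lambda>(i, _). w i))) (Matrix.mat 1 1 (\<lambda>_. of_real a))"
    for H w unfolding bordered_def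
    by (rule arg_cong[where f = "\<lambda>C. four_block_mat H _ C _"]) (auto intro!: eq_matI)
  let ?a = "Matrix.mat 1 1 (\<lambda>_. complex_of_real a)"
  have a: "?a \<in> carrier_mat 1 1" by simp
  have "X * bordered n D (adjoint_action n U v) a = four_block_mat (U * D) (U * b') (mat_adjoint b') ?a"
    unfolding B X_def b'_def[symmetric] using U D a c ca
    by (subst mult_four_block_mat[of _ n n _ 1 _ 1 _ _ n _ 1]) auto
  also have "\<dots> * mat_adjoint X = four_block_mat (U * D * mat_adjoint U) (U * b') (mat_adjoint b' * mat_adjoint U) ?a"
    unfolding Xa using U D a c ca Ua
    by (subst mult_four_block_mat[of _ n n _ 1 _ 1 _ _ n _ 1]) auto
  also have "\<dots> = bordered n (U * D * mat_adjoint U) v a"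
    unfolding B Ub' b'a b_def[symmetric] ..
  finally have eq: "X * bordered n D (adjoint_action n U v) a * mat_adjoint X = bordered n (U * D * mat_adjoint U) v a" .
  have 1: "mat_adjoint X * X = 1\<^sub>m (n + 1)" "X * mat_adjoint X = 1\<^sub>m (n + 1)"
    unfolding Xa unfolding X_def using U Ua by (subst mult_four_block_mat[of _ n n _ 1 _ 1 _ _ n _ 1]; auto)+
  show ?thesis
    using char_poly_unitary[OF _ X 1, of "bordered n D (adjoint_action n U v) a"] D unfolding eq by simp
qed

text \<open>A Schur complement: away from the diagonal entries, eliminating the last column of the
  characteristic matrix leaves the secular function in its corner.\<close>

lemma poly_char_poly_arrow:
  fixes \<mu> :: "nat \<Rightarrow> complex"
  assumes x: "\<And>i. i < n \<Longrightarrow> x \<noteq> \<mu> i"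
  shows "poly (char_poly (bordered n (mat_diag n \<mu>) v a)) x =
    (\<Prod>i<n. x - \<mu> i) * (x - of_real a - (\<Sum>i<n. of_real ((cmod (v i))\<^sup>2) / (x - \<mu> i)))"
proof -
  let ?B = "bordered n (mat_diag n \<mu>) v a"
  have B: "?B \<in> carrier_mat (Suc n) (Suc n)" by simp
  define D where "D = mat_diag n (\<lambda>i. x - \<mu> i)"
  define b where "b = Matrix.mat n 1 (\<lambda>(i, _). - v i)"
  define c where "c = Matrix.mat 1 n (\<lambda>(_, j). - cnj (v j))"
  define d where "d = Matrix.mat 1 1 (\<lambda>_. x - complex_of_real a)"
  define e where "e = Matrix.mat n 1 (\<lambda>(i, _). v i / (x - \<mu> i))"
  define s where "s = x - of_real a - (\<Sum>i<n. of_real ((cmod (v i))\<^sup>2) / (x - \<mu> i))"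
  have carr: "D \<in> carrier_mat n n" "b \<in> carrier_mat n 1" "c \<in> carrier_mat 1 n" "d \<in> carrier_mat 1 1" "e \<in> carrier_mat n 1"
    by (auto simp: D_def b_def c_def d_def e_def)
  have "poly (char_poly ?B) x = det (four_block_mat D b c d)"
    unfolding char_poly_def
  proof (rule poly_det_cong)
    show "four_block_mat D b c d \<in> carrier_mat (Suc n) (Suc n)"
      using four_block_carrier_mat[OF carr(1) carr(4)] by simp
    show "char_poly_matrix ?B \<in> carrier_mat (Suc n) (Suc n)" using B by simp
    fix i j assume "i < Suc n" "j < Suc n"
    then show "poly (char_poly_matrix ?B $$ (i, j)) x = four_block_mat D b c d $$ (i, j)"
      using B carrier_matD[OF B] bordered_index[of "mat_diag n \<mu>" n i j v a]
      by (auto simp: char_poly_matrix_def D_def b_def c_def d_def mat_diag_def)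
  qed
  \<comment> \<open>The second factor has determinant 1. Its column \<open>e\<close> solves
    \<open>D * e = - b\<close>, so the product is block lower triangular.\<close>
  also have "\<dots> = det (four_block_mat D b c d) * det (four_block_mat (1\<^sub>m n) e (0\<^sub>m 1 n) (1\<^sub>m 1))"
    using carr by (subst det_four_block_mat_lower_left_zero[of _ n e 1]) auto
  also have "\<dots> = det (four_block_mat D b c d * four_block_mat (1\<^sub>m n) e (0\<^sub>m 1 n) (1\<^sub>m 1))"
    using carr by (intro det_mult[symmetric, of _ "n + 1"]) auto
  also have "four_block_mat D b c d * four_block_mat (1\<^sub>m n) e (0\<^sub>m 1 n) (1\<^sub>m 1) =
      four_block_mat D (D * e + b) c (c * e + d)"
    using carr by (subst mult_four_block_mat[of _ n n _ 1 _ 1 _ _ n _ 1]) auto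
  also have "D * e + b = 0\<^sub>m n 1"
    using x unfolding D_def by (subst mat_diag_mult_left[of _ n 1]) (auto simp: e_def b_def intro!: eq_matI)
  also have "c * e + d = Matrix.mat 1 1 (\<lambda>_. s)"
  proof (rule eq_matI)
    fix i j assume "i < dim_row (Matrix.mat 1 1 (\<lambda>_. s))" "j < dim_col (Matrix.mat 1 1 (\<lambda>_. s))"
    then have ij: "i = 0" "j = 0" by auto
    have "(c * e) $$ (0, 0) = (\<Sum>l<n. c $$ (0, l) * e $$ (l, 0))"
      using carr by (intro mult_mat_index) auto
    also have "\<dots> = - (\<Sum>i<n. of_real ((cmod (v i))\<^sup>2) / (x - \<mu> i))"
      unfolding sum_negf[symmetric] complex_norm_square
      by (intro sum.cong) (auto simp: c_def e_def mult.commute)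
    finally show "(c * e + d) $$ (i, j) = Matrix.mat 1 1 (\<lambda>_. s) $$ (i, j)"
      using carr ij by (simp add: d_def s_def)
  qed (use carr in auto)
  also have "det (four_block_mat D (0\<^sub>m n 1) c (Matrix.mat 1 1 (\<lambda>_. s))) = det D * det (Matrix.mat 1 1 (\<lambda>_. s))"
    using carr by (intro det_four_block_mat_upper_right_zero) auto
  also have "det D = (\<Prod>i<n. x - \<mu> i)"
    unfolding D_def
    by (subst det_lower_triangular[of n]) (auto simp: mat_diag_def prod_list_diag_prod atLeast0LessThan)
  also have "det (Matrix.mat 1 1 (\<lambda>_. s)) = s" by (subst det_single) auto
  finally show ?thesis by (simp add: s_def)
qed

text \<open>The secular formula holds only off the poles; for polynomials finitely many exceptional
  points do no harm.\<close>

lemma poly_eqI_real_cofinite: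
  fixes p q :: "complex poly"
  assumes "finite X" "\<And>x::real. x \<notin> X \<Longrightarrow> poly p (of_real x) = poly q (of_real x)"
  shows "p = q"
proof (rule ccontr)
  assume "p \<noteq> q"
  then have "finite {z. poly (p - q) z = 0}" by (intro poly_roots_finite) simp
  moreover have "of_real ` (UNIV - X) \<subseteq> {z. poly (p - q) z = 0}" using assms(2) by auto
  ultimately have "finite ((of_real :: real \<Rightarrow> complex) ` (UNIV - X))" by (rule finite_subset[rotated])
  then have "finite (UNIV - X)" by (rule finite_imageD) (auto simp: inj_on_def)
  then show False
    using Diff_infinite_finite[OF assms(1) infinite_UNIV_char_0[where 'a = real]] by simp
qed

text \<open>Only the squared moduli of the border enter the secular function, so its phases do not
  influence the spectrum.\<close>

lemma char_poly_arrow_cong: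
  assumes "\<And>i. i < n \<Longrightarrow> cmod (v i) = cmod (w i)"
  shows "char_poly (bordered n (mat_diag n (\<lambda>i. of_real (m i))) v a) =
    char_poly (bordered n (mat_diag n (\<lambda>i. of_real (m i))) w a)"
proof (rule poly_eqI_real_cofinite[of "m ` {..<n}"])
  fix x assume "x \<notin> m ` {..<n}"
  then have "complex_of_real x \<noteq> of_real (m i)" if "i < n" for i using that by auto
  then show "poly (char_poly (bordered n (mat_diag n (\<lambda>i. of_real (m i))) v a)) (of_real x) =
      poly (char_poly (bordered n (mat_diag n (\<lambda>i. of_real (m i))) w a)) (of_real x)"
    using assms by (simp add: poly_char_poly_arrow)
qed simp

lemma mat_diag_hermitian: "mat_diag n (\<lambda>i. of_real (m i)) \<in> hermitian_mats n"
  unfolding hermitian_mats_iff by (auto simp: mat_diag_def)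

section \<open>Measurability of the ordered eigenvalues\<close>

lemma measurable_coeff_mult:
  fixes p q :: "'w \<Rightarrow> 'a::{real_normed_field, second_countable_topology} poly"
  assumes "\<And>k. (\<lambda>\<omega>. coeff (p \<omega>) k) \<in> borel_measurable M" "\<And>k. (\<lambda>\<omega>. coeff (q \<omega>) k) \<in> borel_measurable M"
  shows "(\<lambda>\<omega>. coeff (p \<omega> * q \<omega>) k) \<in> borel_measurable M"
  unfolding coeff_mult using assms by (intro borel_measurable_sum borel_measurable_times)

lemma measurable_coeff_prod:
  fixes p :: "'i \<Rightarrow> 'w \<Rightarrow> 'a::{real_normed_field, second_countable_topology} poly"
  assumes "\<And>i k. i \<in> I \<Longrightarrow> (\<lambda>\<omega>. coeff (p i \<omega>) k) \<in> borel_measurable M"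
  shows "(\<lambda>\<omega>. coeff (\<Prod>i\<in>I. p i \<omega>) k) \<in> borel_measurable M"
  using assms
proof (induction I arbitrary: k rule: infinite_finite_induct)
  case (insert i I)
  then show ?case by (auto intro!: measurable_coeff_mult)
qed auto

text \<open>By the Leibniz formula every coefficient is a polynomial in the entries.\<close>

lemma measurable_coeff_char_poly:
  fixes X :: "'w \<Rightarrow> complex mat"
  assumes "\<And>\<omega>. \<omega> \<in> space M \<Longrightarrow> X \<omega> \<in> carrier_mat n n"
    and meas: "\<And>i j. i < n \<Longrightarrow> j < n \<Longrightarrow> (\<lambda>\<omega>. X \<omega> $$ (i, j)) \<in> borel_measurable M"
  shows "(\<lambda>\<omega>. coeff (char_poly (X \<omega>)) k) \<in> borel_measurable M"
proof -
  have "coeff (char_poly (X \<omega>)) k = (\<Sum>p | p permutes {0..<n}.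
      coeff (signof p * (\<Prod>i\<in>{0..<n}. (if i = p i then [:0, 1:] else 0) + [:- (X \<omega> $$ (i, p i)):])) k)"
    if "\<omega> \<in> space M" for \<omega>
  proof -
    have X: "X \<omega> \<in> carrier_mat n n" using assms(1) that by auto
    have "char_poly (X \<omega>) = (\<Sum>p | p permutes {0..<n}. signof p * (\<Prod>i\<in>{0..<n}. char_poly_matrix (X \<omega>) $$ (i, p i)))"
      unfolding char_poly_def by (rule det_def') (use X in simp)
    also have "\<dots> = (\<Sum>p | p permutes {0..<n}. signof p * (\<Prod>i\<in>{0..<n}. (if i = p i then [:0, 1:] else 0) + [:- (X \<omega> $$ (i, p i)):]))"
    proof (intro sum.cong refl arg_cong[where f = "\<lambda>x. signof _ * x"] prod.cong)
      fix p i assume "p \<in> {p. p permutes {0..<n}}" "i \<in> {0..<n}"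
      then have "i < n" "p i < n" using permutes_in_image by fastforce+
      then show "char_poly_matrix (X \<omega>) $$ (i, p i) = (if i = p i then [:0, 1:] else 0) + [:- (X \<omega> $$ (i, p i)):]"
        using X by (auto simp: char_poly_matrix_def)
    qed
    finally show ?thesis by (simp add: coeff_sum)
  qed
  moreover have "(\<lambda>\<omega>. \<Sum>p | p permutes {0..<n}.
      coeff (signof p * (\<Prod>i\<in>{0..<n}. (if i = p i then [:0, 1:] else 0) + [:- (X \<omega> $$ (i, p i)):])) k) \<in> borel_measurable M"
  proof (intro borel_measurable_sum measurable_coeff_mult measurable_coeff_prod)
    fix p i k assume "p \<in> {p. p permutes {0..<n}}" "i \<in> {0..<n}"
    then have "i < n" "p i < n" using permutes_in_image by fastforce+
    then show "(\<lambda>\<omega>. coeff ((if i = p i then [:0, 1:] else 0) + [:- (X \<omega> $$ (i, p i)):]) k) \<in> borel_measurable M"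
      using meas[of i "p i"] by (cases k) auto
  qed auto
  ultimately show ?thesis by (simp cong: measurable_cong)
qed

lemma coeff_prod_linear_of_real:
  fixes n :: nat
  shows "coeff (\<Prod>i<n. [:- of_real (l i), 1:]) k = (of_real (coeff (\<Prod>i<n. [:- l i, 1:]) k) :: complex)"
  by (induction n arbitrary: k) (auto simp: coeff_pCons split: nat.splits)

lemma coeff_prod_linear_nonneg:
  fixes l :: "nat \<Rightarrow> real"
  shows "(\<And>i. i < m \<Longrightarrow> l i \<le> t) \<Longrightarrow> 0 \<le> coeff (\<Prod>i<m. [:t - l i, 1:]) k"
proof (induction m arbitrary: k)
  case (Suc m)
  then have "0 \<le> coeff (\<Prod>i<m. [:t - l i, 1:]) k" for k by auto
  with Suc.prems[of m] show ?case by (auto simp: coeff_pCons split: nat.splits)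
qed (auto simp: one_pCons coeff_pCons split: nat.splits)

text \<open>After the shift by t the question is whether all roots are at most 0. If they are, every
  linear factor has nonnegative coefficients and so has the product; conversely a monic polynomial
  with nonnegative coefficients is positive at positive arguments. The event that the largest root
  is at most t thus becomes finitely many inequalities between measurable functions.\<close>

lemma max_root_le_iff:
  fixes l :: "nat \<Rightarrow> real"
  assumes "mono_on {..n} l"
  shows "l n \<le> t \<longleftrightarrow> (\<forall>k\<le>n. 0 \<le> coeff (pcompose (\<Prod>i<Suc n. [:- l i, 1:]) [:t, 1:]) k)"
proof -
  define p where "p = pcompose (\<Prod>i<Suc n. [:- l i, 1:]) [:t, 1:]"
  have p: "p = (\<Prod>i<Suc n. [:t - l i, 1:])"
    unfolding p_def pcompose_prod by (simp add: pcompose_pCons)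
  have deg: "degree p = Suc n" unfolding p by (subst degree_prod_eq_sum_degree) auto
  have lead: "coeff p (Suc n) = 1"
    using deg lead_coeff_prod[of "\<lambda>i. [:t - l i, 1:]" "{..<Suc n}"] unfolding p by simp
  have "0 \<le> coeff p k" if "l n \<le> t" for k
    unfolding p
  proof (rule coeff_prod_linear_nonneg)
    fix i assume "i < Suc n"
    then have "l i \<le> l n" using mono_onD[OF assms, of i n] by simp
    with that show "l i \<le> t" by simp
  qed
  moreover have "l n \<le> t" if nn: "\<forall>k\<le>n. 0 \<le> coeff p k"
  proof (rule ccontr)
    assume "\<not> l n \<le> t"
    then have y: "0 < l n - t" by simp
    have "poly p (l n - t) = (\<Sum>k\<le>n. coeff p k * (l n - t) ^ k) + (l n - t) ^ Suc n"
      unfolding poly_altdef deg by (simp add: lead)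
    moreover have "0 \<le> (\<Sum>k\<le>n. coeff p k * (l n - t) ^ k)"
      using nn y by (intro sum_nonneg mult_nonneg_nonneg) auto
    moreover have "0 < (l n - t) ^ Suc n" using y by simp
    moreover have "poly p (l n - t) = 0" unfolding p poly_prod by simp
    ultimately show False by linarith
  qed
  ultimately show ?thesis unfolding p_def[symmetric] by blast
qed

lemma pcompose_pow: "pcompose (p ^ n) q = pcompose p q ^ n"
  by (induction n) (auto simp: pcompose_mult pcompose_1)

text \<open>The largest root is measurable by the coefficient criterion; dividing it out leaves a
  polynomial with measurable coefficients and one root less.\<close>

lemma measurable_sorted_roots:
  fixes l :: "'w \<Rightarrow> nat \<Rightarrow> real"
  assumes "\<And>\<omega>. \<omega> \<in> space M \<Longrightarrow> mono_on {..<n} (l \<omega>)"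
    and "\<And>k. (\<lambda>\<omega>. coeff (\<Prod>i<n. [:- l \<omega> i, 1:]) k) \<in> borel_measurable M"
    and "i < n"
  shows "(\<lambda>\<omega>. l \<omega> i) \<in> borel_measurable M"
  using assms
proof (induction n arbitrary: i)
  case (Suc n)
  define p where "p \<omega> = (\<Prod>i<Suc n. [:- l \<omega> i, 1:])" for \<omega>
  define q where "q \<omega> = (\<Prod>i<n. [:- l \<omega> i, 1:])" for \<omega>
  note p[measurable] = Suc.prems(2)[folded p_def]
  have degp: "degree (p \<omega>) = Suc n" and degq: "degree (q \<omega>) = n" for \<omega>
    unfolding p_def q_def by (subst degree_prod_eq_sum_degree; simp)+
  have last: "(\<lambda>\<omega>. l \<omega> n) \<in> borel_measurable M"
  proof (rule borel_measurable_iff_le[THEN iffD2], rule allI)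
    fix t :: real
    have "(\<lambda>\<omega>. coeff (pcompose (p \<omega>) [:t, 1:]) k) \<in> borel_measurable M" for k
    proof -
      have "pcompose (p \<omega>) [:t, 1:] = (\<Sum>j\<le>Suc n. Polynomial.smult (coeff (p \<omega>) j) ([:t, 1:] ^ j))" for \<omega>
        by (subst poly_as_sum_of_monoms[of "p \<omega>", symmetric])
          (simp only: degp pcompose_sum monom_altdef pcompose_smult pcompose_pow, simp add: pcompose_pCons)
      then have "coeff (pcompose (p \<omega>) [:t, 1:]) k = (\<Sum>j\<le>Suc n. coeff (p \<omega>) j * coeff ([:t, 1:] ^ j) k)" for \<omega>
        by (simp only: coeff_sum coeff_smult)
      then show ?thesis by simp
    qed
    note [measurable] = this
    have "l \<omega> n \<le> t \<longleftrightarrow> (\<forall>k\<in>{..n}. 0 \<le> coeff (pcompose (p \<omega>) [:t, 1:]) k)" if "\<omega> \<in> space M" for \<omega>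
      using max_root_le_iff[of n "l \<omega>" t] Suc.prems(1)[OF that] unfolding p_def lessThan_Suc_atMost by auto
    then have "{\<omega> \<in> space M. l \<omega> n \<le> t} = {\<omega> \<in> space M. \<forall>k\<in>{..n}. 0 \<le> coeff (pcompose (p \<omega>) [:t, 1:]) k}"
      by blast
    also have "\<dots> \<in> sets M" by measurable
    finally show "{\<omega> \<in> space M. l \<omega> n \<le> t} \<in> sets M" .
  qed
  \<comment> \<open>Synthetic division: the coefficients of the quotient follow from the top
    downwards, starting with a zero above its degree.\<close>
  have rec: "coeff (q \<omega>) k = coeff (p \<omega>) (Suc k) + l \<omega> n * coeff (q \<omega>) (Suc k)" for \<omega> k
    by (simp add: p_def q_def[symmetric] coeff_pCons)
  have "(\<lambda>\<omega>. coeff (q \<omega>) k) \<in> borel_measurable M" if "k \<le> Suc n" for k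
    using that
  proof (induction k rule: inc_induct)
    case base
    have "coeff (q \<omega>) (Suc n) = 0" for \<omega> by (rule coeff_eq_0) (simp add: degq)
    then show ?case by simp
  next
    case (step k)
    then show ?case unfolding rec[of _ k] using last p by (intro borel_measurable_add borel_measurable_times) auto
  qed
  moreover have "(\<lambda>\<omega>. coeff (q \<omega>) k) \<in> borel_measurable M" if "\<not> k \<le> Suc n" for k
  proof -
    have "coeff (q \<omega>) k = 0" for \<omega> using that by (intro coeff_eq_0) (simp add: degq)
    then show ?thesis by simp
  qed
  ultimately have "(\<lambda>\<omega>. coeff (q \<omega>) k) \<in> borel_measurable M" for k by blast
  moreover have "mono_on {..<n} (l \<omega>)" if "\<omega> \<in> space M" for \<omega>
    using Suc.prems(1)[OF that] by (rule mono_on_subset) auto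
  ultimately have "(\<lambda>\<omega>. l \<omega> i) \<in> borel_measurable M" if "i < n" for i
    unfolding q_def using that by (intro Suc.IH) auto
  with last Suc.prems(3) show ?case by (cases "i = n") auto
qed simp

lemma measurable_eigvals:
  assumes X: "\<And>\<omega>. \<omega> \<in> space M \<Longrightarrow> X \<omega> \<in> hermitian_mats n"
    and "\<And>i j. i < n \<Longrightarrow> j < n \<Longrightarrow> (\<lambda>\<omega>. X \<omega> $$ (i, j)) \<in> borel_measurable M"
    and "i < n"
  shows "(\<lambda>\<omega>. eigvals (X \<omega>) ! i) \<in> borel_measurable M"
proof (rule measurable_sorted_roots[where l = "\<lambda>\<omega> i. eigvals (X \<omega>) ! i"])
  show "mono_on {..<n} (\<lambda>i. eigvals (X \<omega>) ! i)" if "\<omega> \<in> space M" for \<omega>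
    using hermitian_eigvals(1,2)[OF X[OF that]] by (auto simp: mono_on_def sorted_iff_nth_mono)
  show "(\<lambda>\<omega>. coeff (\<Prod>i<n. [:- (eigvals (X \<omega>) ! i), 1:]) k) \<in> borel_measurable M" for k
  proof -
    have "(\<lambda>\<omega>. Re (coeff (char_poly (X \<omega>)) k)) \<in> borel_measurable M"
      using assms by (intro measurable_compose[OF measurable_coeff_char_poly[of M X n] borel_measurable_Re])
        (auto simp: hermitian_mats_def)
    moreover have "coeff (\<Prod>i<n. [:- (eigvals (X \<omega>) ! i), 1:]) k = Re (coeff (char_poly (X \<omega>)) k)" if "\<omega> \<in> space M" for \<omega>
      unfolding hermitian_eigvals(3)[OF X[OF that]] coeff_prod_linear_of_real by simp
    ultimately show ?thesis by (simp cong: measurable_cong)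
  qed
qed (rule assms)

section \<open>The volume of the sequences interlacing a given one\<close>

lemma det_mat_diag: "det (mat_diag n (f :: nat \<Rightarrow> 'a::idom)) = (\<Prod>i<n. f i)"
  by (subst det_lower_triangular[of n]) (auto simp: mat_diag_def prod_list_diag_prod atLeast0LessThan)

text \<open>Column operations: subtracting \<open>x n\<close> times the preceding column leaves a
  single 1 in the last row, and its minor is the smaller matrix with row i scaled by
  \<open>x i - x n\<close>.\<close>

lemma det_vandermonde:
  fixes x :: "nat \<Rightarrow> real"
  shows "det (Matrix.mat n n (\<lambda>(i, j). x i ^ j)) = vdm n x"
proof (induction n)
  case 0
  then show ?case by (simp add: vdm_def det_dim_zero)
next
  case (Suc n)
  let ?A = "Matrix.mat (Suc n) (Suc n) (\<lambda>(i, j). x i ^ j)"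
  define C where "C = Matrix.mat (Suc n) (Suc n) (\<lambda>(i, j). if i = j then 1 else if Suc i = j then - x n else 0)"
  define B where "B = Matrix.mat (Suc n) (Suc n) (\<lambda>(i, j). if j = 0 then 1 else x i ^ (j - 1) * (x i - x n))"
  have C: "C \<in> carrier_mat (Suc n) (Suc n)" and B: "B \<in> carrier_mat (Suc n) (Suc n)"
    by (auto simp: C_def B_def)
  have "det C = 1"
    by (subst det_upper_triangular[OF _ C]) (auto simp: C_def prod_list_diag_prod)
  have "?A * C = B"
  proof (rule eq_matI)
    fix i j assume "i < dim_row B" "j < dim_col B"
    then have ij: "i < Suc n" "j < Suc n" by (auto simp: B_def)
    have "(?A * C) $$ (i, j) = (\<Sum>l<Suc n. ?A $$ (i, l) * C $$ (l, j))"
      by (rule mult_mat_index[OF _ C ij]) simp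
    also have "\<dots> = (\<Sum>l<Suc n. (if l = j then x i ^ j else 0) + (if Suc l = j then - x n * x i ^ l else 0))"
      using ij by (intro sum.cong) (auto simp: C_def)
    also have "\<dots> = B $$ (i, j)"
    proof (cases j)
      case 0
      then show ?thesis using ij by (simp add: sum.distrib B_def)
    next
      case (Suc k)
      then show ?thesis using ij
        by (simp only: sum.distrib Suc nat.inject sum.delta sum.delta' finite_lessThan)
           (simp add: B_def algebra_simps)
    qed
    finally show "(?A * C) $$ (i, j) = B $$ (i, j)" .
  qed (auto simp: B_def C_def)
  then have "det ?A = det B"
    using det_mult[of ?A "Suc n" C] C \<open>det C = 1\<close> by simp
  also have "\<dots> = (\<Sum>j<Suc n. B $$ (n, j) * cofactor B n j)"
    using laplace_expansion_row[OF B, of n] by simp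
  also have "\<dots> = cofactor B n 0"
    by (subst sum.lessThan_Suc_shift) (simp add: B_def)
  also have "\<dots> = (- 1) ^ n * det (mat_delete B n 0)" by (simp add: cofactor_def)
  also have "mat_delete B n 0 = mat_diag n (\<lambda>i. x i - x n) * Matrix.mat n n (\<lambda>(i, j). x i ^ j)"
    by (subst mat_diag_mult_left[of _ n n]) (auto simp: mat_delete_def B_def intro!: eq_matI)
  also have "det \<dots> = (\<Prod>i<n. x i - x n) * vdm n x"
    by (subst det_mult[of _ n]) (auto simp: det_mat_diag Suc.IH)
  also have "(- 1) ^ n * \<dots> = vdm (Suc n) x"
  proof -
    have "(\<Prod>i<n. x n - x i) = (\<Prod>i<n. (- 1) * (x i - x n))" by simp
    also have "\<dots> = (- 1) ^ n * (\<Prod>i<n. x i - x n)" by (subst prod.distrib) simp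
    finally show ?thesis by (simp add: vdm_Suc)
  qed
  finally show ?case .
qed

text \<open>Row operations: subtracting the preceding row leaves a single 1 in the first column. Up
  to the factors \<open>Suc j\<close>, the entries are the integrals of the monomials between
  neighbours.\<close>

lemma det_vandermonde_differences:
  fixes x :: "nat \<Rightarrow> real"
  shows "det (Matrix.mat n n (\<lambda>(i, j). x (Suc i) ^ Suc j - x i ^ Suc j)) = vdm (Suc n) x"
proof -
  let ?A = "Matrix.mat (Suc n) (Suc n) (\<lambda>(i, j). x i ^ j)"
  define C where "C = Matrix.mat (Suc n) (Suc n) (\<lambda>(i, j). if i = j then 1 else if i = Suc j then - 1 else (0::real))"
  define B where "B = Matrix.mat (Suc n) (Suc n) (\<lambda>(i, j). if i = 0 then x 0 ^ j else x i ^ j - x (i - 1) ^ j)"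
  have C: "C \<in> carrier_mat (Suc n) (Suc n)" and B: "B \<in> carrier_mat (Suc n) (Suc n)"
    by (auto simp: C_def B_def)
  have "det C = 1"
    by (subst det_lower_triangular[OF _ C]) (auto simp: C_def prod_list_diag_prod)
  have "C * ?A = B"
  proof (rule eq_matI)
    fix i j assume "i < dim_row B" "j < dim_col B"
    then have ij: "i < Suc n" "j < Suc n" by (auto simp: B_def)
    have "(C * ?A) $$ (i, j) = (\<Sum>l<Suc n. C $$ (i, l) * ?A $$ (l, j))"
      by (rule mult_mat_index[OF C _ ij]) simp
    also have "\<dots> = (\<Sum>l<Suc n. (if l = i then x i ^ j else 0) + (if Suc l = i then - (x l ^ j) else 0))"
      using ij by (intro sum.cong) (auto simp: C_def)
    also have "\<dots> = B $$ (i, j)"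
    proof (cases i)
      case 0
      then show ?thesis using ij by (simp add: sum.distrib B_def)
    next
      case (Suc k)
      then show ?thesis using ij
        by (simp only: sum.distrib Suc nat.inject sum.delta sum.delta' finite_lessThan)
           (simp add: B_def)
    qed
    finally show "(C * ?A) $$ (i, j) = B $$ (i, j)" .
  qed (auto simp: B_def C_def)
  then have "vdm (Suc n) x = det B"
    using det_mult[OF C, of ?A] \<open>det C = 1\<close> by (simp add: det_vandermonde)
  also have "\<dots> = (\<Sum>i<Suc n. B $$ (i, 0) * cofactor B i 0)"
    using laplace_expansion_column[OF B, of 0] by simp
  also have "\<dots> = cofactor B 0 0"
    by (subst sum.lessThan_Suc_shift) (simp add: B_def)
  also have "\<dots> = det (mat_delete B 0 0)" by (simp add: cofactor_def)
  also have "mat_delete B 0 0 = Matrix.mat n n (\<lambda>(i, j). x (Suc i) ^ Suc j - x i ^ Suc j)"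
    by (auto simp: mat_delete_def B_def intro!: eq_matI)
  finally show ?thesis by simp
qed

lemma has_bochner_integral_power_Ioo:
  fixes a b :: real
  assumes "a \<le> b"
  shows "has_bochner_integral lborel (\<lambda>x. x ^ k * indicator {a<..<b} x) ((b ^ Suc k - a ^ Suc k) / Suc k)"
proof -
  have "((\<lambda>x. x ^ Suc k / Suc k) has_real_derivative x ^ k) (at x)" for x :: real
    by (rule derivative_eq_intros refl | simp del: power_Suc of_nat_Suc)+
  then have "has_bochner_integral lborel (\<lambda>x. x ^ k * indicator {a..b} x) (b ^ Suc k / Suc k - a ^ Suc k / Suc k)"
    using assms by (intro has_bochner_integral_FTC_Icc_real) auto
  moreover have "AE x in lborel. x ^ k * indicator {a..b} x = x ^ k * indicator {a<..<b} x"
    using AE_lborel_singleton[of a] AE_lborel_singleton[of b]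
    by eventually_elim (auto split: split_indicator)
  ultimately show ?thesis
    by (subst (asm) has_bochner_integral_cong_AE[where g = "\<lambda>x. x ^ k * indicator {a<..<b} x"])
       (auto simp: diff_divide_distrib)
qed

text \<open>Interlacing confines m to a box. Each term of the Leibniz expansion of the Vandermonde
  determinant is a product of monomials in separate variables, so integration acts on the entries
  and yields a determinant of differences of powers.\<close>

lemma nn_integral_vdm_interlacing:
  assumes l: "strict_mono_on {..n} l"
  shows "(\<integral>\<^sup>+m. (if interlaces n m l then ennreal (vdm n m) else 0) \<partial>Pi\<^sub>M {..<n} (\<lambda>_. lborel)) =
    ennreal (vdm (Suc n) l / fact n)"
proof -
  let ?P = "Pi\<^sub>M {..<n} (\<lambda>_::nat. lborel :: real measure)"
  let ?S = "{p. p permutes {0..<n}}"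
  have le: "l i \<le> l (Suc i)" if "i < n" for i
    using strict_mono_onD[OF l, of i "Suc i"] that by auto
  define f where "f p i x = x ^ p i * indicator {l i<..<l (Suc i)} x" for p :: "nat \<Rightarrow> nat" and i and x :: real
  have f: "has_bochner_integral lborel (f p i) ((l (Suc i) ^ Suc (p i) - l i ^ Suc (p i)) / Suc (p i))"
    if "i < n" for p i
    unfolding f_def using has_bochner_integral_power_Ioo[OF le[OF that]] by simp
  \<comment> \<open>The indicators cut the expansion down to the box. Its terms have both signs, so
    they are integrated as real functions, and only their nonnegative sum is converted to
    \<open>ennreal\<close>.\<close>
  define F where "F m = (\<Sum>p\<in>?S. signof p * (\<Prod>i<n. f p i (m i)))" for m
  have int: "integrable ?P (\<lambda>m. \<Prod>i<n. f p i (m i))" for p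
    using f by (intro lborel_PiM.product_integrable_prod) (auto simp: has_bochner_integral_iff)
  have F: "(if interlaces n m l then vdm n m else 0) = F m" for m
  proof (cases "interlaces n m l")
    case False
    then have "(\<Prod>i<n. f p i (m i)) = 0" for p
      by (auto simp: interlaces_def f_def indicator_def)
    then show ?thesis using False by (simp add: F_def)
  next
    case True
    then have "f p i (m i) = m i ^ p i" if "i < n" for p i
      using that by (simp add: interlaces_def f_def)
    then have "F m = (\<Sum>p\<in>?S. signof p * (\<Prod>i=0..<n. m i ^ p i))"
      by (simp add: F_def atLeast0LessThan)
    also have "\<dots> = (\<Sum>p\<in>?S. signof p * (\<Prod>i=0..<n. Matrix.mat n n (\<lambda>(i, j). m i ^ j) $$ (i, p i)))"
    proof (intro sum.cong refl arg_cong[where f = "\<lambda>x. signof _ * x"] prod.cong)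
      fix p i assume "p \<in> ?S" "i \<in> {0..<n}"
      then have "i < n" "p i < n" using permutes_in_image by fastforce+
      then show "m i ^ p i = Matrix.mat n n (\<lambda>(i, j). m i ^ j) $$ (i, p i)" by simp
    qed
    also have "\<dots> = vdm n m"
      unfolding det_vandermonde[symmetric] by (rule det_def'[symmetric]) simp
    finally show ?thesis using True by simp
  qed
  have nn: "0 \<le> F m" for m
  proof (cases "interlaces n m l")
    case True
    have "0 \<le> vdm n m"
      using interlaces_lower_strict_mono[OF True]
      by (intro vdm_nonneg) (auto simp: strict_mono_on_def less_imp_le)
    then show ?thesis using F[of m] True by simp
  next
    case False
    then show ?thesis using F[of m] by simp
  qed
  \<comment> \<open>For every permutation the denominators \<open>Suc (p i)\<close> run through 1,
    ..., n, so the same factorial comes out of every term.\<close>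
  have perm: "(\<Prod>i<n. real (Suc (p i))) = fact n" if "p \<in> ?S" for p
  proof -
    have "(\<Prod>i<n. real (Suc (p i))) = (\<Prod>i<n. real (Suc i))"
      using prod.permute[of p "{..<n}" "\<lambda>i. real (Suc i)"] that by (simp add: comp_def atLeast0LessThan)
    also have "\<dots> = fact n" by (simp add: fact_prod_Suc atLeast0LessThan)
    finally show ?thesis .
  qed
  have "integral\<^sup>L ?P F = (\<Sum>p\<in>?S. signof p * (\<Prod>i<n. (l (Suc i) ^ Suc (p i) - l i ^ Suc (p i)) / Suc (p i)))"
  proof -
    have "integral\<^sup>L ?P F = (\<Sum>p\<in>?S. integral\<^sup>L ?P (\<lambda>m. signof p * (\<Prod>i<n. f p i (m i))))"
      unfolding F_def by (rule Bochner_Integration.integral_sum) (use int in simp)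
    also have "\<dots> = (\<Sum>p\<in>?S. signof p * (\<Prod>i<n. integral\<^sup>L lborel (f p i)))"
    proof (intro sum.cong refl)
      fix p
      have "integral\<^sup>L ?P (\<lambda>m. \<Prod>i<n. f p i (m i)) = (\<Prod>i<n. integral\<^sup>L lborel (f p i))"
        by (rule lborel_PiM.product_integral_prod) (use f in \<open>auto simp: has_bochner_integral_iff\<close>)
      then show "integral\<^sup>L ?P (\<lambda>m. signof p * (\<Prod>i<n. f p i (m i))) = signof p * (\<Prod>i<n. integral\<^sup>L lborel (f p i))"
        by simp
    qed
    also have "\<dots> = (\<Sum>p\<in>?S. signof p * (\<Prod>i<n. (l (Suc i) ^ Suc (p i) - l i ^ Suc (p i)) / Suc (p i)))"
      using f by (intro sum.cong refl arg_cong[where f = "\<lambda>x. signof _ * x"] prod.cong)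
        (auto simp: has_bochner_integral_iff)
    finally show ?thesis .
  qed
  also have "\<dots> = (\<Sum>p\<in>?S. signof p * (\<Prod>i<n. l (Suc i) ^ Suc (p i) - l i ^ Suc (p i))) / fact n"
    unfolding sum_divide_distrib prod_dividef using perm by (intro sum.cong) auto
  also have "(\<Sum>p\<in>?S. signof p * (\<Prod>i<n. l (Suc i) ^ Suc (p i) - l i ^ Suc (p i))) =
      (\<Sum>p\<in>?S. signof p * (\<Prod>i=0..<n. Matrix.mat n n (\<lambda>(i, j). l (Suc i) ^ Suc j - l i ^ Suc j) $$ (i, p i)))"
    unfolding lessThan_atLeast0
  proof (intro sum.cong refl arg_cong[where f = "\<lambda>x. signof _ * x"] prod.cong)
    fix p i assume "p \<in> {p. p permutes {0..<n}}" "i \<in> {0..<n}"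
    then have "i < n" "p i < n" using permutes_in_image by fastforce+
    then show "l (Suc i) ^ Suc (p i) - l i ^ Suc (p i) =
      Matrix.mat n n (\<lambda>(i, j). l (Suc i) ^ Suc j - l i ^ Suc j) $$ (i, p i)" by simp
  qed
  also have "\<dots> = vdm (Suc n) l"
    unfolding det_vandermonde_differences[symmetric] by (rule det_def'[symmetric]) simp
  finally have I: "integral\<^sup>L ?P F = vdm (Suc n) l / fact n" .
  have "(\<integral>\<^sup>+m. (if interlaces n m l then ennreal (vdm n m) else 0) \<partial>?P) = (\<integral>\<^sup>+m. ennreal (F m) \<partial>?P)"
    by (intro nn_integral_cong) (simp flip: F)
  also have "\<dots> = ennreal (integral\<^sup>L ?P F)"
    using nn int by (intro nn_integral_eq_integral) (auto simp: F_def[abs_def])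
  finally show ?thesis unfolding I .
qed

section \<open>Gaussian Hermitian matrices and their corners\<close>

text \<open>Both measures agree on boxes. Renaming coordinates identifies the last row and the last
  column with vectors indexed by \<open>{..<n}\<close>, and for \<open>I = J\<close> it permutes the
  eigenvalues.\<close>

lemma distr_PiM_reindex_bij:
  fixes N :: "'a measure"
  assumes N: "sigma_finite_measure N" and g: "bij_betw g I J" and fin: "finite I"
  shows "distr (Pi\<^sub>M J (\<lambda>_. N)) (Pi\<^sub>M I (\<lambda>_. N)) (\<lambda>x. \<lambda>i\<in>I. x (g i)) = Pi\<^sub>M I (\<lambda>_. N)"
proof -
  interpret N: sigma_finite_measure N by fact
  interpret P: product_sigma_finite "\<lambda>_. N" ..
  have finJ: "finite J" using g fin bij_betw_finite by blast
  interpret J: finite_product_sigma_finite "\<lambda>_. N" J by standard fact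
  have gJ: "g i \<in> J" if "i \<in> I" for i using g that by (auto simp: bij_betw_def)
  have meas: "(\<lambda>x. \<lambda>i\<in>I. x (g i)) \<in> Pi\<^sub>M J (\<lambda>_. N) \<rightarrow>\<^sub>M Pi\<^sub>M I (\<lambda>_. N)"
    using gJ by (intro measurable_restrict measurable_component_singleton)
  show ?thesis
  proof (rule P.PiM_eqI[OF fin])
    fix A assume A: "\<And>i. i \<in> I \<Longrightarrow> A i \<in> sets N"
    define h where "h = the_inv_into I g"
    have h: "h j \<in> I" "g (h j) = j" if "j \<in> J" for j
      using g that the_inv_into_into[of g I j I] f_the_inv_into_f[of g I j]
      by (auto simp: h_def bij_betw_def)
    have hg: "h (g i) = i" if "i \<in> I" for i
      using g that by (auto simp: h_def bij_betw_def the_inv_into_f_f)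
    have "(\<lambda>x. \<lambda>i\<in>I. x (g i)) -` Pi\<^sub>E I A \<inter> space (Pi\<^sub>M J (\<lambda>_. N)) = Pi\<^sub>E J (\<lambda>j. A (h j))"
    proof (rule Set.set_eqI, rule iffI)
      fix x assume x: "x \<in> (\<lambda>x. \<lambda>i\<in>I. x (g i)) -` Pi\<^sub>E I A \<inter> space (Pi\<^sub>M J (\<lambda>_. N))"
      then have "x j \<in> A (h j)" if "j \<in> J" for j
        using h[OF that] by (auto simp: PiE_iff dest!: bspec[of _ _ "h j"])
      then show "x \<in> Pi\<^sub>E J (\<lambda>j. A (h j))" using x by (auto simp: space_PiM PiE_iff)
    next
      fix x assume x: "x \<in> Pi\<^sub>E J (\<lambda>j. A (h j))"
      have "x (g i) \<in> A i" if "i \<in> I" for i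
        using x gJ[OF that] hg[OF that] by (auto simp: PiE_iff dest!: bspec[of _ _ "g i"])
      moreover have "x j \<in> space N" if "j \<in> J" for j
        using x that A[OF h(1)[OF that], THEN sets.sets_into_space] by (auto simp: PiE_iff)
      ultimately show "x \<in> (\<lambda>x. \<lambda>i\<in>I. x (g i)) -` Pi\<^sub>E I A \<inter> space (Pi\<^sub>M J (\<lambda>_. N))"
        using x by (auto simp: space_PiM PiE_iff)
    qed
    then have "emeasure (distr (Pi\<^sub>M J (\<lambda>_. N)) (Pi\<^sub>M I (\<lambda>_. N)) (\<lambda>x. \<lambda>i\<in>I. x (g i))) (Pi\<^sub>E I A) =
        emeasure (Pi\<^sub>M J (\<lambda>_. N)) (Pi\<^sub>E J (\<lambda>j. A (h j)))"
      using meas A fin by (subst emeasure_distr) (auto intro!: sets_PiM_I_finite)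
    also have "\<dots> = (\<Prod>j\<in>J. emeasure N (A (h j)))"
      using A h finJ by (intro J.measure_times) auto
    also have "\<dots> = (\<Prod>i\<in>I. emeasure N (A i))"
      using g hg by (intro prod.reindex_bij_betw[OF g, symmetric, THEN trans] prod.cong) auto
    finally show "emeasure (distr (Pi\<^sub>M J (\<lambda>_. N)) (Pi\<^sub>M I (\<lambda>_. N)) (\<lambda>x. \<lambda>i\<in>I. x (g i))) (Pi\<^sub>E I A) =
        (\<Prod>i\<in>I. emeasure N (A i))" .
  qed auto
qed

lemma nn_integral_PiM_reindex:
  fixes N :: "'a measure"
  assumes "sigma_finite_measure N" "bij_betw g I J" "finite I" "f \<in> borel_measurable (Pi\<^sub>M I (\<lambda>_. N))"
  shows "(\<integral>\<^sup>+x. f (\<lambda>i\<in>I. x (g i)) \<partial>Pi\<^sub>M J (\<lambda>_. N)) = (\<integral>\<^sup>+x. f x \<partial>Pi\<^sub>M I (\<lambda>_. N))"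
proof -
  have "(\<lambda>x. \<lambda>i\<in>I. x (g i)) \<in> Pi\<^sub>M J (\<lambda>_. N) \<rightarrow>\<^sub>M Pi\<^sub>M I (\<lambda>_. N)"
    using assms(2) by (intro measurable_restrict measurable_component_singleton) (auto simp: bij_betw_def)
  from nn_integral_distr[OF this, of f] assms(4) show ?thesis
    unfolding distr_PiM_reindex_bij[OF assms(1-3)] by simp
qed

section \<open>The Gaussian law on Hermitian matrices and its sums\<close>

definition herm :: "nat \<Rightarrow> (nat \<times> nat \<Rightarrow> complex) \<Rightarrow> complex mat" where
  "herm n z = Matrix.mat n n (\<lambda>(i, j). (z (i, j) + cnj (z (j, i))) / 2)"

lemma hermitian_part_mat: "hermitian_part (Matrix.mat n n z) = herm n z"
  unfolding hermitian_part_def herm_def by (intro eq_matI) auto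

lemma herm_index: "i < n \<Longrightarrow> j < n \<Longrightarrow> herm n z $$ (i, j) = (z (i, j) + cnj (z (j, i))) / 2"
  by (simp add: herm_def)

lemma herm_hermitian: "herm n z \<in> hermitian_mats n"
  unfolding hermitian_mats_iff by (auto simp: herm_def add.commute)

lemma space_hermitian_borel[simp]: "space (hermitian_borel n) = hermitian_mats n"
  by (simp add: hermitian_borel_def)

lemma measurable_hermitian_borelI:
  assumes "\<And>x. x \<in> space N \<Longrightarrow> f x \<in> hermitian_mats n"
    and "\<And>i j. i < n \<Longrightarrow> j < n \<Longrightarrow> (\<lambda>x. f x $$ (i, j)) \<in> borel_measurable N"
  shows "f \<in> N \<rightarrow>\<^sub>M hermitian_borel n"
  unfolding hermitian_borel_def
  using assms by (intro measurable_vimage_algebra2 measurable_restrict) auto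

lemma measurable_hermitian_borel_index:
  assumes "i < n" "j < n"
  shows "(\<lambda>A. A $$ (i, j)) \<in> borel_measurable (hermitian_borel n)"
proof -
  have "(\<lambda>A. \<lambda>ij\<in>{..<n} \<times> {..<n}. A $$ ij) \<in> hermitian_borel n \<rightarrow>\<^sub>M (\<Pi>\<^sub>M ij\<in>{..<n} \<times> {..<n}. borel)"
    unfolding hermitian_borel_def by (rule measurable_vimage_algebra1) (auto simp: space_PiM)
  from measurable_compose[OF this measurable_component_singleton[of "(i, j)"]] assms show ?thesis by simp
qed

lemma measurable_hermitian_index:
  assumes "f \<in> N \<rightarrow>\<^sub>M hermitian_borel n" "i < n" "j < n"
  shows "(\<lambda>x. f x $$ (i, j)) \<in> borel_measurable N"
  using measurable_compose[OF assms(1) measurable_hermitian_borel_index[OF assms(2,3)]] .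

lemma measurable_cnj[measurable (raw)]:
  "f \<in> borel_measurable M \<Longrightarrow> (\<lambda>x. cnj (f x)) \<in> borel_measurable M"
  by (rule borel_measurable_continuous_on[OF continuous_on_cnj[OF continuous_on_id]])

lemma measurable_herm[measurable]:
  "herm n \<in> (\<Pi>\<^sub>M ij\<in>{..<n} \<times> {..<n}. cgauss s) \<rightarrow>\<^sub>M hermitian_borel n"
proof (rule measurable_hermitian_borelI)
  fix i j assume "i < n" "j < n"
  then have [measurable]: "(\<lambda>z. z (i, j)) \<in> borel_measurable (\<Pi>\<^sub>M ij\<in>{..<n} \<times> {..<n}. cgauss s)"
    "(\<lambda>z. z (j, i)) \<in> borel_measurable (\<Pi>\<^sub>M ij\<in>{..<n} \<times> {..<n}. cgauss s)"
    using measurable_component_singleton[of "(i, j)" "{..<n} \<times> {..<n}" "\<lambda>_. cgauss s"]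
      measurable_component_singleton[of "(j, i)" "{..<n} \<times> {..<n}" "\<lambda>_. cgauss s"] by simp_all
  show "(\<lambda>z. herm n z $$ (i, j)) \<in> borel_measurable (\<Pi>\<^sub>M ij\<in>{..<n} \<times> {..<n}. cgauss s)"
    unfolding herm_index[OF \<open>i < n\<close> \<open>j < n\<close>] by measurable
qed (rule herm_hermitian)

text \<open>\<open>s\<close> is the width of the independent entries before symmetrisation. It
  remains the width of the diagonal entries; off the diagonal the real and imaginary parts have
  width \<open>s / sqrt 2\<close>.\<close>

definition gue :: "real \<Rightarrow> nat \<Rightarrow> complex mat measure" where
  "gue s n = distr (\<Pi>\<^sub>M ij\<in>{..<n} \<times> {..<n}. cgauss s) (hermitian_borel n) (herm n)"

lemma sets_gue[measurable_cong, simp]: "sets (gue s n) = sets (hermitian_borel n)"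
  by (simp add: gue_def)

lemma space_gue[simp]: "space (gue s n) = hermitian_mats n"
  by (simp add: gue_def)

lemma GUE_eq_gue: "GUE n = gue (sqrt (1/2)) n"
  unfolding GUE_def gue_def std_complex_gaussian_eq hermitian_part_mat ..

lemma prob_space_gue: "0 < s \<Longrightarrow> prob_space (gue s n)"
  unfolding gue_def
  by (intro prob_space.prob_space_distr prob_space_PiM prob_space_cgauss measurable_herm)

lemma nn_integral_gue:
  "f \<in> borel_measurable (hermitian_borel n) \<Longrightarrow>
    (\<integral>\<^sup>+A. f A \<partial>gue s n) = (\<integral>\<^sup>+z. f (herm n z) \<partial>(\<Pi>\<^sub>M ij\<in>{..<n} \<times> {..<n}. cgauss s))"
  unfolding gue_def by (subst nn_integral_distr[OF measurable_herm]) simp_all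

lemma sum_mats_hermitian:
  assumes "\<And>k. k \<in> I \<Longrightarrow> B k \<in> hermitian_mats n"
  shows "sum_mats n B I \<in> hermitian_mats n"
proof -
  have h: "B k $$ (i, j) = cnj (B k $$ (j, i))" if "k \<in> I" "i < n" "j < n" for k i j
    using assms[OF that(1)] that(2,3) unfolding hermitian_mats_iff by blast
  have "(\<Sum>k\<in>I. B k $$ (i, j)) = cnj (\<Sum>k\<in>I. B k $$ (j, i))" if "i < n" "j < n" for i j
    unfolding cnj_sum using h that by (intro sum.cong refl)
  then show ?thesis unfolding hermitian_mats_iff by (simp add: sum_mats_def)
qed

lemma measurable_sum_mats:
  assumes "\<And>k. k \<in> I \<Longrightarrow> (\<lambda>x. B x k) \<in> N \<rightarrow>\<^sub>M hermitian_borel n"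
  shows "(\<lambda>x. sum_mats n (B x) I) \<in> N \<rightarrow>\<^sub>M hermitian_borel n"
proof (rule measurable_hermitian_borelI)
  show "sum_mats n (B x) I \<in> hermitian_mats n" if "x \<in> space N" for x
    using measurable_space[OF assms that] by (intro sum_mats_hermitian) simp
  show "(\<lambda>x. sum_mats n (B x) I $$ (i, j)) \<in> borel_measurable N" if "i < n" "j < n" for i j
    using that measurable_hermitian_index[OF assms that] by (simp add: sum_mats_def)
qed

text \<open>Symmetrisation is additive, so the sum of the matrices is the symmetrisation of the
  entrywise sums, whose variances add. The induction starts with one summand, since a normal density
  requires positive width.\<close>

lemma nn_integral_sum_mats_gue:
  fixes I :: "'k set"
  assumes "finite I" "I \<noteq> {}" "0 < s" "f \<in> borel_measurable (hermitian_borel n)"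
  shows "(\<integral>\<^sup>+B. f (sum_mats n B I) \<partial>Pi\<^sub>M I (\<lambda>_. gue s n)) = (\<integral>\<^sup>+A. f A \<partial>gue (sqrt (card I) * s) n)"
  using assms(1,2,4)
proof (induction I arbitrary: f rule: finite_ne_induct)
  case (singleton k)
  interpret G: prob_space "gue s n" using assms(3) by (rule prob_space_gue)
  interpret P: product_sigma_finite "\<lambda>_::'k. gue s n" ..
  have *: "Matrix.mat n n (\<lambda>ij. A $$ ij) = A" if "A \<in> hermitian_mats n" for A
    using that by (intro eq_matI) (auto simp: hermitian_mats_def)
  have "(\<integral>\<^sup>+B. f (sum_mats n B {k}) \<partial>Pi\<^sub>M {k} (\<lambda>_. gue s n)) = (\<integral>\<^sup>+B. f (B k) \<partial>Pi\<^sub>M {k} (\<lambda>_. gue s n))"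
    by (intro nn_integral_cong) (auto simp: sum_mats_def * space_PiM PiE_iff)
  also have "\<dots> = (\<integral>\<^sup>+A. f A \<partial>gue s n)"
    using singleton by (intro P.product_nn_integral_singleton) simp
  finally show ?case by simp
next
  case (insert k I)
  let ?N = "\<lambda>s. \<Pi>\<^sub>M ij\<in>{..<n} \<times> {..<n}. cgauss s"
  interpret G: prob_space "gue s n" using assms(3) by (rule prob_space_gue)
  interpret P: product_sigma_finite "\<lambda>_::'k. gue s n" ..
  note f[measurable] = insert.prems
  define t where "t = sqrt (card I) * s"
  have t: "0 < t" using insert.hyps assms(3) by (auto simp: t_def card_gt_0_iff)
  define add where "add A B = Matrix.mat n n (\<lambda>ij. A $$ ij + B $$ ij)" for A B :: "complex mat"
  have add[measurable (raw)]: "(\<lambda>x. add (X x) (Y x)) \<in> N \<rightarrow>\<^sub>M hermitian_borel n"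
    if X: "X \<in> N \<rightarrow>\<^sub>M hermitian_borel n" and Y: "Y \<in> N \<rightarrow>\<^sub>M hermitian_borel n" for X Y and N :: "'n measure"
  proof (rule measurable_hermitian_borelI)
    show "add (X x) (Y x) \<in> hermitian_mats n" if "x \<in> space N" for x
    proof -
      have "X x \<in> hermitian_mats n" "Y x \<in> hermitian_mats n"
        using measurable_space[OF X that] measurable_space[OF Y that] by auto
      then have "X x $$ (i, j) = cnj (X x $$ (j, i))" "Y x $$ (i, j) = cnj (Y x $$ (j, i))" if "i < n" "j < n" for i j
        using that unfolding hermitian_mats_iff by blast+
      then have "X x $$ (i, j) + Y x $$ (i, j) = cnj (X x $$ (j, i) + Y x $$ (j, i))" if "i < n" "j < n" for i j
        using that by (metis complex_cnj_add)
      then show ?thesis unfolding hermitian_mats_iff by (simp add: add_def)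
    qed
    show "(\<lambda>x. add (X x) (Y x) $$ (i, j)) \<in> borel_measurable N" if "i < n" "j < n" for i j
      using that measurable_hermitian_index[OF X that] measurable_hermitian_index[OF Y that] by (simp add: add_def)
  qed
  have sums[measurable]: "(\<lambda>B. sum_mats n B J) \<in> Pi\<^sub>M J (\<lambda>_. gue s n) \<rightarrow>\<^sub>M hermitian_borel n" for J :: "'k set"
    by (rule measurable_sum_mats) measurable
  have upd: "sum_mats n (B(k := A)) (insert k I) = add (sum_mats n B I) A" for A B
  proof -
    have "(\<Sum>i\<in>I. (B(k := A)) i $$ ij) = (\<Sum>i\<in>I. B i $$ ij)" for ij
      using insert.hyps by (intro sum.cong) auto
    then show ?thesis using insert.hyps
      unfolding sum_mats_def add_def by (intro eq_matI) (auto simp: add.commute)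
  qed
  have "(\<integral>\<^sup>+B. f (sum_mats n B (insert k I)) \<partial>Pi\<^sub>M (insert k I) (\<lambda>_. gue s n)) =
      (\<integral>\<^sup>+B. \<integral>\<^sup>+A. f (add (sum_mats n B I) A) \<partial>gue s n \<partial>Pi\<^sub>M I (\<lambda>_. gue s n))"
    using insert.hyps by (subst P.product_nn_integral_insert) (simp, simp, measurable, simp only: upd)
  also have "\<dots> = (\<integral>\<^sup>+X. \<integral>\<^sup>+A. f (add X A) \<partial>gue s n \<partial>gue t n)"
    unfolding t_def by (rule insert.IH[where f = "\<lambda>X. \<integral>\<^sup>+A. f (add X A) \<partial>gue s n"]) measurable
  also have "\<dots> = (\<integral>\<^sup>+w. \<integral>\<^sup>+A. f (add (herm n w) A) \<partial>gue s n \<partial>?N t)"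
    by (rule nn_integral_gue) measurable
  also have "\<dots> = (\<integral>\<^sup>+w. \<integral>\<^sup>+z. f (add (herm n w) (herm n z)) \<partial>?N s \<partial>?N t)"
    by (intro nn_integral_cong nn_integral_gue) (use herm_hermitian in measurable)
  also have "\<dots> = (\<integral>\<^sup>+w. \<integral>\<^sup>+z. f (herm n (\<lambda>ij\<in>{..<n} \<times> {..<n}. w ij + z ij)) \<partial>?N s \<partial>?N t)"
  proof -
    have "add (herm n w) (herm n z) = herm n (\<lambda>ij\<in>{..<n} \<times> {..<n}. w ij + z ij)" for w z
      by (intro eq_matI) (auto simp: add_def herm_def field_simps)
    then show ?thesis by (simp only:)
  qed
  also have "\<dots> = (\<integral>\<^sup>+z. f (herm n z) \<partial>?N (sqrt (t\<^sup>2 + s\<^sup>2)))"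
  proof (rule nn_integral_PiM_binary[where F = "\<lambda>z. f (herm n z)"])
    have "0 < sqrt (t\<^sup>2 + s\<^sup>2)" using t by (simp add: add_pos_nonneg)
    then show "sigma_finite_measure (cgauss t)" "sigma_finite_measure (cgauss s)"
      "sigma_finite_measure (cgauss (sqrt (t\<^sup>2 + s\<^sup>2)))"
      using t assms(3) prob_space_cgauss prob_space_imp_sigma_finite by blast+
    show "(\<lambda>(x, y). x + y) \<in> cgauss t \<Otimes>\<^sub>M cgauss s \<rightarrow>\<^sub>M cgauss (sqrt (t\<^sup>2 + s\<^sup>2))"
      by measurable
    show "(\<integral>\<^sup>+x. \<integral>\<^sup>+y. g (x + y) \<partial>cgauss s \<partial>cgauss t) = (\<integral>\<^sup>+x. g x \<partial>cgauss (sqrt (t\<^sup>2 + s\<^sup>2)))"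
      if "g \<in> borel_measurable (cgauss (sqrt (t\<^sup>2 + s\<^sup>2)))" for g
      using that t assms(3) by (intro nn_integral_cgauss_add) (auto simp: measurable_cong_sets[OF sets_cgauss refl])
  qed (simp, measurable)
  also have "sqrt (t\<^sup>2 + s\<^sup>2) = sqrt (card (insert k I)) * s"
    using insert.hyps assms(3)
    by (intro real_sqrt_unique) (auto simp: t_def power_mult_distrib algebra_simps)
  also have "(\<integral>\<^sup>+z. f (herm n z) \<partial>?N (sqrt (card (insert k I)) * s)) = (\<integral>\<^sup>+A. f A \<partial>gue (sqrt (card (insert k I)) * s) n)"
    by (rule nn_integral_gue[symmetric]) measurable
  finally show ?case .
qed

lemma sigma_finite_cgauss: "0 < s \<Longrightarrow> sigma_finite_measure (cgauss s)"
  by (rule prob_space_imp_sigma_finite[OF prob_space_cgauss])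

section \<open>Splitting off the last row and column\<close>

lemma measurable_bordered:
  assumes "H \<in> N \<rightarrow>\<^sub>M hermitian_borel n" "v \<in> N \<rightarrow>\<^sub>M Pi\<^sub>M {..<n} (\<lambda>_. lborel)" "a \<in> borel_measurable N"
  shows "(\<lambda>x. bordered n (H x) (v x) (a x)) \<in> N \<rightarrow>\<^sub>M hermitian_borel (Suc n)"
proof (rule measurable_hermitian_borelI)
  have H: "H x \<in> hermitian_mats n" if "x \<in> space N" for x
    using measurable_space[OF assms(1) that] by simp
  then show "bordered n (H x) (v x) (a x) \<in> hermitian_mats (Suc n)" if "x \<in> space N" for x
    using that by (intro bordered_hermitian)
  have v[measurable]: "(\<lambda>x. v x i) \<in> borel_measurable N" if "i < n" for i
    using measurable_compose[OF assms(2) measurable_component_singleton[of i]] that by simp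
  note [measurable] = assms(3) measurable_hermitian_index[OF assms(1)]
  fix i j assume ij: "i < Suc n" "j < Suc n"
  have "bordered n (H x) (v x) (a x) $$ (i, j) =
      (if i < n then if j < n then H x $$ (i, j) else v x i else if j < n then cnj (v x j) else of_real (a x))"
    if "x \<in> space N" for x
    using H[OF that] ij by (subst bordered_index) (auto simp: hermitian_mats_def)
  moreover have "(\<lambda>x. if i < n then if j < n then H x $$ (i, j) else v x i else if j < n then cnj (v x j) else of_real (a x))
      \<in> borel_measurable N"
    using v[of i] v[of j] by (cases "i < n"; cases "j < n"; simp; measurable)
  ultimately show "(\<lambda>x. bordered n (H x) (v x) (a x) $$ (i, j)) \<in> borel_measurable N"
    by (simp cong: measurable_cong)
qed

text \<open>The index square splits into the corner block, the rest of the last column, the rest of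
  the last row, and one diagonal entry. Entry (i, n) of the symmetrisation averages
  \<open>z (i, n)\<close> with the conjugate of \<open>z (n, i)\<close>; these are independent, so
  the width shrinks by \<open>sqrt 2\<close>, while the diagonal entry keeps the width
  \<open>s\<close>.\<close>

lemma nn_integral_herm_Suc:
  assumes s: "0 < s" and f[measurable]: "f \<in> borel_measurable (hermitian_borel (Suc n))"
  shows "(\<integral>\<^sup>+z. f (herm (Suc n) z) \<partial>(\<Pi>\<^sub>M ij\<in>{..<Suc n} \<times> {..<Suc n}. cgauss s)) =
    (\<integral>\<^sup>+z. \<integral>\<^sup>+v. \<integral>\<^sup>+a. f (bordered n (herm n z) v a)
      \<partial>rgauss s \<partial>Pi\<^sub>M {..<n} (\<lambda>_. cgauss (s / sqrt 2)) \<partial>(\<Pi>\<^sub>M ij\<in>{..<n} \<times> {..<n}. cgauss s))"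
proof -
  let ?P = "\<lambda>I. Pi\<^sub>M I (\<lambda>_::nat \<times> nat. cgauss s)"
  let ?V = "Pi\<^sub>M {..<n} (\<lambda>_. cgauss (s / sqrt 2))"
  let ?I = "{..<n} \<times> {..<n}"
  define E1 where "E1 = (\<lambda>i. (i, n)) ` {..<n}"
  define E2 where "E2 = (\<lambda>i. (n, i)) ` {..<n}"
  define E where "E = insert (n, n) (E1 \<union> E2)"
  have s2: "0 < s / sqrt 2" using s by simp
  have I: "{..<Suc n} \<times> {..<Suc n} = ?I \<union> E"
    by (auto simp: E_def E1_def E2_def less_Suc_eq)
  have disj: "?I \<inter> E = {}" "E1 \<inter> E2 = {}" "(n, n) \<notin> E1 \<union> E2" and fin: "finite ?I" "finite E" "finite E1" "finite E2"
    by (auto simp: E_def E1_def E2_def)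
  interpret C: prob_space "cgauss s" using s by (rule prob_space_cgauss)
  interpret R: prob_space "rgauss s" using s by (rule prob_space_rgauss)
  interpret P: product_sigma_finite "\<lambda>_::nat \<times> nat. cgauss s" ..
  interpret FE: finite_product_sigma_finite "\<lambda>_::nat \<times> nat. cgauss s" E by standard fact
  have bd[measurable (raw)]: "(\<lambda>x. bordered n (H x) (v x) (a x)) \<in> N \<rightarrow>\<^sub>M hermitian_borel (Suc n)"
    if "H \<in> N \<rightarrow>\<^sub>M hermitian_borel n" "v \<in> N \<rightarrow>\<^sub>M Pi\<^sub>M {..<n} (\<lambda>_. cgauss u)" "a \<in> borel_measurable N"
    for H v a u and N :: "'n measure"
  proof (rule measurable_bordered[OF that(1) _ that(3)])
    have "sets (Pi\<^sub>M {..<n} (\<lambda>_. cgauss u)) = sets (Pi\<^sub>M {..<n} (\<lambda>_. lborel))" by (intro sets_PiM_cong) auto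
    then show "v \<in> N \<rightarrow>\<^sub>M Pi\<^sub>M {..<n} (\<lambda>_. lborel)" using that(2) by (simp cong: measurable_cong_sets)
  qed
  have comp: "(\<lambda>y. y e) \<in> borel_measurable (?P J)" if "e \<in> J" for e J
    using measurable_component_singleton[OF that, of "\<lambda>_. cgauss s"]
    by (simp add: measurable_cong_sets[OF refl sets_cgauss])
  have inner: "(\<integral>\<^sup>+y. f (bordered n H (\<lambda>i\<in>{..<n}. (y (i, n) + cnj (y (n, i))) / 2) (Re (y (n, n)))) \<partial>?P E) =
      (\<integral>\<^sup>+v. \<integral>\<^sup>+a. f (bordered n H v a) \<partial>rgauss s \<partial>?V)" if H: "H \<in> hermitian_mats n" for H
  proof -
    have [measurable]: "(\<lambda>_. H) \<in> N \<rightarrow>\<^sub>M hermitian_borel n" for N :: "'n measure"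
      using H by simp
    have V[measurable]: "(\<lambda>y. \<lambda>i\<in>{..<n}. (y (i, n) + cnj (y (n, i))) / 2) \<in> ?P J \<rightarrow>\<^sub>M ?V"
      if "E1 \<union> E2 \<subseteq> J" for J
    proof (rule measurable_restrict)
      fix i assume "i \<in> {..<n}"
      then have "(i, n) \<in> J" "(n, i) \<in> J" using that by (auto simp: E1_def E2_def)
      note [measurable] = comp[OF this(1)] comp[OF this(2)]
      show "(\<lambda>y. (y (i, n) + cnj (y (n, i))) / 2) \<in> ?P J \<rightarrow>\<^sub>M cgauss (s / sqrt 2)" by measurable
    qed
    define K where "K v = (\<integral>\<^sup>+a. f (bordered n H v a) \<partial>rgauss s)" for v
    have K[measurable]: "K \<in> borel_measurable ?V" unfolding K_def by measurable
    have upd: "(\<lambda>i\<in>{..<n}. ((y((n, n) := t)) (i, n) + cnj ((y((n, n) := t)) (n, i))) / 2) =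
        (\<lambda>i\<in>{..<n}. (y (i, n) + cnj (y (n, i))) / 2)" for y and t :: complex
      by (auto simp: fun_eq_iff)
    \<comment> \<open>The diagonal entry can be integrated on its own, as the border does not
      involve the coordinate (n, n).\<close>
    have "(\<integral>\<^sup>+y. f (bordered n H (\<lambda>i\<in>{..<n}. (y (i, n) + cnj (y (n, i))) / 2) (Re (y (n, n)))) \<partial>?P E) =
        (\<integral>\<^sup>+y. \<integral>\<^sup>+t. f (bordered n H (\<lambda>i\<in>{..<n}. (y (i, n) + cnj (y (n, i))) / 2) (Re t)) \<partial>cgauss s \<partial>?P (E1 \<union> E2))"
      unfolding E_def
    proof (subst P.product_nn_integral_insert)
      have [measurable]: "(\<lambda>y. y (n, n)) \<in> borel_measurable (?P (insert (n, n) (E1 \<union> E2)))"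
        by (rule comp) simp
      have [measurable]: "(\<lambda>y. \<lambda>i\<in>{..<n}. (y (i, n) + cnj (y (n, i))) / 2) \<in> ?P (insert (n, n) (E1 \<union> E2)) \<rightarrow>\<^sub>M ?V"
        by (rule V) auto
      show "(\<lambda>y. f (bordered n H (\<lambda>i\<in>{..<n}. (y (i, n) + cnj (y (n, i))) / 2) (Re (y (n, n)))))
          \<in> borel_measurable (?P (insert (n, n) (E1 \<union> E2)))"
        by measurable
    qed (use fin disj in \<open>simp_all only: upd fun_upd_same finite_Un not_False_eq_True simp_thms\<close>)
    also have "\<dots> = (\<integral>\<^sup>+y. K (\<lambda>i\<in>{..<n}. (y (i, n) + cnj (y (n, i))) / 2) \<partial>?P (E1 \<union> E2))"
    proof (rule nn_integral_cong)
      fix y assume "y \<in> space (?P (E1 \<union> E2))"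
      then have v[measurable]: "(\<lambda>i\<in>{..<n}. (y (i, n) + cnj (y (n, i))) / 2) \<in> space ?V"
        by (simp add: space_PiM)
      have [measurable]: "(\<lambda>a. f (bordered n H (\<lambda>i\<in>{..<n}. (y (i, n) + cnj (y (n, i))) / 2) a)) \<in> borel_measurable borel"
        by measurable
      show "(\<integral>\<^sup>+t. f (bordered n H (\<lambda>i\<in>{..<n}. (y (i, n) + cnj (y (n, i))) / 2) (Re t)) \<partial>cgauss s) =
        K (\<lambda>i\<in>{..<n}. (y (i, n) + cnj (y (n, i))) / 2)"
        unfolding K_def by (rule nn_integral_cgauss_Re[OF s]) measurable
    qed
    also have "\<dots> = (\<integral>\<^sup>+x. \<integral>\<^sup>+y. K (\<lambda>i\<in>{..<n}. ((merge E1 E2 (x, y)) (i, n) + cnj ((merge E1 E2 (x, y)) (n, i))) / 2) \<partial>?P E2 \<partial>?P E1)"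
      by (rule P.product_nn_integral_fold[OF disj(2) fin(3,4)]) (use V[of "E1 \<union> E2"] K in measurable)
    also have "\<dots> = (\<integral>\<^sup>+x. \<integral>\<^sup>+y. K (\<lambda>i\<in>{..<n}. (x (i, n) + cnj (y (n, i))) / 2) \<partial>?P E2 \<partial>?P E1)"
    proof -
      have "(\<lambda>i\<in>{..<n}. ((merge E1 E2 (x, y)) (i, n) + cnj ((merge E1 E2 (x, y)) (n, i))) / 2) =
          (\<lambda>i\<in>{..<n}. (x (i, n) + cnj (y (n, i))) / 2)" for x y :: "nat \<times> nat \<Rightarrow> complex"
      proof
        fix i
        have "(i, n) \<in> E1 \<and> (n, i) \<in> E2 \<and> (n, i) \<notin> E1" if "i < n"
          using that by (auto simp: E1_def E2_def)
        then show "(\<lambda>i\<in>{..<n}. ((merge E1 E2 (x, y)) (i, n) + cnj ((merge E1 E2 (x, y)) (n, i))) / 2) i =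
          (\<lambda>i\<in>{..<n}. (x (i, n) + cnj (y (n, i))) / 2) i" by (auto simp: merge_def)
      qed
      then show ?thesis by (simp only:)
    qed
    \<comment> \<open>Writing both strips as restrictions exposes the bijections from i to (i, n)
      and to (n, i) that carry them to vectors.\<close>
    also have "\<dots> = (\<integral>\<^sup>+x. \<integral>\<^sup>+y. K (\<lambda>i\<in>{..<n}. ((\<lambda>i\<in>{..<n}. x (i, n)) i + cnj ((\<lambda>i\<in>{..<n}. y (n, i)) i)) / 2) \<partial>?P E2 \<partial>?P E1)"
    proof -
      have "(\<lambda>i\<in>{..<n}. ((\<lambda>i\<in>{..<n}. x (i, n)) i + cnj ((\<lambda>i\<in>{..<n}. y (n, i)) i)) / 2) =
        (\<lambda>i\<in>{..<n}. (x (i, n) + cnj (y (n, i))) / 2)" for x y :: "nat \<times> nat \<Rightarrow> complex" by auto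
      then show ?thesis by (simp only:)
    qed
    also have "\<dots> = (\<integral>\<^sup>+x. \<integral>\<^sup>+y. K (\<lambda>i\<in>{..<n}. (x i + cnj (y i)) / 2) \<partial>Pi\<^sub>M {..<n} (\<lambda>_. cgauss s) \<partial>Pi\<^sub>M {..<n} (\<lambda>_. cgauss s))"
    proof -
      have W[measurable (raw)]: "(\<lambda>p. K (\<lambda>i\<in>{..<n}. (x p i + cnj (y p i)) / 2)) \<in> borel_measurable N"
        if "x \<in> N \<rightarrow>\<^sub>M Pi\<^sub>M {..<n} (\<lambda>_. cgauss s)" "y \<in> N \<rightarrow>\<^sub>M Pi\<^sub>M {..<n} (\<lambda>_. cgauss s)"
        for x y and N :: "'n measure"
      proof (rule measurable_compose[OF _ K], rule measurable_restrict)
        fix i assume "i \<in> {..<n}"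
        from measurable_compose[OF that(1) measurable_component_singleton[OF this]]
          measurable_compose[OF that(2) measurable_component_singleton[OF this]]
        have [measurable]: "(\<lambda>p. x p i) \<in> borel_measurable N" "(\<lambda>p. y p i) \<in> borel_measurable N" by simp_all
        show "(\<lambda>p. (x p i + cnj (y p i)) / 2) \<in> N \<rightarrow>\<^sub>M cgauss (s / sqrt 2)" by measurable
      qed
      interpret FV: finite_product_sigma_finite "\<lambda>_::nat. cgauss s" "{..<n}" by standard auto
      have bij: "bij_betw (\<lambda>i. (i, n)) {..<n} E1" "bij_betw (\<lambda>i. (n, i)) {..<n} E2"
        by (auto simp: bij_betw_def inj_on_def E1_def E2_def)
      have "(\<integral>\<^sup>+x. \<integral>\<^sup>+y. K (\<lambda>i\<in>{..<n}. ((\<lambda>i\<in>{..<n}. x (i, n)) i + cnj ((\<lambda>i\<in>{..<n}. y (n, i)) i)) / 2) \<partial>?P E2 \<partial>?P E1) =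
        (\<integral>\<^sup>+x. \<integral>\<^sup>+y. K (\<lambda>i\<in>{..<n}. ((\<lambda>i\<in>{..<n}. x (i, n)) i + cnj (y i)) / 2) \<partial>Pi\<^sub>M {..<n} (\<lambda>_. cgauss s) \<partial>?P E1)"
      proof (rule nn_integral_cong)
        fix x :: "nat \<times> nat \<Rightarrow> complex"
        have [measurable]: "(\<lambda>i\<in>{..<n}. x (i, n)) \<in> space (Pi\<^sub>M {..<n} (\<lambda>_. cgauss s))" by (simp add: space_PiM)
        show "(\<integral>\<^sup>+y. K (\<lambda>i\<in>{..<n}. ((\<lambda>i\<in>{..<n}. x (i, n)) i + cnj ((\<lambda>i\<in>{..<n}. y (n, i)) i)) / 2) \<partial>?P E2) =
          (\<integral>\<^sup>+y. K (\<lambda>i\<in>{..<n}. ((\<lambda>i\<in>{..<n}. x (i, n)) i + cnj (y i)) / 2) \<partial>Pi\<^sub>M {..<n} (\<lambda>_. cgauss s))"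
          by (rule nn_integral_PiM_reindex[OF sigma_finite_cgauss[OF s] bij(2),
            where f = "\<lambda>y. K (\<lambda>i\<in>{..<n}. ((\<lambda>i\<in>{..<n}. x (i, n)) i + cnj (y i)) / 2)"]) (simp, measurable)
      qed
      also have "\<dots> = (\<integral>\<^sup>+x. \<integral>\<^sup>+y. K (\<lambda>i\<in>{..<n}. (x i + cnj (y i)) / 2) \<partial>Pi\<^sub>M {..<n} (\<lambda>_. cgauss s) \<partial>Pi\<^sub>M {..<n} (\<lambda>_. cgauss s))"
        by (rule nn_integral_PiM_reindex[OF sigma_finite_cgauss[OF s] bij(1),
            where f = "\<lambda>x. \<integral>\<^sup>+y. K (\<lambda>i\<in>{..<n}. (x i + cnj (y i)) / 2) \<partial>Pi\<^sub>M {..<n} (\<lambda>_. cgauss s)"]) (simp, measurable)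
      finally show ?thesis .
    qed
    also have "\<dots> = (\<integral>\<^sup>+v. K v \<partial>?V)"
      using s by (intro nn_integral_PiM_binary sigma_finite_cgauss nn_integral_cgauss_hermitian)
        (auto simp: measurable_cong_sets[OF sets_cgauss refl])
    finally show ?thesis unfolding K_def .
  qed
  have "(\<integral>\<^sup>+z. f (herm (Suc n) z) \<partial>?P ({..<Suc n} \<times> {..<Suc n})) =
      (\<integral>\<^sup>+x. \<integral>\<^sup>+y. f (herm (Suc n) (merge ?I E (x, y))) \<partial>?P E \<partial>?P ?I)"
    unfolding I using measurable_compose[OF measurable_herm[of "Suc n" s, unfolded I] f]
    by (intro P.product_nn_integral_fold disj fin)
  also have "\<dots> = (\<integral>\<^sup>+x. \<integral>\<^sup>+y. f (bordered n (herm n x) (\<lambda>i\<in>{..<n}. (y (i, n) + cnj (y (n, i))) / 2) (Re (y (n, n)))) \<partial>?P E \<partial>?P ?I)"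
  proof -
    have "herm (Suc n) (merge ?I E (x, y)) =
      bordered n (herm n x) (\<lambda>i\<in>{..<n}. (y (i, n) + cnj (y (n, i))) / 2) (Re (y (n, n)))" for x y
    proof (rule eq_matI)
      have H: "herm n x \<in> carrier_mat n n" by (simp add: herm_def)
      note B = bordered_carrier[OF H]
      let ?B = "bordered n (herm n x) (\<lambda>i\<in>{..<n}. (y (i, n) + cnj (y (n, i))) / 2) (Re (y (n, n)))"
      fix i j assume "i < dim_row ?B" "j < dim_col ?B"
      then have ij: "i < Suc n" "j < Suc n" using B[of "\<lambda>i\<in>{..<n}. (y (i, n) + cnj (y (n, i))) / 2" "Re (y (n, n))"] by auto
      have m: "merge ?I E (x, y) (i, j) = (if i < n \<and> j < n then x (i, j) else y (i, j))" if "i < Suc n" "j < Suc n" for i j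
        using that I by (auto simp: merge_def)
      show "herm (Suc n) (merge ?I E (x, y)) $$ (i, j) = ?B $$ (i, j)"
        using ij by (auto simp: herm_index m bordered_index[OF H] less_Suc_eq add.commute complex_eq_iff)
    qed (auto simp: herm_def bordered_def)
    then show ?thesis by (simp only:)
  qed
  also have "\<dots> = (\<integral>\<^sup>+z. \<integral>\<^sup>+v. \<integral>\<^sup>+a. f (bordered n (herm n z) v a) \<partial>rgauss s \<partial>?V \<partial>?P ?I)"
    by (intro nn_integral_cong inner herm_hermitian)
  finally show ?thesis .
qed

section \<open>The spectrum of a bordered matrix\<close>

definition oeig :: "nat \<Rightarrow> complex mat \<Rightarrow> nat \<Rightarrow> real" where
  "oeig n H = (\<lambda>i\<in>{..<n}. eigvals H ! i)"

lemma measurable_oeig[measurable]: "oeig n \<in> hermitian_borel n \<rightarrow>\<^sub>M Pi\<^sub>M {..<n} (\<lambda>_. lborel)"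
  unfolding oeig_def
  using measurable_eigvals[of "hermitian_borel n" "\<lambda>H. H" n] measurable_hermitian_borel_index
  by (intro measurable_restrict) auto

lemma oeig_cong: "char_poly A = char_poly B \<Longrightarrow> oeig n A = oeig n B"
  by (simp add: oeig_def eigvals_def)

definition arrow :: "nat \<Rightarrow> (nat \<Rightarrow> real) \<Rightarrow> (nat \<Rightarrow> complex) \<Rightarrow> real \<Rightarrow> complex mat" where
  "arrow n m v a = bordered n (mat_diag n (\<lambda>i. of_real (m i))) v a"

text \<open>Off the poles the characteristic polynomial of this arrow matrix is the product of the
  \<open>x - l i\<close>. As the substitution starts from \<open>l\<close>, this evaluates the
  integrand without describing the eigenvalues as functions of border and corner.\<close>

lemma oeig_arrow_secular:
  assumes m: "strict_mono_on {..<n} m" and il: "interlaces n m l" and l: "l \<in> extensional {..<Suc n}"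
  shows "oeig (Suc n) (arrow n m (\<lambda>i. of_real (sqrt (secular_r m l n i))) (secular_a m l n)) = l"
proof -
  let ?A = "arrow n m (\<lambda>i. of_real (sqrt (secular_r m l n i))) (secular_a m l n)"
  have inj: "inj_on m {..<n}" using m strict_mono_on_imp_inj_on by blast
  have "char_poly ?A = (\<Prod>i<Suc n. [:- of_real (l i), 1:])"
  proof (rule poly_eqI_real_cofinite[of "m ` {..<n}"])
    fix x assume x: "x \<notin> m ` {..<n}"
    then have ne: "complex_of_real x \<noteq> of_real (m i)" "x \<noteq> m i" if "i < n" for i using that by auto
    have "poly (char_poly ?A) (of_real x) = (\<Prod>i<n. of_real x - of_real (m i)) *
        (of_real x - of_real (secular_a m l n) - (\<Sum>i<n. of_real (secular_r m l n i) / (of_real x - of_real (m i))))"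
      unfolding arrow_def using ne secular_r_pos[OF m il]
      by (subst poly_char_poly_arrow) (auto intro!: sum.cong simp: less_imp_le simp flip: of_real_power)
    also have "\<dots> = of_real ((\<Prod>i<n. x - m i) * (x - secular_a m l n - (\<Sum>i<n. secular_r m l n i / (x - m i))))"
      by simp
    also have "\<dots> = of_real (\<Prod>i\<le>n. x - l i)"
      by (subst secular_partial_fractions[OF inj ne(2)]) auto
    also have "\<dots> = poly (\<Prod>i<Suc n. [:- of_real (l i), 1:]) (of_real x)"
      unfolding poly_prod by (simp add: lessThan_Suc_atMost)
    finally show "poly (char_poly ?A) (of_real x) = poly (\<Prod>i<Suc n. [:- of_real (l i), 1:]) (of_real x)" .
  qed simp
  moreover have "mono_on {..<Suc n} l"
    using interlaces_strict_mono[OF il] unfolding lessThan_Suc_atMost by (rule strict_mono_on_imp_mono_on)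
  ultimately have "eigvals ?A = map l [0..<Suc n]" by (rule eigvals_eqI)
  then show ?thesis using l by (auto simp: oeig_def extensional_def fun_eq_iff simp del: upt_Suc)
qed

text \<open>The squared moduli pass through a restriction, so that the right-hand side is a function
  of a point of the product space and their exponential law can be applied.\<close>

lemma oeig_arrow_cmod:
  "oeig (Suc n) (arrow n m v a) =
    oeig (Suc n) (arrow n m (\<lambda>i. of_real (sqrt ((\<lambda>i\<in>{..<n}. (cmod (v i))\<^sup>2) i))) a)"
  unfolding arrow_def by (intro oeig_cong char_poly_arrow_cong) auto

lemma arrow_hermitian: "arrow n m v a \<in> hermitian_mats (Suc n)"
  unfolding arrow_def by (intro bordered_hermitian mat_diag_hermitian)

lemma measurable_arrow:
  assumes "m \<in> N \<rightarrow>\<^sub>M Pi\<^sub>M {..<n} (\<lambda>_. lborel)" "\<And>i. i < n \<Longrightarrow> (\<lambda>x. v x i) \<in> borel_measurable N"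
    "a \<in> borel_measurable N"
  shows "(\<lambda>x. arrow n (m x) (v x) (a x)) \<in> N \<rightarrow>\<^sub>M hermitian_borel (Suc n)"
proof (rule measurable_hermitian_borelI[OF arrow_hermitian])
  fix i j assume ij: "i < Suc n" "j < Suc n"
  have m: "(\<lambda>x. m x i) \<in> borel_measurable N" if "i < n" for i
    using measurable_compose[OF assms(1) measurable_component_singleton[of i]] that by simp
  note [measurable] = assms(3)
  have "arrow n (m x) (v x) (a x) $$ (i, j) =
      (if i < n then if j < n then if i = j then of_real (m x j) else 0 else v x i else if j < n then cnj (v x j) else of_real (a x))" for x
    unfolding arrow_def using ij by (subst bordered_index) (auto simp: mat_diag_def)
  moreover have "(\<lambda>x. if i < n then if j < n then if i = j then of_real (m x j) else 0 else v x i else if j < n then cnj (v x j) else of_real (a x))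
      \<in> borel_measurable N"
    using assms(2)[of i] assms(2)[of j] m[of j] by (cases "i < n"; cases "j < n"; cases "i = j"; simp; measurable)
  ultimately show "(\<lambda>x. arrow n (m x) (v x) (a x) $$ (i, j)) \<in> borel_measurable N" by simp
qed

text \<open>Diagonalising \<open>H\<close> moves its unitary matrix into the border, where the
  Gaussian law absorbs it. As \<open>H\<close> is fixed, \<open>U\<close> is picked for each
  \<open>H\<close> separately and no measurable choice is involved.\<close>

lemma nn_integral_bordered_hermitian:
  assumes s: "0 < s" and t: "0 < t" and H: "H \<in> hermitian_mats n"
    and F[measurable]: "F \<in> borel_measurable (Pi\<^sub>M {..<Suc n} (\<lambda>_. lborel))"
  shows "(\<integral>\<^sup>+v. \<integral>\<^sup>+a. F (oeig (Suc n) (bordered n H v a)) \<partial>rgauss t \<partial>Pi\<^sub>M {..<n} (\<lambda>_. cgauss s)) =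
    (\<integral>\<^sup>+v. \<integral>\<^sup>+a. F (oeig (Suc n) (arrow n (oeig n H) v a)) \<partial>rgauss t \<partial>Pi\<^sub>M {..<n} (\<lambda>_. cgauss s))"
proof -
  let ?P = "Pi\<^sub>M {..<n} (\<lambda>_. lborel :: complex measure)"
  interpret R: prob_space "rgauss t" using t by (rule prob_space_rgauss)
  obtain U where U: "U \<in> carrier_mat n n" "mat_adjoint U * U = 1\<^sub>m n" "U * mat_adjoint U = 1\<^sub>m n"
    "H = U * mat_diag n (\<lambda>i. of_real (eigvals H ! i)) * mat_adjoint U"
    using hermitian_eigvals(4)[OF H] by blast
  have D: "mat_diag n (\<lambda>i. of_real (eigvals H ! i)) = mat_diag n (\<lambda>i. complex_of_real (oeig n H i))"
    by (intro eq_matI) (auto simp: mat_diag_def oeig_def)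
  define K where "K v = (\<integral>\<^sup>+a. F (oeig (Suc n) (arrow n (oeig n H) v a)) \<partial>rgauss t)" for v
  have K: "K \<in> borel_measurable ?P"
  proof -
    have ar: "(\<lambda>(v, a). arrow n (oeig n H) v a) \<in> ?P \<Otimes>\<^sub>M rgauss t \<rightarrow>\<^sub>M hermitian_borel (Suc n)"
      unfolding split_beta'
    proof (rule measurable_arrow)
      show "(\<lambda>x. oeig n H) \<in> ?P \<Otimes>\<^sub>M rgauss t \<rightarrow>\<^sub>M Pi\<^sub>M {..<n} (\<lambda>_. lborel)"
        by (rule measurable_const) (simp add: space_PiM oeig_def)
      show "(\<lambda>x. fst x i) \<in> borel_measurable (?P \<Otimes>\<^sub>M rgauss t)" if "i < n" for i
        using measurable_compose[OF measurable_fst measurable_component_singleton[of i "{..<n}" "\<lambda>_. lborel"]] that by simp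
    qed measurable
    show ?thesis unfolding K_def by (rule R.borel_measurable_nn_integral)
      (use measurable_compose[OF ar measurable_compose[OF measurable_oeig F]] in \<open>simp add: split_beta'\<close>)
  qed
  \<comment> \<open>\<open>?T'\<close> multiplies by \<open>U\<close>. Of the two unitarity
    relations, \<open>UU\<close> makes it a right inverse of \<open>?T\<close>, and
    \<open>UU'\<close> gives the preserved norm.\<close>
  let ?T = "adjoint_action n U" and ?T' = "\<lambda>y. \<lambda>i\<in>{..<n}. \<Sum>j<n. U $$ (i, j) * y j"
  have lin: "(\<lambda>y. \<lambda>i\<in>{..<n}. \<Sum>j<n. c i j * y j) \<in> ?P \<rightarrow>\<^sub>M ?P" for c :: "nat \<Rightarrow> nat \<Rightarrow> complex"
    by measurable
  have UU: "(\<Sum>j<n. cnj (U $$ (j, i)) * U $$ (j, k)) = (if i = k then 1 else 0)" if "i < n" "k < n" for i k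
  proof -
    have "(\<Sum>j<n. cnj (U $$ (j, i)) * U $$ (j, k)) = (mat_adjoint U * U) $$ (i, k)"
      using U(1) that by (subst mult_mat_index[of _ n n _ n]) auto
    then show ?thesis unfolding U(2) using that by simp
  qed
  have UU': "(\<Sum>j<n. U $$ (i, j) * cnj (U $$ (k, j))) = (if i = k then 1 else 0)" if "i < n" "k < n" for i k
  proof -
    have "(\<Sum>j<n. U $$ (i, j) * cnj (U $$ (k, j))) = (U * mat_adjoint U) $$ (i, k)"
      using U(1) that by (subst mult_mat_index[of _ n n _ n]) auto
    then show ?thesis unfolding U(3) using that by simp
  qed
  have inv: "?T (?T' y) = y" if "y \<in> {..<n} \<rightarrow>\<^sub>E UNIV" for y
  proof
    fix i
    show "?T (?T' y) i = y i"
    proof (cases "i < n")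
      case True
      have "?T (?T' y) i = (\<Sum>j<n. \<Sum>k<n. cnj (U $$ (j, i)) * U $$ (j, k) * y k)"
        using True by (simp add: adjoint_action_def sum_distrib_left mult.assoc)
      also have "\<dots> = (\<Sum>k<n. (\<Sum>j<n. cnj (U $$ (j, i)) * U $$ (j, k)) * y k)"
        unfolding sum_distrib_right by (rule sum.swap)
      also have "\<dots> = (\<Sum>k<n. (if i = k then 1 else 0) * y k)"
        using True UU by (intro sum.cong) auto
      also have "\<dots> = y i" using True by (simp add: if_distrib[of "\<lambda>x. x * _"] cong: if_cong)
      finally show ?thesis .
    next
      case False
      then show ?thesis using that by (auto simp: adjoint_action_def PiE_iff extensional_def)
    qed
  qed
  have norm: "(\<Sum>i<n. (cmod (?T x i))\<^sup>2) = (\<Sum>i<n. (cmod (x i))\<^sup>2)" for x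
  proof -
    have "complex_of_real (\<Sum>i<n. (cmod (?T x i))\<^sup>2) = (\<Sum>i<n. ?T x i * cnj (?T x i))"
      unfolding of_real_sum complex_norm_square ..
    also have "\<dots> = (\<Sum>i<n. \<Sum>j<n. \<Sum>k<n. x j * cnj (x k) * (U $$ (k, i) * cnj (U $$ (j, i))))"
      by (intro sum.cong refl) (simp add: adjoint_action_def sum_product mult_ac)
    also have "\<dots> = (\<Sum>j<n. \<Sum>k<n. \<Sum>i<n. x j * cnj (x k) * (U $$ (k, i) * cnj (U $$ (j, i))))"
      by (rule trans[OF sum.swap], rule sum.cong[OF refl], rule sum.swap)
    also have "\<dots> = (\<Sum>j<n. \<Sum>k<n. x j * cnj (x k) * (if k = j then 1 else 0))"
      unfolding sum_distrib_left[symmetric] using UU' by (intro sum.cong refl) auto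
    also have "\<dots> = (\<Sum>j<n. x j * cnj (x j))"
      by (intro sum.cong refl) (simp add: if_distrib[of "\<lambda>x. _ * x"] cong: if_cong)
    also have "\<dots> = complex_of_real (\<Sum>i<n. (cmod (x i))\<^sup>2)"
      unfolding of_real_sum complex_norm_square ..
    finally show ?thesis unfolding of_real_eq_iff .
  qed
  have "(\<integral>\<^sup>+v. \<integral>\<^sup>+a. F (oeig (Suc n) (bordered n H v a)) \<partial>rgauss t \<partial>Pi\<^sub>M {..<n} (\<lambda>_. cgauss s)) =
      (\<integral>\<^sup>+v. K (?T v) \<partial>Pi\<^sub>M {..<n} (\<lambda>_. cgauss s))"
  proof -
    have "oeig (Suc n) (bordered n H v a) = oeig (Suc n) (arrow n (oeig n H) (?T v) a)" for v a
      unfolding arrow_def D[symmetric]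
      by (rule oeig_cong, subst U(4), rule char_poly_bordered_unitary[OF U(1-3) mat_diag_dim])
    then show ?thesis by (simp only: K_def)
  qed
  also have "\<dots> = (\<integral>\<^sup>+v. K v \<partial>Pi\<^sub>M {..<n} (\<lambda>_. cgauss s))"
  proof (rule nn_integral_PiM_cgauss_isometry[OF s finite_lessThan _ lin[of "\<lambda>i j. U $$ (i, j)"] _ inv norm K])
    show "?T \<in> ?P \<rightarrow>\<^sub>M ?P" unfolding adjoint_action_def by (rule lin)
    show "?T (\<lambda>i\<in>{..<n}. x i + y i) = (\<lambda>i\<in>{..<n}. ?T x i + ?T y i)" for x y
      by (auto simp: adjoint_action_def fun_eq_iff distrib_left sum.distrib)
  qed
  finally show ?thesis unfolding K_def .
qed

section \<open>The density of the ordered eigenvalues\<close>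

text \<open>Normalisation of the density on increasing sequences, with \<open>c\<close> standing for
  the number K of summands. The factorials stop at n - 1; the missing \<open>fact n\<close> comes
  from the random labelling.\<close>

definition gue_const :: "nat \<Rightarrow> real \<Rightarrow> real" where
  "gue_const n c = (2 / c) ^ (n choose 2) / ((c * pi) powr (real n / 2) * (\<Prod>j<n. fact j))"

text \<open>The new factors have separate origins: \<open>2 / c\<close> from each of n exponential
  densities, \<open>1 / sqrt (c * pi)\<close> from the normal density of the corner entry,
  \<open>1 / fact n\<close> from integrating the Vandermonde product over interlacing
  sequences.\<close>

lemma gue_const_Suc:
  assumes "0 < c"
  shows "gue_const (Suc n) c = gue_const n c * ((2 / c) ^ n / sqrt (c * pi)) / fact n"
proof -
  have "Suc n choose 2 = (n choose 2) + n" by (simp add: numeral_2_eq_2)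
  moreover have "(c * pi) powr (real (Suc n) / 2) = (c * pi) powr (real n / 2) * sqrt (c * pi)"
    using assms by (simp add: add_divide_distrib powr_add powr_half_sqrt mult.commute)
  ultimately show ?thesis by (simp add: gue_const_def power_add)
qed

lemma gue_const_nonneg: "0 < c \<Longrightarrow> 0 \<le> gue_const n c"
  unfolding gue_const_def by (intro divide_nonneg_nonneg mult_nonneg_nonneg prod_nonneg) auto

lemma pred_strict_mono:
  fixes m :: "'x \<Rightarrow> nat \<Rightarrow> real"
  assumes "\<And>i. i < n \<Longrightarrow> (\<lambda>x. m x i) \<in> borel_measurable N"
  shows "Measurable.pred N (\<lambda>x. strict_mono_on {..<n} (m x))"
proof -
  have eq: "strict_mono_on {..<n} (m x) \<longleftrightarrow> (\<forall>i\<in>{..<n}. \<forall>j\<in>{..<n}. i < j \<longrightarrow> m x i < m x j)" for x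
    by (auto simp: strict_mono_on_def)
  show ?thesis
    unfolding eq
  proof (intro pred_intros_finite finite_lessThan)
    fix i j assume "i \<in> {..<n}" "j \<in> {..<n}"
    then have "Measurable.pred N (\<lambda>x. m x i < m x j)"
      using assms by (intro borel_measurable_pred_less) auto
    then show "Measurable.pred N (\<lambda>x. i < j \<longrightarrow> m x i < m x j)"
      by (cases "i < j") simp_all
  qed
qed

lemma measurable_vdm:
  assumes "\<And>i. i < n \<Longrightarrow> (\<lambda>x. m x i) \<in> borel_measurable N"
  shows "(\<lambda>x. vdm n (m x)) \<in> borel_measurable N"
  unfolding vdm_def using assms by (intro borel_measurable_prod borel_measurable_diff) auto

text \<open>For fixed m this is the conditional law of l, whose Jacobian is
  \<open>vdm (Suc n) l / vdm n m\<close>, with the denominator multiplied across. The growing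
  exponential in m will cancel against the Gaussian weight of m.\<close>

lemma nn_integral_arrow:
  fixes F :: "(nat \<Rightarrow> real) \<Rightarrow> ennreal"
  assumes c: "0 < c" and m: "strict_mono_on {..<n} m" "m \<in> extensional {..<n}"
    and F[measurable]: "F \<in> borel_measurable (Pi\<^sub>M {..<Suc n} (\<lambda>_. lborel))"
  shows "ennreal (vdm n m) * (\<integral>\<^sup>+v. \<integral>\<^sup>+a. F (oeig (Suc n) (arrow n m v a))
        \<partial>rgauss (sqrt (c / 2)) \<partial>Pi\<^sub>M {..<n} (\<lambda>_. cgauss (sqrt (c / 2) / sqrt 2))) =
    (\<integral>\<^sup>+l. (if interlaces n m l
        then ennreal ((2 / c) ^ n / sqrt (c * pi) * exp (((\<Sum>i<n. (m i)\<^sup>2) - (\<Sum>i<Suc n. (l i)\<^sup>2)) / c) * vdm (Suc n) l) * F l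
        else 0) \<partial>Pi\<^sub>M {..<Suc n} (\<lambda>_. lborel))"
proof -
  let ?s = "sqrt (c / 2)"
  let ?P = "Pi\<^sub>M {..<n} (\<lambda>_. lborel :: real measure)"
  have s: "0 < ?s" "0 < ?s / sqrt 2" using c by auto
  \<comment> \<open>These are the mean of each exponential variable and twice the variance of the
    corner entry.\<close>
  have s2: "2 * (?s / sqrt 2)\<^sup>2 = c / 2" "2 * ?s\<^sup>2 = c" using c by (auto simp: power_divide)
  interpret R: prob_space "rgauss ?s" using s by (intro prob_space_rgauss)
  define A where "A r a = arrow n m (\<lambda>i. of_real (sqrt (r i))) a" for r a
  have A[measurable]: "(\<lambda>(r, a). A r a) \<in> ?P \<Otimes>\<^sub>M lborel \<rightarrow>\<^sub>M hermitian_borel (Suc n)"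
    unfolding split_beta' A_def
  proof (rule measurable_arrow)
    show "(\<lambda>x. m) \<in> ?P \<Otimes>\<^sub>M lborel \<rightarrow>\<^sub>M ?P"
      using m by (intro measurable_const) (simp add: space_PiM PiE_def)
    fix i assume "i < n"
    then have [measurable]: "(\<lambda>x. fst x i) \<in> borel_measurable (?P \<Otimes>\<^sub>M lborel)"
      using measurable_compose[OF measurable_fst measurable_component_singleton[of i "{..<n}" "\<lambda>_. lborel :: real measure"]] by simp
    show "(\<lambda>x. complex_of_real (sqrt (fst x i))) \<in> borel_measurable (?P \<Otimes>\<^sub>M lborel)" by measurable
  qed measurable
  define G where "G r a = F (oeig (Suc n) (A r a))" for r a
  have G: "(\<lambda>(r, a). G r a) \<in> borel_measurable (?P \<Otimes>\<^sub>M lborel)"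
    unfolding G_def split_beta' using A[unfolded split_beta'] by measurable
  have G2[measurable (raw)]: "(\<lambda>x. G (r x) (a x)) \<in> borel_measurable N"
    if "r \<in> N \<rightarrow>\<^sub>M ?P" "a \<in> N \<rightarrow>\<^sub>M lborel" for r a and N :: "'n measure"
    using measurable_compose[OF measurable_Pair[OF that] G] by simp
  \<comment> \<open>The joint density of (r, a) on positive r: n exponential densities with mean
    \<open>c / 2\<close> times a normal density with variance \<open>c / 2\<close>.\<close>
  define w where "w r a = (2 / c) ^ n / sqrt (c * pi) * exp (- (2 * (\<Sum>i<n. r i) + a\<^sup>2) / c)" for r :: "nat \<Rightarrow> real" and a
  have w0: "0 \<le> w r a" for r a using c by (simp add: w_def)
  have wm[measurable]: "(\<lambda>x. w (fst x) (snd x)) \<in> borel_measurable (?P \<Otimes>\<^sub>M lborel)"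
    unfolding w_def by measurable
  have "(\<integral>\<^sup>+v. \<integral>\<^sup>+a. F (oeig (Suc n) (arrow n m v a)) \<partial>rgauss ?s \<partial>Pi\<^sub>M {..<n} (\<lambda>_. cgauss (?s / sqrt 2))) =
      (\<integral>\<^sup>+v. \<integral>\<^sup>+a. G (\<lambda>i\<in>{..<n}. (cmod (v i))\<^sup>2) a \<partial>rgauss ?s \<partial>Pi\<^sub>M {..<n} (\<lambda>_. cgauss (?s / sqrt 2)))"
    unfolding G_def A_def oeig_arrow_cmod[symmetric] ..
  also have "\<dots> = (\<integral>\<^sup>+r. (if \<forall>i\<in>{..<n}. 0 < r i
      then ennreal (exp (- (\<Sum>i<n. r i) / (2 * (?s / sqrt 2)\<^sup>2)) / (2 * (?s / sqrt 2)\<^sup>2) ^ card {..<n}) * (\<integral>\<^sup>+a. G r a \<partial>rgauss ?s) else 0) \<partial>?P)"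
    by (rule nn_integral_PiM_cgauss_cmod_square[OF s(2) finite_lessThan, where F = "\<lambda>r. \<integral>\<^sup>+a. G r a \<partial>rgauss ?s"])
      measurable
  also have "\<dots> = (\<integral>\<^sup>+r. \<integral>\<^sup>+a. (if \<forall>i\<in>{..<n}. 0 < r i then ennreal (w r a) * G r a else 0) \<partial>lborel \<partial>?P)"
  proof (rule nn_integral_cong)
    fix r assume r[measurable]: "r \<in> space ?P"
    show "(if \<forall>i\<in>{..<n}. 0 < r i
        then ennreal (exp (- (\<Sum>i<n. r i) / (2 * (?s / sqrt 2)\<^sup>2)) / (2 * (?s / sqrt 2)\<^sup>2) ^ card {..<n}) * (\<integral>\<^sup>+a. G r a \<partial>rgauss ?s) else 0) =
      (\<integral>\<^sup>+a. (if \<forall>i\<in>{..<n}. 0 < r i then ennreal (w r a) * G r a else 0) \<partial>lborel)"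
    proof (cases "\<forall>i\<in>{..<n}. 0 < r i")
      case False
      show ?thesis unfolding if_not_P[OF False] by simp
    next
      case True
      define k where "k = exp (- (\<Sum>i<n. r i) / (c / 2)) / (c / 2) ^ n"
      have k: "0 \<le> k" using c by (simp add: k_def)
      have "(\<integral>\<^sup>+a. G r a \<partial>rgauss ?s) = (\<integral>\<^sup>+a. ennreal (normal_density 0 ?s a) * G r a \<partial>lborel)"
        unfolding rgauss_def by (subst nn_integral_density) auto
      then have "ennreal k * (\<integral>\<^sup>+a. G r a \<partial>rgauss ?s) = (\<integral>\<^sup>+a. ennreal k * (ennreal (normal_density 0 ?s a) * G r a) \<partial>lborel)"
        by (simp add: nn_integral_cmult)
      also have "\<dots> = (\<integral>\<^sup>+a. ennreal (w r a) * G r a \<partial>lborel)"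
      proof (rule nn_integral_cong)
        fix a
        have wk: "k * normal_density 0 ?s a = w r a"
        proof -
          have 1: "normal_density 0 ?s a = exp (- a\<^sup>2 / c) / sqrt (c * pi)"
            using c by (simp add: normal_density_def mult.commute)
          have "exp (- (\<Sum>i<n. r i) / (c / 2)) * exp (- a\<^sup>2 / c) = exp (- (2 * (\<Sum>i<n. r i) + a\<^sup>2) / c)"
            unfolding exp_add[symmetric] using c by (simp add: field_simps)
          moreover have "1 / (c / 2) ^ n = (2 / c) ^ n" by (simp add: power_divide)
          moreover have "k * normal_density 0 ?s a =
              (1 / (c / 2) ^ n) / sqrt (c * pi) * (exp (- (\<Sum>i<n. r i) / (c / 2)) * exp (- a\<^sup>2 / c))"
            unfolding 1 k_def by (simp only: times_divide_eq_left times_divide_eq_right mult_1_left divide_divide_eq_left mult_ac)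
          ultimately show ?thesis unfolding w_def by (simp only:)
        qed
        have "ennreal (w r a) = ennreal k * ennreal (normal_density 0 ?s a)"
          unfolding wk[symmetric] by (rule ennreal_mult'[OF k])
        then show "ennreal k * (ennreal (normal_density 0 ?s a) * G r a) = ennreal (w r a) * G r a"
          by (simp only: mult.assoc)
      qed
      finally show ?thesis unfolding if_P[OF True] s2 k_def card_lessThan .
    qed
  qed
  finally have *: "(\<integral>\<^sup>+v. \<integral>\<^sup>+a. F (oeig (Suc n) (arrow n m v a)) \<partial>rgauss ?s \<partial>Pi\<^sub>M {..<n} (\<lambda>_. cgauss (?s / sqrt 2))) =
      (\<integral>\<^sup>+r. \<integral>\<^sup>+a. (if \<forall>i\<in>{..<n}. 0 < r i then ennreal (w r a) * G r a else 0) \<partial>lborel \<partial>?P)" .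
  then have "ennreal (vdm n m) * (\<integral>\<^sup>+v. \<integral>\<^sup>+a. F (oeig (Suc n) (arrow n m v a)) \<partial>rgauss ?s \<partial>Pi\<^sub>M {..<n} (\<lambda>_. cgauss (?s / sqrt 2))) =
      (\<integral>\<^sup>+l. (if interlaces n m l then ennreal (vdm (Suc n) l) * (ennreal (w (secular_r m l n) (secular_a m l n)) * G (secular_r m l n) (secular_a m l n)) else 0)
          \<partial>Pi\<^sub>M {..<Suc n} (\<lambda>_. lborel))"
  proof -
    have "(\<lambda>(r, a). ennreal (w r a) * G r a) \<in> borel_measurable (?P \<Otimes>\<^sub>M lborel)"
      unfolding split_beta' by measurable
    from nn_integral_interlacing[OF m(1) this, unfolded prod.case] *
    show ?thesis by (simp only:)
  qed
  also have "\<dots> = (\<integral>\<^sup>+l. (if interlaces n m l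
        then ennreal ((2 / c) ^ n / sqrt (c * pi) * exp (((\<Sum>i<n. (m i)\<^sup>2) - (\<Sum>i<Suc n. (l i)\<^sup>2)) / c) * vdm (Suc n) l) * F l
        else 0) \<partial>Pi\<^sub>M {..<Suc n} (\<lambda>_. lborel))"
  proof (rule nn_integral_cong)
    fix l :: "nat \<Rightarrow> real" assume "l \<in> space (Pi\<^sub>M {..<Suc n} (\<lambda>_. lborel))"
    then have l: "l \<in> extensional {..<Suc n}" by (simp add: space_PiM PiE_def)
    show "(if interlaces n m l then ennreal (vdm (Suc n) l) * (ennreal (w (secular_r m l n) (secular_a m l n)) * G (secular_r m l n) (secular_a m l n)) else 0) =
      (if interlaces n m l
        then ennreal ((2 / c) ^ n / sqrt (c * pi) * exp (((\<Sum>i<n. (m i)\<^sup>2) - (\<Sum>i<Suc n. (l i)\<^sup>2)) / c) * vdm (Suc n) l) * F l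
        else 0)"
    proof (cases "interlaces n m l")
      case True
      have inj: "inj_on m {..<n}" using m(1) strict_mono_on_imp_inj_on by blast
      have G: "G (secular_r m l n) (secular_a m l n) = F l"
        unfolding G_def A_def oeig_arrow_secular[OF m(1) True l] ..
      \<comment> \<open>By the trace identity the exponent depends on r and a only through the sums
        of squares of l and m.\<close>
      have w: "w (secular_r m l n) (secular_a m l n) =
          (2 / c) ^ n / sqrt (c * pi) * exp (((\<Sum>i<n. (m i)\<^sup>2) - (\<Sum>i<Suc n. (l i)\<^sup>2)) / c)" (is "_ = ?w")
        unfolding w_def lessThan_Suc_atMost secular_sum_squares[OF inj, of l] by (simp add: algebra_simps)
      have "0 \<le> ?w" using c by simp
      then have "ennreal (?w * vdm (Suc n) l) = ennreal (vdm (Suc n) l) * ennreal ?w"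
        by (subst ennreal_mult') (auto simp: mult.commute)
      then show ?thesis using True by (simp only: if_True G w mult.assoc)
    qed simp
  qed
  finally show ?thesis .
qed

text \<open>The right-hand side charges only strictly increasing sequences. Almost sure simplicity
  of the spectrum is therefore part of the induction, and it supplies the strictly increasing m that
  the step requires.\<close>

lemma nn_integral_oeig_herm:
  fixes F :: "(nat \<Rightarrow> real) \<Rightarrow> ennreal"
  assumes c: "0 < c" and "F \<in> borel_measurable (Pi\<^sub>M {..<n} (\<lambda>_. lborel))"
  shows "(\<integral>\<^sup>+z. F (oeig n (herm n z)) \<partial>(\<Pi>\<^sub>M ij\<in>{..<n} \<times> {..<n}. cgauss (sqrt (c / 2)))) =
    (\<integral>\<^sup>+l. (if strict_mono_on {..<n} l
        then ennreal (gue_const n c * (vdm n l)\<^sup>2 * exp (- (\<Sum>i<n. (l i)\<^sup>2) / c)) * F l else 0)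
      \<partial>Pi\<^sub>M {..<n} (\<lambda>_. lborel))"
  using assms(2)
proof (induction n arbitrary: F)
  case 0
  have "oeig 0 H = (\<lambda>_. undefined)" for H by (auto simp: oeig_def)
  moreover have "gue_const 0 c = 1" using c by (simp add: gue_const_def numeral_2_eq_2)
  ultimately show ?case
    by (simp add: PiM_empty nn_integral_count_space_finite vdm_def strict_mono_on_def max.absorb2)
next
  case (Suc n)
  let ?s = "sqrt (c / 2)"
  let ?P = "\<lambda>k. Pi\<^sub>M {..<k} (\<lambda>_::nat. lborel :: real measure)"
  let ?V = "Pi\<^sub>M {..<n} (\<lambda>_. cgauss (?s / sqrt 2))"
  let ?M = "\<Pi>\<^sub>M ij\<in>{..<n} \<times> {..<n}. cgauss ?s"
  have s: "0 < ?s" "0 < ?s / sqrt 2" using c by auto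
  note F[measurable] = Suc.prems
  interpret R: prob_space "rgauss ?s" using s by (intro prob_space_rgauss)
  interpret V: prob_space ?V using s by (intro prob_space_PiM prob_space_cgauss)
  interpret P0: finite_product_sigma_finite "\<lambda>_. lborel :: real measure" "{..<n}" by standard auto
  interpret P1: finite_product_sigma_finite "\<lambda>_. lborel :: real measure" "{..<Suc n}" by standard auto
  interpret PP: pair_sigma_finite "?P (Suc n)" "?P n" ..
  define \<Phi> where "\<Phi> m = (\<integral>\<^sup>+v. \<integral>\<^sup>+a. F (oeig (Suc n) (arrow n m v a)) \<partial>rgauss ?s \<partial>?V)" for m
  have \<Phi>: "\<Phi> \<in> borel_measurable (?P n)"
  proof -
    have "(\<lambda>x. arrow n (fst (fst x)) (snd (fst x)) (snd x)) \<in> (?P n \<Otimes>\<^sub>M ?V) \<Otimes>\<^sub>M rgauss ?s \<rightarrow>\<^sub>M hermitian_borel (Suc n)"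
    proof (rule measurable_arrow)
      show "(\<lambda>x. snd (fst x) i) \<in> borel_measurable ((?P n \<Otimes>\<^sub>M ?V) \<Otimes>\<^sub>M rgauss ?s)" if "i < n" for i
        using measurable_compose[OF measurable_compose[OF measurable_fst measurable_snd]
          measurable_component_singleton[of i "{..<n}" "\<lambda>_. cgauss (?s / sqrt 2)"]] that by simp
    qed measurable
    note [measurable] = measurable_compose[OF this measurable_compose[OF measurable_oeig F]]
    show ?thesis unfolding \<Phi>_def by measurable
  qed
  \<comment> \<open>\<open>q\<close> gathers the factors of the joint density of (m, l) that stay
    constant while m is integrated out.\<close>
  define q where "q m l = gue_const n c * ((2 / c) ^ n / sqrt (c * pi)) * vdm (Suc n) l * exp (- (\<Sum>i<Suc n. (l i)\<^sup>2) / c)" for m l :: "nat \<Rightarrow> real"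
  define Q where "Q m l = (if interlaces n m l then ennreal (q m l) * F l * ennreal (vdm n m) else 0)" for m l
  have Q: "(\<lambda>(l, m). Q m l) \<in> borel_measurable (?P (Suc n) \<Otimes>\<^sub>M ?P n)"
  proof -
    have [measurable]: "(\<lambda>x. fst x i) \<in> borel_measurable (?P (Suc n) \<Otimes>\<^sub>M ?P n)" if "i < Suc n" for i
      using measurable_compose[OF measurable_fst measurable_component_singleton[of i "{..<Suc n}" "\<lambda>_. lborel :: real measure"]] that by simp
    have [measurable]: "(\<lambda>x. snd x i) \<in> borel_measurable (?P (Suc n) \<Otimes>\<^sub>M ?P n)" if "i < n" for i
      using measurable_compose[OF measurable_snd measurable_component_singleton[of i "{..<n}" "\<lambda>_. lborel :: real measure"]] that by simp
    have [measurable]: "Measurable.pred (?P (Suc n) \<Otimes>\<^sub>M ?P n) (\<lambda>x. interlaces n (snd x) (fst x))"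
      by (intro pred_interlaces) auto
    have [measurable]: "(\<lambda>x. vdm (Suc n) (fst x)) \<in> borel_measurable (?P (Suc n) \<Otimes>\<^sub>M ?P n)"
      "(\<lambda>x. vdm n (snd x)) \<in> borel_measurable (?P (Suc n) \<Otimes>\<^sub>M ?P n)"
      by (intro measurable_vdm; simp)+
    have [measurable]: "(\<lambda>x. \<Sum>i<Suc n. (fst x i)\<^sup>2) \<in> borel_measurable (?P (Suc n) \<Otimes>\<^sub>M ?P n)"
      by (intro borel_measurable_sum borel_measurable_power) simp
    show ?thesis unfolding Q_def q_def split_beta' by measurable
  qed
  have q0: "0 \<le> q m l" if "interlaces n m l" for m l
    unfolding q_def using gue_const_nonneg[OF c, of n] c interlaces_vdm_nonneg[OF that]
    by (intro mult_nonneg_nonneg) auto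
  have step: "(if strict_mono_on {..<n} m
        then ennreal (gue_const n c * (vdm n m)\<^sup>2 * exp (- (\<Sum>i<n. (m i)\<^sup>2) / c)) * \<Phi> m else 0) =
      (\<integral>\<^sup>+l. Q m l \<partial>?P (Suc n))" if m: "m \<in> space (?P n)" for m
  proof (cases "strict_mono_on {..<n} m")
    case False
    then have "Q m l = 0" for l using interlaces_lower_strict_mono[of n m l] by (auto simp: Q_def)
    then show ?thesis using False by simp
  next
    case True
    \<comment> \<open>Of the two Vandermonde factors of m one stays in \<open>k\<close>; the other
      pays for the denominator of the Jacobian in \<open>nn_integral_arrow\<close>.\<close>
    define k where "k = gue_const n c * vdm n m * exp (- (\<Sum>i<n. (m i)\<^sup>2) / c)"
    have v0: "0 \<le> vdm n m" using True by (intro vdm_nonneg) (auto simp: strict_mono_on_def less_imp_le)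
    have k0: "0 \<le> k" unfolding k_def using gue_const_nonneg[OF c, of n] v0 by (intro mult_nonneg_nonneg) auto
    have mext: "m \<in> extensional {..<n}" using m by (simp add: space_PiM PiE_def)
    let ?J = "\<lambda>l. (if interlaces n m l
        then ennreal ((2 / c) ^ n / sqrt (c * pi) * exp (((\<Sum>i<n. (m i)\<^sup>2) - (\<Sum>i<Suc n. (l i)\<^sup>2)) / c) * vdm (Suc n) l) * F l
        else 0)"
    have J: "?J \<in> borel_measurable (?P (Suc n))"
    proof -
      have [measurable]: "Measurable.pred (?P (Suc n)) (\<lambda>l. interlaces n m l)"
        by (intro pred_interlaces) auto
      have [measurable]: "vdm (Suc n) \<in> borel_measurable (?P (Suc n))"
        by (intro measurable_vdm) auto
      show ?thesis by measurable
    qed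
    have "ennreal (gue_const n c * (vdm n m)\<^sup>2 * exp (- (\<Sum>i<n. (m i)\<^sup>2) / c)) * \<Phi> m =
        ennreal k * (ennreal (vdm n m) * \<Phi> m)"
    proof -
      have "gue_const n c * (vdm n m)\<^sup>2 * exp (- (\<Sum>i<n. (m i)\<^sup>2) / c) = k * vdm n m"
        by (simp add: k_def power2_eq_square)
      then show ?thesis using ennreal_mult'[OF k0, of "vdm n m"] by (simp only: mult.assoc)
    qed
    also have "\<dots> = ennreal k * (\<integral>\<^sup>+l. ?J l \<partial>?P (Suc n))"
      unfolding \<Phi>_def nn_integral_arrow[OF c True mext F] ..
    also have "\<dots> = (\<integral>\<^sup>+l. ennreal k * ?J l \<partial>?P (Suc n))"
      by (rule nn_integral_cmult[symmetric, OF J])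
    also have "\<dots> = (\<integral>\<^sup>+l. Q m l \<partial>?P (Suc n))"
    proof (rule nn_integral_cong)
      fix l
      show "ennreal k * ?J l = Q m l"
      proof (cases "interlaces n m l")
        case il: True
        have "k * ((2 / c) ^ n / sqrt (c * pi) * exp (((\<Sum>i<n. (m i)\<^sup>2) - (\<Sum>i<Suc n. (l i)\<^sup>2)) / c) * vdm (Suc n) l) =
            q m l * vdm n m * (exp (- (\<Sum>i<n. (m i)\<^sup>2) / c) * exp ((\<Sum>i<n. (m i)\<^sup>2) / c))"
        proof -
          have e: "exp ((A - B) / c) = exp (A / c) * exp (- B / c)" for A B
            by (simp add: exp_add[symmetric] diff_divide_distrib)
          show ?thesis
            unfolding k_def q_def e by (simp only: mult_ac times_divide_eq_left times_divide_eq_right)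
        qed
        \<comment> \<open>The Gaussian weight of m disappears, which leaves \<open>vdm n m\<close>
          as the only dependence on m besides the interlacing condition.\<close>
        also have "exp (- (\<Sum>i<n. (m i)\<^sup>2) / c) * exp ((\<Sum>i<n. (m i)\<^sup>2) / c) = 1"
          by (simp add: exp_add[symmetric])
        finally have kq: "k * ((2 / c) ^ n / sqrt (c * pi) * exp (((\<Sum>i<n. (m i)\<^sup>2) - (\<Sum>i<Suc n. (l i)\<^sup>2)) / c) * vdm (Suc n) l) =
            q m l * vdm n m" by (simp only: mult_1_right)
        have "ennreal k * ennreal ((2 / c) ^ n / sqrt (c * pi) * exp (((\<Sum>i<n. (m i)\<^sup>2) - (\<Sum>i<Suc n. (l i)\<^sup>2)) / c) * vdm (Suc n) l) =
            ennreal (q m l) * ennreal (vdm n m)"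
          unfolding ennreal_mult'[OF k0, symmetric] ennreal_mult'[OF q0[OF il], symmetric] kq ..
        then have "ennreal k * ?J l = ennreal (q m l) * ennreal (vdm n m) * F l"
          unfolding if_P[OF il] mult.assoc[symmetric] by (simp only:)
        then show ?thesis unfolding Q_def if_P[OF il] by (simp only: mult_ac)
      qed (simp add: Q_def)
    qed
    finally show ?thesis using True by simp
  qed
  have "(\<integral>\<^sup>+z. F (oeig (Suc n) (herm (Suc n) z)) \<partial>(\<Pi>\<^sub>M ij\<in>{..<Suc n} \<times> {..<Suc n}. cgauss ?s)) =
      (\<integral>\<^sup>+z. \<integral>\<^sup>+v. \<integral>\<^sup>+a. F (oeig (Suc n) (bordered n (herm n z) v a)) \<partial>rgauss ?s \<partial>?V \<partial>?M)"
    by (rule nn_integral_herm_Suc[OF s(1), where f = "\<lambda>H. F (oeig (Suc n) H)"]) measurable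
  also have "\<dots> = (\<integral>\<^sup>+z. \<Phi> (oeig n (herm n z)) \<partial>?M)"
    unfolding \<Phi>_def by (intro nn_integral_cong nn_integral_bordered_hermitian s herm_hermitian F)
  also have "\<dots> = (\<integral>\<^sup>+m. (if strict_mono_on {..<n} m
        then ennreal (gue_const n c * (vdm n m)\<^sup>2 * exp (- (\<Sum>i<n. (m i)\<^sup>2) / c)) * \<Phi> m else 0) \<partial>?P n)"
    by (rule Suc.IH[OF \<Phi>])
  also have "\<dots> = (\<integral>\<^sup>+m. \<integral>\<^sup>+l. Q m l \<partial>?P (Suc n) \<partial>?P n)"
    by (rule nn_integral_cong) (rule step)
  also have "\<dots> = (\<integral>\<^sup>+l. \<integral>\<^sup>+m. Q m l \<partial>?P n \<partial>?P (Suc n))"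
    by (rule PP.Fubini'[OF Q])
  also have "\<dots> = (\<integral>\<^sup>+l. (if strict_mono_on {..<Suc n} l
        then ennreal (gue_const (Suc n) c * (vdm (Suc n) l)\<^sup>2 * exp (- (\<Sum>i<Suc n. (l i)\<^sup>2) / c)) * F l else 0) \<partial>?P (Suc n))"
  proof (rule nn_integral_cong)
    fix l
    show "(\<integral>\<^sup>+m. Q m l \<partial>?P n) = (if strict_mono_on {..<Suc n} l
        then ennreal (gue_const (Suc n) c * (vdm (Suc n) l)\<^sup>2 * exp (- (\<Sum>i<Suc n. (l i)\<^sup>2) / c)) * F l else 0)"
    proof (cases "strict_mono_on {..n} l")
      case False
      then have "Q m l = 0" for m using interlaces_strict_mono[of n m l] by (auto simp: Q_def)
      then show ?thesis using False by (simp add: lessThan_Suc_atMost)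
    next
      case True
      define k where "k = gue_const n c * ((2 / c) ^ n / sqrt (c * pi)) * vdm (Suc n) l * exp (- (\<Sum>i<Suc n. (l i)\<^sup>2) / c)"
      have v0: "0 \<le> vdm (Suc n) l"
        using True by (intro vdm_nonneg) (auto simp: strict_mono_on_def less_imp_le)
      have k0: "0 \<le> k"
        unfolding k_def using gue_const_nonneg[OF c, of n] c v0 by (intro mult_nonneg_nonneg) auto
      have I: "(\<lambda>m. if interlaces n m l then ennreal (vdm n m) else 0) \<in> borel_measurable (?P n)"
      proof -
        have [measurable]: "Measurable.pred (?P n) (\<lambda>m. interlaces n m l)"
          by (intro pred_interlaces) auto
        have [measurable]: "vdm n \<in> borel_measurable (?P n)" by (intro measurable_vdm) auto
        show ?thesis by measurable
      qed
      have "(\<integral>\<^sup>+m. Q m l \<partial>?P n) = (\<integral>\<^sup>+m. ennreal k * F l * (if interlaces n m l then ennreal (vdm n m) else 0) \<partial>?P n)"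
        by (intro nn_integral_cong) (simp add: Q_def q_def k_def)
      also have "\<dots> = ennreal k * F l * ennreal (vdm (Suc n) l / fact n)"
        unfolding nn_integral_cmult[OF I] nn_integral_vdm_interlacing[OF True] ..
      also have "\<dots> = ennreal (k * (vdm (Suc n) l / fact n)) * F l"
        unfolding ennreal_mult'[OF k0] by (simp only: mult.assoc mult.commute mult.left_commute)
      also have "k * (vdm (Suc n) l / fact n) = gue_const (Suc n) c * (vdm (Suc n) l)\<^sup>2 * exp (- (\<Sum>i<Suc n. (l i)\<^sup>2) / c)"
        unfolding k_def gue_const_Suc[OF c] by (simp only: power2_eq_square times_divide_eq_left times_divide_eq_right divide_divide_eq_left mult_ac)
      finally show ?thesis using True by (simp add: lessThan_Suc_atMost)
    qed
  qed
  finally show ?case .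
qed

section \<open>The unordered eigenvalues of the sum\<close>

text \<open>Independence makes the joint law of the summands a product measure, and K summands of
  width \<open>sqrt (1/2)\<close> add up to the width \<open>sqrt (K / 2)\<close>.\<close>

lemma nn_integral_sum_iid_GUE:
  assumes "prob_space M" "1 \<le> K" "iid_GUE M n {1..K} A"
  shows "(\<lambda>\<omega>. sum_mats n (\<lambda>k. A k \<omega>) {1..K}) \<in> M \<rightarrow>\<^sub>M hermitian_borel n"
    and "f \<in> borel_measurable (hermitian_borel n) \<Longrightarrow>
      (\<integral>\<^sup>+\<omega>. f (sum_mats n (\<lambda>k. A k \<omega>) {1..K}) \<partial>M) = (\<integral>\<^sup>+H. f H \<partial>gue (sqrt (real K / 2)) n)"
proof -
  interpret prob_space M by fact
  have ind: "indep_vars (\<lambda>_. hermitian_borel n) A {1..K}"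
    and law: "\<And>k. k \<in> {1..K} \<Longrightarrow> distr M (hermitian_borel n) (A k) = gue (sqrt (1/2)) n"
    using assms(3) unfolding iid_GUE_def GUE_eq_gue by auto
  have A: "A k \<in> M \<rightarrow>\<^sub>M hermitian_borel n" if "k \<in> {1..K}" for k
    using ind that unfolding indep_vars_def by auto
  show "(\<lambda>\<omega>. sum_mats n (\<lambda>k. A k \<omega>) {1..K}) \<in> M \<rightarrow>\<^sub>M hermitian_borel n"
    using A by (intro measurable_sum_mats)
  assume f: "f \<in> borel_measurable (hermitian_borel n)"
  have "distr M (\<Pi>\<^sub>M k\<in>{1..K}. hermitian_borel n) (\<lambda>\<omega>. \<lambda>k\<in>{1..K}. A k \<omega>) =
      (\<Pi>\<^sub>M k\<in>{1..K}. distr M (hermitian_borel n) (A k))"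
    using ind A assms(2) by (subst indep_vars_iff_distr_eq_PiM'[symmetric]) auto
  also have "\<dots> = (\<Pi>\<^sub>M k\<in>{1..K}. gue (sqrt (1/2)) n)"
    by (intro PiM_cong refl law)
  finally have joint: "distr M (\<Pi>\<^sub>M k\<in>{1..K}. hermitian_borel n) (\<lambda>\<omega>. \<lambda>k\<in>{1..K}. A k \<omega>) =
      (\<Pi>\<^sub>M k\<in>{1..K}. gue (sqrt (1/2)) n)" .
  have m: "(\<lambda>\<omega>. \<lambda>k\<in>{1..K}. A k \<omega>) \<in> M \<rightarrow>\<^sub>M (\<Pi>\<^sub>M k\<in>{1..K}. hermitian_borel n)"
    using A by (intro measurable_restrict)
  have sm: "(\<lambda>B. sum_mats n B {1..K}) \<in> (\<Pi>\<^sub>M k\<in>{1..K}. hermitian_borel n) \<rightarrow>\<^sub>M hermitian_borel n"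
    by (intro measurable_sum_mats measurable_component_singleton)
  have r: "sum_mats n (\<lambda>k. A k \<omega>) {1..K} = sum_mats n (\<lambda>k\<in>{1..K}. A k \<omega>) {1..K}" for \<omega>
    by (simp add: sum_mats_def)
  have "(\<integral>\<^sup>+\<omega>. f (sum_mats n (\<lambda>k. A k \<omega>) {1..K}) \<partial>M) =
      (\<integral>\<^sup>+B. f (sum_mats n B {1..K}) \<partial>distr M (\<Pi>\<^sub>M k\<in>{1..K}. hermitian_borel n) (\<lambda>\<omega>. \<lambda>k\<in>{1..K}. A k \<omega>))"
    unfolding r using measurable_compose[OF sm f] by (subst nn_integral_distr[OF m]) simp_all
  also have "\<dots> = (\<integral>\<^sup>+H. f H \<partial>gue (sqrt (card {1..K}) * sqrt (1/2)) n)"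
    unfolding joint using assms(2) f by (intro nn_integral_sum_mats_gue) auto
  also have "sqrt (card {1..K}) * sqrt (1/2) = sqrt (real K / 2)"
    by (simp add: real_sqrt_mult[symmetric])
  finally show "(\<integral>\<^sup>+\<omega>. f (sum_mats n (\<lambda>k. A k \<omega>) {1..K}) \<partial>M) = (\<integral>\<^sup>+H. f H \<partial>gue (sqrt (real K / 2)) n)" .
qed

section \<open>From increasing to randomly labelled eigenvalues\<close>

lemma vdm_permute_square:
  assumes "p permutes {..<n}"
  shows "(vdm n (\<lambda>i. s (p i)))\<^sup>2 = (vdm n s)\<^sup>2"
proof -
  let ?A = "Matrix.mat n n (\<lambda>(i, j). s i ^ j)"
  have p: "p permutes {0..<n}" using assms by (simp add: atLeast0LessThan)
  have "det (Matrix.mat n n (\<lambda>(i, j). s (p i) ^ j)) = det (Matrix.mat n n (\<lambda>(i, j). ?A $$ (p i, j)))"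
    using permutes_in_image[OF p] by (intro arg_cong[where f = det] eq_matI) auto
  also have "\<dots> = signof p * det ?A" by (rule det_permute_rows[OF _ p]) simp
  finally show ?thesis unfolding det_vandermonde by (simp add: power_mult_distrib sign_def)
qed

lemma vdm_eq_0: "\<not> inj_on l {..<n} \<Longrightarrow> vdm n l = 0"
proof -
  assume "\<not> inj_on l {..<n}"
  then obtain i j where ij: "i < n" "j < n" "l i = l j" "i \<noteq> j" by (auto simp: inj_on_def)
  have zero: "vdm n l = 0" if "i < j" "j < n" "l i = l j" for i j
  proof -
    have "(\<Prod>k<j. l j - l k) = 0" using that by (intro prod_zero bexI[of _ i]) auto
    with that(2) have "\<exists>j\<in>{..<n}. (\<Prod>k<j. l j - l k) = 0" by blast
    then show ?thesis unfolding vdm_def by (rule prod_zero[OF finite_lessThan])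
  qed
  show ?thesis using ij zero[of i j] zero[of j i] by (cases "i < j") auto
qed

text \<open>Any such permutation lists the values of \<open>l\<close> in increasing order, and
  injectivity recovers the index from the value.\<close>

lemma unique_sorting_permutation:
  fixes l :: "nat \<Rightarrow> real"
  assumes inj: "inj_on l {..<n}"
  shows "card {p. p permutes {..<n} \<and> strict_mono_on {..<n} (\<lambda>i. l (p i))} = 1"
proof -
  define xs where "xs = sorted_list_of_set (l ` {..<n})"
  have xs: "sorted_wrt (<) xs" "set xs = l ` {..<n}" "length xs = n"
    using card_image[OF inj] by (auto simp: xs_def)
  have xs_eq: "map (\<lambda>i. l (p i)) [0..<n] = xs"
    if "p permutes {..<n}" "strict_mono_on {..<n} (\<lambda>i. l (p i))" for p
  proof (rule strict_sorted_equal[symmetric])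
    show "sorted_wrt (<) (map (\<lambda>i. l (p i)) [0..<n])"
      using that(2) by (auto simp: sorted_wrt_iff_nth_less strict_mono_on_def)
    have "(\<lambda>i. l (p i)) ` {..<n} = l ` p ` {..<n}" by (simp add: image_image)
    then show "set xs = set (map (\<lambda>i. l (p i)) [0..<n])"
      using permutes_image[OF that(1)] xs(2) by (simp add: atLeast0LessThan)
  qed (rule xs)
  \<comment> \<open>Outside the index range \<open>q\<close> is the identity, as
    \<open>permutes\<close> demands.\<close>
  define q where "q i = (if i < n then the_inv_into {..<n} l (xs ! i) else i)" for i
  have q: "q i < n" "l (q i) = xs ! i" if "i < n" for i
  proof -
    have "xs ! i \<in> l ` {..<n}" using xs that by (metis nth_mem)
    then show "q i < n" "l (q i) = xs ! i"
      using the_inv_into_into[OF inj, of "xs ! i" "{..<n}"] f_the_inv_into_f[OF inj] that by (auto simp: q_def)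
  qed
  have q_less: "xs ! i < xs ! j" if "i < j" "j < n" for i j
    using xs(1,3) that by (simp add: sorted_wrt_nth_less)
  have "inj_on q {..<n}"
    by (rule inj_onI) (metis lessThan_iff linorder_neqE_nat order_less_irrefl q(2) q_less)
  moreover have "q ` {..<n} \<subseteq> {..<n}" using q by auto
  ultimately have "bij_betw q {..<n} {..<n}"
    by (simp add: bij_betw_def endo_inj_surj)
  then have qp: "q permutes {..<n}" by (rule bij_imp_permutes) (simp add: q_def)
  have qs: "strict_mono_on {..<n} (\<lambda>i. l (q i))"
    using q q_less by (auto simp: strict_mono_on_def)
  have "p = q" if p: "p permutes {..<n}" "strict_mono_on {..<n} (\<lambda>i. l (p i))" for p
  proof
    fix i show "p i = q i"
    proof (cases "i < n")
      case True
      have "map (\<lambda>i. l (p i)) [0..<n] ! i = map (\<lambda>i. l (q i)) [0..<n] ! i"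
        unfolding xs_eq[OF p] xs_eq[OF qp qs] ..
      then have "l (p i) = l (q i)" using True by simp
      moreover have "p i < n" using permutes_in_image[OF p(1), of i] True by simp
      ultimately show ?thesis using inj q(1)[OF True] by (auto dest: inj_onD)
    next
      case False
      then show ?thesis using permutes_not_in[OF p(1), of i] by (simp add: q_def)
    qed
  qed
  then have "{p. p permutes {..<n} \<and> strict_mono_on {..<n} (\<lambda>i. l (p i))} = {q}"
    using qp qs by blast
  then show ?thesis by simp
qed

text \<open>Each injective \<open>l\<close> becomes increasing under exactly one relabelling, so the
  relabelled chambers cover the injective points exactly once. Points with equal coordinates carry
  no weight because \<open>w\<close> vanishes there.\<close>

lemma sum_nn_integral_sorted:
  fixes F w :: "(nat \<Rightarrow> real) \<Rightarrow> ennreal"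
  assumes F: "F \<in> borel_measurable (Pi\<^sub>M {..<n} (\<lambda>_. lborel))" and w: "w \<in> borel_measurable (Pi\<^sub>M {..<n} (\<lambda>_. lborel))"
    and sym: "\<And>l p. p permutes {..<n} \<Longrightarrow> w (\<lambda>i\<in>{..<n}. l (p i)) = w l"
    and ninj: "\<And>l. \<not> inj_on l {..<n} \<Longrightarrow> w l = 0"
  shows "(\<Sum>p | p permutes {..<n}. \<integral>\<^sup>+l. (if strict_mono_on {..<n} l then w l * F (\<lambda>i\<in>{..<n}. l (p i)) else 0) \<partial>Pi\<^sub>M {..<n} (\<lambda>_. lborel))
    = (\<integral>\<^sup>+l. w l * F l \<partial>Pi\<^sub>M {..<n} (\<lambda>_. lborel))"
proof -
  let ?P = "Pi\<^sub>M {..<n} (\<lambda>_. lborel :: real measure)"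
  let ?S = "{p. p permutes {..<n}}"
  note [measurable] = F w
  have comp: "(\<lambda>l. l i) \<in> borel_measurable ?P" if "i < n" for i
    using measurable_component_singleton[of i "{..<n}" "\<lambda>_. lborel :: real measure"] that by simp
  \<comment> \<open>Renaming the coordinates moves the permutation, inverted, from the argument of
    \<open>F\<close> to the ordering condition.\<close>
  define g where "g p l = (if strict_mono_on {..<n} (\<lambda>i. l (p i)) then w l * F l else 0)" for p and l :: "nat \<Rightarrow> real"
  have gm: "g p \<in> borel_measurable ?P" if "p permutes {..<n}" for p
  proof -
    have [measurable]: "Measurable.pred ?P (\<lambda>l. strict_mono_on {..<n} (\<lambda>i. l (p i)))"
      using permutes_in_image[OF that] by (intro pred_strict_mono comp) auto
    show ?thesis unfolding g_def by measurable
  qed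
  have "(\<integral>\<^sup>+l. (if strict_mono_on {..<n} l then w l * F (\<lambda>i\<in>{..<n}. l (p i)) else 0) \<partial>?P) = (\<integral>\<^sup>+l. g (inv_into UNIV p) l \<partial>?P)"
    if p: "p permutes {..<n}" for p
  proof -
    have ip: "inv_into UNIV p permutes {..<n}" by (rule permutes_inv[OF p])
    have "(if strict_mono_on {..<n} l then w l * F (\<lambda>i\<in>{..<n}. l (p i)) else 0) = g (inv_into UNIV p) (\<lambda>i\<in>{..<n}. l (p i))" for l
    proof -
      have "(\<lambda>i\<in>{..<n}. l (p i)) (inv_into UNIV p i) = l i" if "i < n" for i
        using that permutes_in_image[OF ip, of i] permutes_inverses(1)[OF p, of i] by simp
      then have "strict_mono_on {..<n} (\<lambda>i. (\<lambda>i\<in>{..<n}. l (p i)) (inv_into UNIV p i)) \<longleftrightarrow> strict_mono_on {..<n} l"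
        by (auto simp: strict_mono_on_def)
      then show ?thesis unfolding g_def sym[OF p] by (simp only:)
    qed
    then have "(\<integral>\<^sup>+l. (if strict_mono_on {..<n} l then w l * F (\<lambda>i\<in>{..<n}. l (p i)) else 0) \<partial>?P) =
        (\<integral>\<^sup>+l. g (inv_into UNIV p) (\<lambda>i\<in>{..<n}. l (p i)) \<partial>?P)" by (simp only:)
    also have "\<dots> = (\<integral>\<^sup>+l. g (inv_into UNIV p) l \<partial>?P)"
      by (rule nn_integral_PiM_reindex[OF sigma_finite_lborel permutes_imp_bij[OF p] finite_lessThan gm[OF ip]])
    finally show ?thesis .
  qed
  then have "(\<Sum>p\<in>?S. \<integral>\<^sup>+l. (if strict_mono_on {..<n} l then w l * F (\<lambda>i\<in>{..<n}. l (p i)) else 0) \<partial>?P) =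
      (\<Sum>p\<in>?S. \<integral>\<^sup>+l. g (inv_into UNIV p) l \<partial>?P)"
    by (intro sum.cong) auto
  also have "\<dots> = (\<Sum>p\<in>?S. \<integral>\<^sup>+l. g p l \<partial>?P)"
    by (rule sum_permutations_inverse[symmetric])
  also have "\<dots> = (\<integral>\<^sup>+l. (\<Sum>p\<in>?S. g p l) \<partial>?P)"
    using gm by (intro nn_integral_sum[symmetric]) auto
  also have "\<dots> = (\<integral>\<^sup>+l. w l * F l \<partial>?P)"
  proof (rule nn_integral_cong)
    fix l :: "nat \<Rightarrow> real"
    have fin: "finite ?S" by (rule finite_permutations) simp
    have "(\<Sum>p\<in>?S. g p l) = of_nat (card {p \<in> ?S. strict_mono_on {..<n} (\<lambda>i. l (p i))}) * (w l * F l)"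
      unfolding g_def using fin by (simp add: sum.If_cases Int_def)
    then show "(\<Sum>p\<in>?S. g p l) = w l * F l"
      using unique_sorting_permutation[of l n] ninj[of l] by (cases "inj_on l {..<n}") auto
  qed
  finally show ?thesis .
qed

theorem proposition3p4:
  fixes M :: "'w measure" and n K :: nat and A :: "nat \<Rightarrow> 'w \<Rightarrow> complex mat"
  assumes "prob_space M"
    and "n \<ge> 1" and "K \<ge> 1"
    and "iid_GUE M n {1..K} A"
  shows "joint_eigenvalue_density M n (\<lambda>\<omega>. sum_mats n (\<lambda>k. A k \<omega>) {1..K})
    (\<lambda>s. (2 / real K) ^ (n choose 2)
         / ((real K * pi) powr (real n / 2) * (\<Prod>j=1..n. fact j))
         * (vandermonde n s)\<^sup>2
         * exp (- (1 / real K) * (\<Sum>i<n. s i * s i)))"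
proof -
  let ?P = "Pi\<^sub>M {..<n} (\<lambda>_. lborel :: real measure)"
  let ?S = "{p. p permutes {..<n}}"
  interpret M: prob_space M by fact
  have K: "0 < real K" using assms(3) by simp
  have fin: "finite ?S" by (rule finite_permutations) simp
  have cardS: "card ?S = fact n" by (rule card_permutations) simp_all
  have "id \<in> ?S" by (simp add: permutes_id)
  then have ne: "?S \<noteq> {}" by blast
  interpret U: prob_space "uniform_count_measure ?S"
    by (rule prob_space_uniform_count_measure[OF fin ne])
  interpret MU: pair_sigma_finite M "uniform_count_measure ?S" ..
  define p where "p s = (2 / real K) ^ (n choose 2) / ((real K * pi) powr (real n / 2) * (\<Prod>j=1..n. fact j))
    * (vandermonde n s)\<^sup>2 * exp (- (1 / real K) * (\<Sum>i<n. s i * s i))" for s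
  define S where "S \<omega> = sum_mats n (\<lambda>k. A k \<omega>) {1..K}" for \<omega>
  have Smeas: "S \<in> M \<rightarrow>\<^sub>M hermitian_borel n"
    unfolding S_def by (rule nn_integral_sum_iid_GUE(1)[OF assms(1,3,4)])
  \<comment> \<open>The stated constant is \<open>gue_const n K\<close> divided by the
    \<open>fact n\<close> of the random labelling; the two Vandermonde products agree after
    squaring.\<close>
  have p_eq: "p s = gue_const n K * (vdm n s)\<^sup>2 * exp (- (\<Sum>i<n. (s i)\<^sup>2) / K) / fact n" for s
  proof -
    have "(\<Prod>j=1..n. fact j :: real) = (\<Prod>j<n. fact j) * fact n"
    proof -
      \<comment> \<open>The index 0 may be added because \<open>fact 0 = 1\<close>.\<close>
      have "(\<Prod>j=1..n. fact j :: real) = (\<Prod>j\<le>n. fact j)"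
        by (intro prod.mono_neutral_left) (auto simp: not_le)
      then show ?thesis by (simp add: lessThan_Suc_atMost[symmetric])
    qed
    then show ?thesis
      unfolding p_def gue_const_def vandermonde_square by (simp add: power2_eq_square mult.assoc)
  qed
  have p0: "0 \<le> p s" for s
    unfolding p_eq using gue_const_nonneg[OF K, of n] by (intro divide_nonneg_nonneg mult_nonneg_nonneg) auto
  have p_perm: "p (\<lambda>i. s (\<pi> i)) = p s" if "\<pi> permutes {..<n}" for s \<pi>
  proof -
    have "(\<Sum>i<n. (s (\<pi> i))\<^sup>2) = (\<Sum>i<n. (s i)\<^sup>2)"
      using sum.permute[OF that, of "\<lambda>i. (s i)\<^sup>2"] by (simp add: comp_def)
    then show ?thesis unfolding p_eq using vdm_permute_square[OF that, of s] by simp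
  qed
  have p_cong: "p s = p t" if "\<And>i. i < n \<Longrightarrow> s i = t i" for s t
    unfolding p_eq using vdm_cong[of n s t] that by simp
  have comp[measurable]: "(\<lambda>l. l i) \<in> borel_measurable ?P" if "i < n" for i
    using measurable_component_singleton[of i "{..<n}" "\<lambda>_. lborel :: real measure"] that by simp
  have pm[measurable]: "p \<in> borel_measurable ?P"
  proof -
    have [measurable]: "vdm n \<in> borel_measurable ?P" by (intro measurable_vdm comp)
    have [measurable]: "(\<lambda>s. \<Sum>i<n. (s i)\<^sup>2) \<in> borel_measurable ?P"
      by (intro borel_measurable_sum borel_measurable_power comp) simp
    show ?thesis unfolding p_eq[abs_def] by measurable
  qed
  define X where "X = (\<lambda>(\<omega>, \<pi>). \<lambda>i\<in>{..<n}. eigvals (S \<omega>) ! \<pi> i)"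
  have X_eq: "X (\<omega>, \<pi>) = (\<lambda>i\<in>{..<n}. oeig n (S \<omega>) (\<pi> i))" if "\<pi> permutes {..<n}" for \<omega> \<pi>
    unfolding X_def prod.case
  proof (rule restrict_ext)
    fix i assume "i \<in> {..<n}"
    then have "\<pi> i \<in> {..<n}" using permutes_in_image[OF that] by blast
    then show "eigvals (S \<omega>) ! \<pi> i = oeig n (S \<omega>) (\<pi> i)" by (simp add: oeig_def)
  qed
  have perm_meas[measurable]: "(\<lambda>l. \<lambda>i\<in>{..<n}. l (\<pi> i)) \<in> ?P \<rightarrow>\<^sub>M ?P" if "\<pi> permutes {..<n}" for \<pi>
  proof (intro measurable_restrict measurable_component_singleton)
    fix i assume "i \<in> {..<n}"
    then show "\<pi> i \<in> {..<n}" using permutes_in_image[OF that] by blast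
  qed
  have Xm: "X \<in> M \<Otimes>\<^sub>M uniform_count_measure ?S \<rightarrow>\<^sub>M ?P"
  proof -
    have "(\<lambda>x. X (fst x, snd x)) \<in> M \<Otimes>\<^sub>M uniform_count_measure ?S \<rightarrow>\<^sub>M ?P"
    \<comment> \<open>Only finitely many labellings occur, so measurability may be checked for each
      fixed one.\<close>
    proof (rule measurable_compose_countable'[where f = "\<lambda>\<pi> x. X (fst x, \<pi>)" and g = snd and I = ?S])
      fix \<pi> assume "\<pi> \<in> ?S"
      then have \<pi>: "\<pi> permutes {..<n}" by simp
      have "(\<lambda>x. \<lambda>i\<in>{..<n}. oeig n (S (fst x)) (\<pi> i)) \<in> M \<Otimes>\<^sub>M uniform_count_measure ?S \<rightarrow>\<^sub>M ?P"
        using measurable_compose[OF measurable_compose[OF measurable_compose[OF measurable_fst Smeas] measurable_oeig] perm_meas[OF \<pi>]] .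
      then show "(\<lambda>x. X (fst x, \<pi>)) \<in> M \<Otimes>\<^sub>M uniform_count_measure ?S \<rightarrow>\<^sub>M ?P"
        unfolding X_eq[OF \<pi>] .
    next
      show "snd \<in> M \<Otimes>\<^sub>M uniform_count_measure ?S \<rightarrow>\<^sub>M count_space ?S"
        using measurable_snd[of M "uniform_count_measure ?S"]
        by (simp add: measurable_cong_sets[OF refl sets_uniform_count_measure_count_space])
      show "countable ?S" using fin by (rule countable_finite)
    qed
    then show ?thesis by simp
  qed
  have law: "(\<integral>\<^sup>+x. F (X x) \<partial>(M \<Otimes>\<^sub>M uniform_count_measure ?S)) = (\<integral>\<^sup>+s. ennreal (p s) * F s \<partial>?P)"
    if F[measurable]: "F \<in> borel_measurable ?P" for F
  proof -
    have "(\<integral>\<^sup>+x. F (X x) \<partial>(M \<Otimes>\<^sub>M uniform_count_measure ?S)) =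
        (\<integral>\<^sup>+\<pi>. \<integral>\<^sup>+\<omega>. F (X (\<omega>, \<pi>)) \<partial>M \<partial>uniform_count_measure ?S)"
      by (rule MU.nn_integral_snd[symmetric]) (use measurable_compose[OF Xm F] in simp)
    \<comment> \<open>The uniform choice gives each labelling the weight \<open>1 / fact n\<close>;
      for a fixed labelling the vector is a rearrangement of the increasing eigenvalues.\<close>
    also have "\<dots> = (\<Sum>\<pi>\<in>?S. ennreal (1 / fact n) * (\<integral>\<^sup>+\<omega>. F (X (\<omega>, \<pi>)) \<partial>M))"
      unfolding uniform_count_measure_def by (subst nn_integral_point_measure_finite[OF fin]) (simp add: cardS)
    also have "\<dots> = (\<Sum>\<pi>\<in>?S. \<integral>\<^sup>+l. (if strict_mono_on {..<n} l then ennreal (p l) * F (\<lambda>i\<in>{..<n}. l (\<pi> i)) else 0) \<partial>?P)"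
    proof (rule sum.cong[OF refl])
      fix \<pi> assume "\<pi> \<in> ?S"
      then have \<pi>: "\<pi> permutes {..<n}" by simp
      let ?F = "\<lambda>l. F (\<lambda>i\<in>{..<n}. l (\<pi> i))"
      let ?g = "\<lambda>l. (if strict_mono_on {..<n} l
            then ennreal (gue_const n K * (vdm n l)\<^sup>2 * exp (- (\<Sum>i<n. (l i)\<^sup>2) / K)) * ?F l else 0)"
      have F': "?F \<in> borel_measurable ?P"
        by (rule measurable_compose[OF perm_meas[OF \<pi>] F])
      have gm: "?g \<in> borel_measurable ?P"
      proof -
        note [measurable] = F'
        have [measurable]: "Measurable.pred ?P (\<lambda>l. strict_mono_on {..<n} l)"
          by (intro pred_strict_mono comp)
        have [measurable]: "vdm n \<in> borel_measurable ?P" by (intro measurable_vdm comp)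
        have [measurable]: "(\<lambda>s. \<Sum>i<n. (s i)\<^sup>2) \<in> borel_measurable ?P"
          by (intro borel_measurable_sum borel_measurable_power comp) simp
        show ?thesis by measurable
      qed
      have "(\<integral>\<^sup>+\<omega>. F (X (\<omega>, \<pi>)) \<partial>M) = (\<integral>\<^sup>+H. ?F (oeig n H) \<partial>gue (sqrt (real K / 2)) n)"
        unfolding X_eq[OF \<pi>] S_def
        by (rule nn_integral_sum_iid_GUE(2)[OF assms(1,3,4), where f = "\<lambda>H. ?F (oeig n H)"])
          (rule measurable_compose[OF measurable_oeig F'])
      also have "\<dots> = (\<integral>\<^sup>+z. ?F (oeig n (herm n z)) \<partial>(\<Pi>\<^sub>M ij\<in>{..<n} \<times> {..<n}. cgauss (sqrt (real K / 2))))"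
        by (rule nn_integral_gue) (rule measurable_compose[OF measurable_oeig F'])
      also have "\<dots> = (\<integral>\<^sup>+l. ?g l \<partial>?P)"
        by (rule nn_integral_oeig_herm[OF K F'])
      finally have "ennreal (1 / fact n) * (\<integral>\<^sup>+\<omega>. F (X (\<omega>, \<pi>)) \<partial>M) = (\<integral>\<^sup>+l. ennreal (1 / fact n) * ?g l \<partial>?P)"
        using nn_integral_cmult[OF gm] by simp
      also have "\<dots> = (\<integral>\<^sup>+l. (if strict_mono_on {..<n} l then ennreal (p l) * ?F l else 0) \<partial>?P)"
      proof (rule nn_integral_cong)
        fix l
        have "ennreal (1 / fact n) * ennreal (gue_const n K * (vdm n l)\<^sup>2 * exp (- (\<Sum>i<n. (l i)\<^sup>2) / K)) = ennreal (p l)"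
          unfolding p_eq by (subst ennreal_mult'[symmetric]) simp_all
        then show "ennreal (1 / fact n) * ?g l = (if strict_mono_on {..<n} l then ennreal (p l) * ?F l else 0)"
          by (simp add: mult.assoc[symmetric])
      qed
      finally show "ennreal (1 / fact n) * (\<integral>\<^sup>+\<omega>. F (X (\<omega>, \<pi>)) \<partial>M) =
        (\<integral>\<^sup>+l. (if strict_mono_on {..<n} l then ennreal (p l) * ?F l else 0) \<partial>?P)" .
    qed
    also have "\<dots> = (\<integral>\<^sup>+s. ennreal (p s) * F s \<partial>?P)"
    proof (rule sum_nn_integral_sorted[OF F])
      show "(\<lambda>l. ennreal (p l)) \<in> borel_measurable ?P" by measurable
      show "ennreal (p (\<lambda>i\<in>{..<n}. l (\<pi> i))) = ennreal (p l)" if "\<pi> permutes {..<n}" for l \<pi>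
        using p_cong[of "\<lambda>i\<in>{..<n}. l (\<pi> i)" "\<lambda>i. l (\<pi> i)"] p_perm[OF that, of l] by simp
      show "ennreal (p l) = 0" if "\<not> inj_on l {..<n}" for l
        unfolding p_eq vdm_eq_0[OF that] by simp
    qed
    finally show ?thesis .
  qed
  have "distributed (M \<Otimes>\<^sub>M uniform_count_measure ?S) ?P X (\<lambda>s. ennreal (p s))"
    unfolding distributed_def
  proof (intro conjI Xm)
    show "(\<lambda>s. ennreal (p s)) \<in> borel_measurable ?P" by measurable
    show "distr (M \<Otimes>\<^sub>M uniform_count_measure ?S) ?P X = density ?P (\<lambda>s. ennreal (p s))"
    proof (rule measure_eqI)
      fix B assume "B \<in> sets (distr (M \<Otimes>\<^sub>M uniform_count_measure ?S) ?P X)"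
      then have B[measurable]: "B \<in> sets ?P" by simp
      have "emeasure (distr (M \<Otimes>\<^sub>M uniform_count_measure ?S) ?P X) B =
          (\<integral>\<^sup>+x. indicator B x \<partial>distr (M \<Otimes>\<^sub>M uniform_count_measure ?S) ?P X)"
        by simp
      also have "\<dots> = (\<integral>\<^sup>+x. indicator B (X x) \<partial>(M \<Otimes>\<^sub>M uniform_count_measure ?S))"
        by (rule nn_integral_distr[OF Xm]) simp
      also have "\<dots> = (\<integral>\<^sup>+s. ennreal (p s) * indicator B s \<partial>?P)"
        by (rule law) measurable
      also have "\<dots> = emeasure (density ?P (\<lambda>s. ennreal (p s))) B"
        by (rule emeasure_density[symmetric]) measurable
      finally show "emeasure (distr (M \<Otimes>\<^sub>M uniform_count_measure ?S) ?P X) B =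
          emeasure (density ?P (\<lambda>s. ennreal (p s))) B" .
    qed simp
  qed
  then show ?thesis
    unfolding joint_eigenvalue_density_def p_def[symmetric] S_def[symmetric]
    using p0 p_perm unfolding X_def by (simp add: comp_def)
qed

end
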